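(* Let $d\ge1$ and let $(X_\ell)_{\ell\in\mathbb Z^d}$ be i.i.d. random variables with values in $[0,1]$ and common distribution function $F$. Let $(z_k)_{k\ge0}$ be a sequence in $\mathbb Z^d$ with maximal local times $M_n$ and numbers of self-intersections $V_n$, and set $$Y_n(s)=\frac1{\sqrt{V_n}}\sum_{k=0}^{n-1}\big[\mathbf 1_{X_{z_k}\le s}-F(s)\big],\qquad s\in[0,1].$$ If $$\lim_n\frac{M_n^2}{V_n}=0,$$ then $Y_n$ converges weakly in $D[0,1]$ to the process $W^0_F:=W^0\circ F$, where $W^0$ is the standard Brownian bridge.
   Context: For a sequence $(z_k)_{k\ge0}$ in $\mathbb Z^d$ and $n\ge1$: $N_n(\ell):=\#\{0\le k\le n-1: z_k=\ell\}$, $M_n:=\max_\ell N_n(\ell)$, $V_n:=\#\{(j,k):0\le j,k\le n-1,\ z_j=z_k\}=\sum_\ell N_n(\ell)^2$. $D[0,1]$ is the space of cadlag functions on $[0,1]$ with the Skorokhod topology. The standard Brownian bridge $W^0$ is the centered Gaussian process with continuous paths on $[0,1]$ and covariance $\mathbb E[W^0(s_1)W^0(s_2)]=s_1\wedge s_2-s_1s_2$. *)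

theory Defs
  imports "HOL-Probability.Probability"
begin

section \<open>The space $D[0,1]$ with the Skorokhod topology\<close>

text \<open>
  Elements of $D[0,1]$ are represented by functions on the reals that are \<^term>\<open>undefined\<close> outside
  the unit interval, so that equality in $D[0,1]$ is equality of functions. The one-sided
  filters below only see points of the unit interval.
\<close>

definition cadlag :: "(real \<Rightarrow> real) set" where
  "cadlag = {f \<in> extensional {0..1}.
     (\<forall>s\<in>{0..<1}. (f \<longlongrightarrow> f s) (at_right s)) \<and>
     (\<forall>s\<in>{0<..1}. \<exists>l. (f \<longlongrightarrow> l) (at_left s))}"

definition time_change :: "(real \<Rightarrow> real) \<Rightarrow> bool" where
  "time_change \<tau> \<longleftrightarrow> strict_mono_on {0..1} \<tau> \<and> continuous_on {0..1} \<tau> \<and> \<tau> ` {0..1} = {0..1}"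

definition skorokhod_close :: "(real \<Rightarrow> real) \<Rightarrow> (real \<Rightarrow> real) \<Rightarrow> real \<Rightarrow> bool" where
  "skorokhod_close f g e \<longleftrightarrow>
     (\<exists>\<tau>. time_change \<tau> \<and> (\<forall>s\<in>{0..1}. \<bar>\<tau> s - s\<bar> \<le> e \<and> \<bar>f s - g (\<tau> s)\<bar> \<le> e))"

text \<open>
  The library's metric spaces require nonnegativity also outside the carrier, where the infimum
  may be taken over the empty set; hence the value 0 there.
\<close>

definition skorokhod_dist :: "(real \<Rightarrow> real) \<Rightarrow> (real \<Rightarrow> real) \<Rightarrow> real" where
  "skorokhod_dist f g =
     (if f \<in> cadlag \<and> g \<in> cadlag then Inf {e. skorokhod_close f g e} else 0)"

definition skorokhod_topology :: "(real \<Rightarrow> real) topology" where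
  "skorokhod_topology = Metric_space.mtopology cadlag skorokhod_dist"

text \<open>
  The constant \<^const>\<open>Metric_space.mtopology\<close> is meaningful only for an actual metric, which is what
  is established next.
\<close>

lemma time_change_id: "time_change (\<lambda>s. s)"
  by (auto simp: time_change_def strict_mono_on_def)

lemma time_change_in: "time_change \<tau> \<Longrightarrow> s \<in> {0..1} \<Longrightarrow> \<tau> s \<in> {0..1}"
  unfolding time_change_def by blast

lemma time_change_1:
  assumes "time_change \<tau>" shows "\<tau> 1 = 1"
proof -
  have "1 \<in> \<tau> ` {0..1}" using assms by (auto simp: time_change_def)
  then obtain s where s: "s \<in> {0..1}" "\<tau> s = 1" by force
  have "\<tau> s < \<tau> 1" if "s < 1"
    using assms that s by (intro strict_mono_onD[of "{0..1}" \<tau>]) (auto simp: time_change_def)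
  with s time_change_in[OF assms, of 1] show ?thesis by (cases "s < 1") auto
qed

lemma time_change_inj: "time_change \<tau> \<Longrightarrow> inj_on \<tau> {0..1}"
  unfolding time_change_def by (simp add: strict_mono_on_imp_inj_on)

lemma time_change_inv:
  assumes "time_change \<tau>" shows "time_change (inv_into {0..1} \<tau>)"
proof -
  let ?i = "inv_into {0..1} \<tau>"
  note t = assms[unfolded time_change_def] and inj = time_change_inj[OF assms]
  have b: "bij_betw \<tau> {0..1} {0..1}" using inj t by (auto simp: bij_betw_def)
  have im: "?i ` {0..1} = {0..1}"
    using bij_betw_inv_into[OF b] by (auto simp: bij_betw_def)
  have c: "continuous_on {0..1} ?i"
    using continuous_on_inv[of "{0..1}" \<tau> ?i] t inj by auto
  have "?i x < ?i y" if "x \<in> {0..1}" "y \<in> {0..1}" "x < y" for x y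
  proof (rule ccontr)
    assume "\<not> ?i x < ?i y"
    then have "?i y \<le> ?i x" by simp
    moreover have "?i x \<in> {0..1}" "?i y \<in> {0..1}" using im that by blast+
    ultimately have "\<tau> (?i y) \<le> \<tau> (?i x)"
      using t by (auto simp: strict_mono_on_leD)
    moreover have "\<tau> (?i x) = x" "\<tau> (?i y) = y" using that t by (auto intro!: f_inv_into_f)
    ultimately show False using that by simp
  qed
  with c im show ?thesis by (auto simp: time_change_def strict_mono_on_def)
qed

lemma time_change_comp:
  assumes "time_change \<sigma>" "time_change \<tau>" shows "time_change (\<lambda>s. \<sigma> (\<tau> s))"
  unfolding time_change_def
proof (intro conjI)
  show "strict_mono_on {0..1} (\<lambda>s. \<sigma> (\<tau> s))"
    using assms time_change_in[OF assms(2)]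
    unfolding strict_mono_on_def time_change_def by blast
  show "continuous_on {0..1} (\<lambda>s. \<sigma> (\<tau> s))"
    using assms unfolding time_change_def by (metis continuous_on_compose2 order_refl)
  show "(\<lambda>s. \<sigma> (\<tau> s)) ` {0..1} = {0..1}"
    using assms unfolding time_change_def by (metis image_image)
qed

lemma cadlag_bounded:
  assumes f: "f \<in> cadlag" shows "\<exists>B. \<forall>s\<in>{0..1}. \<bar>f s\<bar> \<le> B"
proof -
  have loc: "\<exists>d>0. \<exists>B. \<forall>t\<in>{0..1}. \<bar>t - s\<bar> < d \<longrightarrow> \<bar>f t\<bar> \<le> B" if s: "s \<in> {0..1}" for s
  proof -
    have "\<exists>b>s. \<exists>B. \<forall>t\<in>{0..1}. s < t \<and> t < b \<longrightarrow> \<bar>f t\<bar> \<le> B"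
    proof (cases "s < 1")
      case True
      then have "(f \<longlongrightarrow> f s) (at_right s)" using f s by (auto simp: cadlag_def)
      then have "\<forall>\<^sub>F t in at_right s. dist (f t) (f s) < 1" by (rule tendstoD) simp
      then obtain b where b: "b > s" "\<And>t. s < t \<Longrightarrow> t < b \<Longrightarrow> dist (f t) (f s) < 1"
        unfolding eventually_at_right_field by blast
      have "\<bar>f t\<bar> \<le> \<bar>f s\<bar> + 1" if "s < t" "t < b" for t
        using b(2)[OF that] by (auto simp: dist_real_def)
      then show ?thesis using b(1) by blast
    qed (use s in \<open>auto intro!: exI[of _ "s + 1"]\<close>)
    moreover have "\<exists>a<s. \<exists>B. \<forall>t\<in>{0..1}. a < t \<and> t < s \<longrightarrow> \<bar>f t\<bar> \<le> B"
    proof (cases "0 < s")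
      case True
      then have "s \<in> {0<..1}" using s by auto
      then obtain l where "(f \<longlongrightarrow> l) (at_left s)" using f unfolding cadlag_def by blast
      then have "\<forall>\<^sub>F t in at_left s. dist (f t) l < 1" by (rule tendstoD) simp
      then obtain a where a: "a < s" "\<And>t. a < t \<Longrightarrow> t < s \<Longrightarrow> dist (f t) l < 1"
        unfolding eventually_at_left_field by blast
      have "\<bar>f t\<bar> \<le> \<bar>l\<bar> + 1" if "a < t" "t < s" for t
        using a(2)[OF that] by (auto simp: dist_real_def)
      then show ?thesis using a(1) by blast
    qed (use s in \<open>auto intro!: exI[of _ "s - 1"]\<close>)
    ultimately obtain a b A B where ab: "s < b" "a < s"
      and B: "\<forall>t\<in>{0..1}. s < t \<and> t < b \<longrightarrow> \<bar>f t\<bar> \<le> B"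
      and A: "\<forall>t\<in>{0..1}. a < t \<and> t < s \<longrightarrow> \<bar>f t\<bar> \<le> A" by blast
    have "0 < min (b - s) (s - a) \<and> (\<forall>t\<in>{0..1}. \<bar>t - s\<bar> < min (b - s) (s - a) \<longrightarrow>
        \<bar>f t\<bar> \<le> max \<bar>f s\<bar> (max A B))"
    proof (intro conjI ballI impI)
      show "0 < min (b - s) (s - a)" using ab by simp
      fix t :: real assume t: "t \<in> {0..1}" "\<bar>t - s\<bar> < min (b - s) (s - a)"
      consider "t = s" | "s < t" "t < b" | "a < t" "t < s" using t by linarith
      then show "\<bar>f t\<bar> \<le> max \<bar>f s\<bar> (max A B)"
        by cases (use A B t in \<open>auto simp: le_max_iff_disj\<close>)
    qed
    then show ?thesis by blast
  qed
  then have "\<forall>s\<in>{0..1}. \<exists>d B. d > 0 \<and> (\<forall>t\<in>{0..1}. \<bar>t - s\<bar> < d \<longrightarrow> \<bar>f t\<bar> \<le> B)" by blast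
  then obtain d B where dB: "\<And>s. s \<in> {0..1} \<Longrightarrow> d s > 0"
    "\<And>s t. s \<in> {0..1} \<Longrightarrow> t \<in> {0..1} \<Longrightarrow> \<bar>t - s\<bar> < d s \<Longrightarrow> \<bar>f t\<bar> \<le> B s"
    unfolding bchoice_iff by blast
  have "{0..1} \<subseteq> (\<Union>s\<in>{0..1}. ball s (d s))" using dB(1) by force
  then obtain C where C: "C \<subseteq> {0..1}" "finite C" "{0..1} \<subseteq> (\<Union>s\<in>C. ball s (d s))"
    using compactE_image[of "{0..1::real}" "{0..1}" "\<lambda>s. ball s (d s)"] by auto
  have "\<bar>f t\<bar> \<le> (\<Sum>s\<in>C. \<bar>B s\<bar>)" if t: "t \<in> {0..1}" for t
  proof -
    obtain s where s: "s \<in> C" "t \<in> ball s (d s)" using C t by blast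
    have "\<bar>f t\<bar> \<le> B s"
      using dB(2)[of s t] s C t by (auto simp: dist_real_def abs_minus_commute)
    also have "\<dots> \<le> \<bar>B s\<bar>" by simp
    also have "\<dots> \<le> (\<Sum>s\<in>C. \<bar>B s\<bar>)" using C s by (intro member_le_sum) auto
    finally show ?thesis .
  qed
  then show ?thesis by blast
qed

lemma skorokhod_close_nonneg: "skorokhod_close f g e \<Longrightarrow> 0 \<le> e"
proof -
  assume "skorokhod_close f g e"
  then obtain \<tau> :: "real \<Rightarrow> real" where "\<forall>s\<in>{0..1}. \<bar>\<tau> s - s\<bar> \<le> e"
    unfolding skorokhod_close_def by blast
  then have "\<bar>\<tau> 0 - 0\<bar> \<le> e" by (rule bspec) simp
  then show ?thesis by linarith
qed

lemma skorokhod_close_sym: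
  assumes "skorokhod_close f g e" shows "skorokhod_close g f e"
proof -
  obtain \<tau> where t: "time_change \<tau>"
    and e: "\<And>s. s \<in> {0..1} \<Longrightarrow> \<bar>\<tau> s - s\<bar> \<le> e \<and> \<bar>f s - g (\<tau> s)\<bar> \<le> e"
    using assms unfolding skorokhod_close_def by blast
  let ?i = "inv_into {0..1} \<tau>"
  have "\<bar>?i s - s\<bar> \<le> e \<and> \<bar>g s - f (?i s)\<bar> \<le> e" if s: "s \<in> {0..1}" for s
  proof -
    have "\<tau> (?i s) = s" using s t by (auto simp: time_change_def intro!: f_inv_into_f)
    then show ?thesis
      using e[OF time_change_in[OF time_change_inv[OF t] s]] by (simp add: abs_minus_commute)
  qed
  with time_change_inv[OF t] show ?thesis unfolding skorokhod_close_def by blast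
qed

lemma skorokhod_close_trans:
  assumes "skorokhod_close f g a" "skorokhod_close g h b" shows "skorokhod_close f h (a + b)"
proof -
  obtain \<tau> where t: "time_change \<tau>"
    and a: "\<And>s. s \<in> {0..1} \<Longrightarrow> \<bar>\<tau> s - s\<bar> \<le> a \<and> \<bar>f s - g (\<tau> s)\<bar> \<le> a"
    using assms unfolding skorokhod_close_def by blast
  obtain \<sigma> where u: "time_change \<sigma>"
    and b: "\<And>s. s \<in> {0..1} \<Longrightarrow> \<bar>\<sigma> s - s\<bar> \<le> b \<and> \<bar>g s - h (\<sigma> s)\<bar> \<le> b"
    using assms unfolding skorokhod_close_def by blast
  have "\<bar>\<sigma> (\<tau> s) - s\<bar> \<le> a + b \<and> \<bar>f s - h (\<sigma> (\<tau> s))\<bar> \<le> a + b" if s: "s \<in> {0..1}" for s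
    using a[OF s] b[OF time_change_in[OF t s]] by linarith
  with time_change_comp[OF u t] show ?thesis unfolding skorokhod_close_def by blast
qed

lemma skorokhod_close_bdd_below: "bdd_below {e. skorokhod_close f g e}"
  by (rule bdd_belowI[of _ 0]) (simp add: skorokhod_close_nonneg)

lemma skorokhod_close_exists:
  assumes "f \<in> cadlag" "g \<in> cadlag" shows "{e. skorokhod_close f g e} \<noteq> {}"
proof -
  obtain A B where A: "\<forall>s\<in>{0..1}. \<bar>f s\<bar> \<le> A" and B: "\<forall>s\<in>{0..1}. \<bar>g s\<bar> \<le> B"
    using cadlag_bounded[OF assms(1)] cadlag_bounded[OF assms(2)] by blast
  have "\<bar>f 0\<bar> \<le> A" "\<bar>g 0\<bar> \<le> B" using A B by auto
  moreover have "\<bar>f s - g s\<bar> \<le> A + B" if "s \<in> {0..1}" for s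
    using A[rule_format, OF that] B[rule_format, OF that] by linarith
  ultimately have "skorokhod_close f g (A + B)"
    unfolding skorokhod_close_def by (intro exI[of _ "\<lambda>s. s"]) (auto simp: time_change_id)
  then show ?thesis by blast
qed

lemma skorokhod_dist_lessD:
  assumes "f \<in> cadlag" "g \<in> cadlag" "skorokhod_dist f g < e"
  obtains e' where "e' < e" "skorokhod_close f g e'"
proof -
  have "Inf {e. skorokhod_close f g e} < e" using assms by (simp add: skorokhod_dist_def)
  from cInf_lessD[OF skorokhod_close_exists[OF assms(1,2)] this] that show thesis by blast
qed

lemma skorokhod_dist_le: "skorokhod_close f g e \<Longrightarrow> skorokhod_dist f g \<le> e"
  unfolding skorokhod_dist_def
  using cInf_lower[OF _ skorokhod_close_bdd_below, of e f g] skorokhod_close_nonneg[of f g e] by simp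

lemma skorokhod_dist_nonneg: "0 \<le> skorokhod_dist f g"
proof (cases "f \<in> cadlag \<and> g \<in> cadlag")
  case True
  then have "0 \<le> Inf {e. skorokhod_close f g e}"
    by (intro cInf_greatest skorokhod_close_exists) (simp_all add: skorokhod_close_nonneg)
  then show ?thesis by (simp add: skorokhod_dist_def)
qed (auto simp: skorokhod_dist_def)

lemma skorokhod_dist_0_imp_eq:
  assumes f: "f \<in> cadlag" and g: "g \<in> cadlag" and d: "skorokhod_dist f g = 0"
  shows "f = g"
proof -
  have cl: "\<exists>t\<in>{0..1}. \<bar>t - s\<bar> < e \<and> \<bar>f s - g t\<bar> < e \<and> (s = 1 \<longrightarrow> t = 1)"
    if pos: "e > 0" and s: "s \<in> {0..1}" for e s
  proof -
    obtain e' where e': "e' < e" "skorokhod_close f g e'"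
      using skorokhod_dist_lessD[OF f g] d pos by metis
    then obtain \<tau> where t: "time_change \<tau>" "\<bar>\<tau> s - s\<bar> \<le> e'" "\<bar>f s - g (\<tau> s)\<bar> \<le> e'"
      using s unfolding skorokhod_close_def by blast
    then show ?thesis
      using e' time_change_in[OF t(1) s] time_change_1[OF t(1)]
      by (intro bexI[of _ "\<tau> s"]) auto
  qed
  have "f s = g s" if s: "s \<in> {0..1}" for s
  proof (rule ccontr)
    assume ne: "f s \<noteq> g s"
    define e where "e = \<bar>f s - g s\<bar> / 4"
    have e: "e > 0" using ne by (simp add: e_def)
    show False
    proof (cases "s = 1")
      case True
      then have "\<bar>f s - g s\<bar> < e" using cl[OF e s] by auto
      then show False using e by (simp add: e_def)
    next
      case False
      then have s1: "s \<in> {0..<1}" using s by auto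
      have "(f \<longlongrightarrow> f s) (at_right s)" "(g \<longlongrightarrow> g s) (at_right s)"
        using f g s1 by (auto simp: cadlag_def)
      then have "\<forall>\<^sub>F t in at_right s. dist (f t) (f s) < e" "\<forall>\<^sub>F t in at_right s. dist (g t) (g s) < e"
        using e by (auto dest: tendstoD)
      then obtain b c where b: "b > s" "\<And>t. s < t \<Longrightarrow> t < b \<Longrightarrow> dist (f t) (f s) < e"
        and c: "c > s" "\<And>t. s < t \<Longrightarrow> t < c \<Longrightarrow> dist (g t) (g s) < e"
        unfolding eventually_at_right_field by blast
      define m where "m = min (min b c) 1"
      have m: "s < m" "m \<le> b" "m \<le> c" "m \<le> 1" using b c s1 by (auto simp: m_def)
      define t where "t = (s + m) / 2"
      have t: "s < t" "t < m" using m by (auto simp: t_def)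
      define r where "r = min e (min (t - s) (m - t))"
      have "r > 0" using e t by (auto simp: r_def)
      moreover have "t \<in> {0..1}" using t m s by auto
      ultimately obtain u where u: "\<bar>u - t\<bar> < r" "\<bar>f t - g u\<bar> < r" using cl by blast
      then have "s < u" "u < c" "\<bar>f t - g u\<bar> < e" using m by (auto simp: r_def)
      then have "\<bar>g u - g s\<bar> < e" "\<bar>f t - g u\<bar> < e" "\<bar>f t - f s\<bar> < e"
        using c(2) b(2) t m by (auto simp: dist_real_def)
      moreover have "\<bar>f s - g s\<bar> \<le> \<bar>f t - f s\<bar> + \<bar>f t - g u\<bar> + \<bar>g u - g s\<bar>" by linarith
      moreover have "\<bar>f s - g s\<bar> = 4 * e" by (simp add: e_def)
      ultimately show False using e by linarith
    qed
  qed
  moreover have "f \<in> extensional {0..1}" "g \<in> extensional {0..1}"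
    using f g by (auto simp: cadlag_def)
  ultimately show ?thesis by (rule extensionalityI[rotated 2])
qed

lemma Metric_space_skorokhod: "Metric_space cadlag skorokhod_dist"
proof
  fix f g
  show "0 \<le> skorokhod_dist f g" by (rule skorokhod_dist_nonneg)
  show "skorokhod_dist f g = skorokhod_dist g f"
  proof -
    have "skorokhod_close f g = skorokhod_close g f"
      using skorokhod_close_sym by (intro ext) metis
    then show ?thesis by (simp add: skorokhod_dist_def)
  qed
  assume f: "f \<in> cadlag" and g: "g \<in> cadlag"
  have "skorokhod_dist f f = 0"
  proof (rule antisym)
    have "skorokhod_close f f 0"
      unfolding skorokhod_close_def by (intro exI[of _ "\<lambda>s. s"]) (auto simp: time_change_id)
    then show "skorokhod_dist f f \<le> 0" by (rule skorokhod_dist_le)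
    show "0 \<le> skorokhod_dist f f" by (rule skorokhod_dist_nonneg)
  qed
  then show "(skorokhod_dist f g = 0) = (f = g)"
    using skorokhod_dist_0_imp_eq[OF f g] by auto
  fix h assume h: "h \<in> cadlag"
  show "skorokhod_dist f h \<le> skorokhod_dist f g + skorokhod_dist g h"
  proof (rule field_le_epsilon)
    fix e :: real assume e: "e > 0"
    obtain a where a: "a < skorokhod_dist f g + e / 2" "skorokhod_close f g a"
      using skorokhod_dist_lessD[OF f g, of "skorokhod_dist f g + e / 2"] e by auto
    obtain b where b: "b < skorokhod_dist g h + e / 2" "skorokhod_close g h b"
      using skorokhod_dist_lessD[OF g h, of "skorokhod_dist g h + e / 2"] e by auto
    have "skorokhod_dist f h \<le> a + b"
      by (intro skorokhod_dist_le skorokhod_close_trans[OF a(2) b(2)])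
    then show "skorokhod_dist f h \<le> skorokhod_dist f g + skorokhod_dist g h + e"
      using a b by linarith
  qed
qed

lemma topspace_skorokhod: "topspace skorokhod_topology = cadlag"
  unfolding skorokhod_topology_def by (rule Metric_space.topspace_mtopology[OF Metric_space_skorokhod])

section \<open>Weak convergence of random elements of a topological space\<close>

definition borel_of :: "'a topology \<Rightarrow> 'a measure" where
  "borel_of T = sigma (topspace T) {U. openin T U}"

text \<open>
  Measurability is part of the definition because the Bochner integral of a non-measurable
  function is \<^term>\<open>0\<close>.
\<close>

definition converges_weakly_in ::
  "'c topology \<Rightarrow> 'a measure \<Rightarrow> (nat \<Rightarrow> 'a \<Rightarrow> 'c) \<Rightarrow> 'b measure \<Rightarrow> ('b \<Rightarrow> 'c) \<Rightarrow> bool" where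
  "converges_weakly_in T M Y M' Z \<longleftrightarrow>
     (\<forall>n. Y n \<in> measurable M (borel_of T)) \<and> Z \<in> measurable M' (borel_of T) \<and>
     (\<forall>h. continuous_map T euclideanreal h \<and> bounded (h ` topspace T) \<longrightarrow>
        (\<lambda>n. \<integral>\<omega>. h (Y n \<omega>) \<partial>M) \<longlonglongrightarrow> (\<integral>\<omega>. h (Z \<omega>) \<partial>M'))"

section \<open>Gaussian processes and the Brownian bridge\<close>

definition normal_measure :: "real \<Rightarrow> real \<Rightarrow> real measure" where
  "normal_measure \<mu> \<sigma> =
     (if \<sigma> = 0 then return borel \<mu> else density lborel (normal_density \<mu> \<sigma>))"

definition gaussian_rv :: "'a measure \<Rightarrow> ('a \<Rightarrow> real) \<Rightarrow> bool" where
  "gaussian_rv M X \<longleftrightarrow> X \<in> borel_measurable M \<and>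
     (\<exists>\<mu> \<sigma>. 0 \<le> \<sigma> \<and> distr M borel X = normal_measure \<mu> \<sigma>)"

definition gaussian_process :: "'a measure \<Rightarrow> 'i set \<Rightarrow> ('i \<Rightarrow> 'a \<Rightarrow> real) \<Rightarrow> bool" where
  "gaussian_process M T W \<longleftrightarrow> prob_space M \<and>
     (\<forall>I c. finite I \<and> I \<subseteq> T \<longrightarrow> gaussian_rv M (\<lambda>\<omega>. \<Sum>i\<in>I. c i * W i \<omega>))"

definition brownian_bridge :: "'a measure \<Rightarrow> (real \<Rightarrow> 'a \<Rightarrow> real) \<Rightarrow> bool" where
  "brownian_bridge M W \<longleftrightarrow> gaussian_process M {0..1} W \<and>
     (\<forall>\<omega>\<in>space M. continuous_on {0..1} (\<lambda>s. W s \<omega>)) \<and>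
     (\<forall>s\<in>{0..1}. (\<integral>\<omega>. W s \<omega> \<partial>M) = 0) \<and>
     (\<forall>s\<in>{0..1}. \<forall>t\<in>{0..1}. (\<integral>\<omega>. W s \<omega> * W t \<omega> \<partial>M) = min s t - s * t)"

section \<open>Local times and the empirical process\<close>

definition local_time :: "(nat \<Rightarrow> 'l) \<Rightarrow> nat \<Rightarrow> 'l \<Rightarrow> nat" where
  "local_time z n l = card {k. k < n \<and> z k = l}"

definition max_local_time :: "(nat \<Rightarrow> 'l) \<Rightarrow> nat \<Rightarrow> nat" where
  "max_local_time z n = Max (range (local_time z n))"

definition self_intersections :: "(nat \<Rightarrow> 'l) \<Rightarrow> nat \<Rightarrow> nat" where
  "self_intersections z n = card {(j, k). j < n \<and> k < n \<and> z j = z k}"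

text \<open>The range in \<^const>\<open>max_local_time\<close> is finite, so that \<^const>\<open>Max\<close> is the actual maximum.\<close>

lemma finite_range_local_time: "finite (range (local_time z n))"
proof (rule finite_subset)
  show "range (local_time z n) \<subseteq> {..n}"
  proof (rule image_subsetI)
    fix l
    have "card {k. k < n \<and> z k = l} \<le> card {..<n}" by (rule card_mono) auto
    then show "local_time z n l \<in> {..n}" by (simp add: local_time_def)
  qed
qed simp

definition empirical_process ::
  "('l \<Rightarrow> 'a \<Rightarrow> real) \<Rightarrow> (real \<Rightarrow> real) \<Rightarrow> (nat \<Rightarrow> 'l) \<Rightarrow> nat \<Rightarrow> 'a \<Rightarrow> real \<Rightarrow> real" where
  "empirical_process X F z n \<omega> = (\<lambda>s\<in>{0..1}.
     1 / sqrt (real (self_intersections z n)) *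
       (\<Sum>k<n. (if X (z k) \<omega> \<le> s then 1 else 0) - F s))"

end

theory Submission
  imports Defs
begin

text \<open>
  Since \<open>sqrt V\<^sub>n * Y\<^sub>n s\<close> equals the sum over sites of \<open>N\<^sub>n l * (1 - F s)\<close> or \<open>- N\<^sub>n l * F s\<close> according as
  \<open>X l \<le> s\<close> or not, \<open>Y\<^sub>n\<close> is an empirical process of i.i.d. variables with weights \<open>a\<^sub>n l = N\<^sub>n l / sqrt V\<^sub>n\<close>,
  whose squares sum to \<open>1\<close> and whose maximum tends to \<open>0\<close>. Characteristic functions of linear combinations
  then converge to the Gaussian ones. For tightness, the mixed moment of two adjacent increments is at most
  the square of the \<open>F\<close>-mass they cover, which gives a maximal inequality of Billingsley type on any finite grid;
  together with a fourth moment bound, it controls the distance between \<open>Y\<^sub>n\<close> and the step function through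
  its values at a partition whose cells \<open>[t, t')\<close> have small \<open>F\<close>-mass. Jumps of \<open>F\<close> sit at partition points, so
  that this distance is a uniform one. Weak convergence follows by testing with
  bounded Lipschitz functions, without compactness arguments in \<open>D[0,1]\<close>.
\<close>

section \<open>Random elements of metric spaces\<close>

text \<open>The hypothesis on local times says that the largest weight tends to 0. In the central
  limit theorem this makes every site negligible. In the tightness estimate it removes the obstacle
  that shapes the proof: the fourth moment of an increment of mass \<open>p\<close> is only bounded
  by \<open>3 * p\<^sup>2 + S4 * p\<close>, with \<open>S4\<close> the sum of the fourth powers of
  the weights, and the linear term rules out chaining over single increments at fixed
  \<open>n\<close>. Two adjacent increments come from disjoint intervals, so their mixed moment is
  quadratic in the mass; this suffices inside a block. Only the increment over a whole block pays
  the linear term, and these terms add up to a multiple of \<open>S4\<close>, which vanishes as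
  \<open>n\<close> grows. The parameters are therefore chosen in the order: tolerance, partition,
  \<open>n\<close>. Time changes other than the identity are constructed only to compare a fixed
  path with its step function on a fine grid that may miss the jumps of that path; for the empirical
  process these sit at the random points \<open>X l \<omega>\<close>.\<close>

lemma space_borel_of [simp]: "space (borel_of T) = topspace T"
  by (simp add: borel_of_def space_measure_of_conv)

lemma sets_borel_of_openin [intro]: "openin T U \<Longrightarrow> U \<in> sets (borel_of T)"
proof -
  have *: "{U. openin T U} \<subseteq> Pow (topspace T)" using openin_subset by auto
  show "openin T U \<Longrightarrow> U \<in> sets (borel_of T)"
    unfolding borel_of_def sets_measure_of[OF *] by (rule sigma_sets.Basic) simp
qed

lemma measurable_borel_ofI:
  assumes "\<And>\<omega>. \<omega> \<in> space M \<Longrightarrow> f \<omega> \<in> topspace T"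
    and "\<And>U. openin T U \<Longrightarrow> f -` U \<inter> space M \<in> sets M"
  shows "f \<in> measurable M (borel_of T)"
  unfolding borel_of_def
  by (rule measurable_measure_of) (use assms in \<open>auto dest: openin_subset\<close>)

lemma borel_of_continuous_map_compose:
  assumes "f \<in> measurable M (borel_of T)" "continuous_map T euclideanreal h"
  shows "(\<lambda>\<omega>. h (f \<omega>)) \<in> borel_measurable M"
proof (rule borel_measurableI)
  fix U :: "real set" assume "open U"
  then have "openin T {x \<in> topspace T. h x \<in> U}"
    using assms(2) by (auto simp: continuous_map_def)
  then have "f -` {x \<in> topspace T. h x \<in> U} \<inter> space M \<in> sets M"
    by (intro measurable_sets[OF assms(1)]) auto
  moreover have "(\<lambda>\<omega>. h (f \<omega>)) -` U \<inter> space M = f -` {x \<in> topspace T. h x \<in> U} \<inter> space M"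
    using measurable_space[OF assms(1)] by auto
  ultimately show "(\<lambda>\<omega>. h (f \<omega>)) -` U \<inter> space M \<in> sets M" by simp
qed

context Metric_space
begin

lemma Lipschitz_imp_continuous_map:
  assumes "\<And>x y. x \<in> M \<Longrightarrow> y \<in> M \<Longrightarrow> \<bar>g x - g y\<bar> \<le> L * d x y"
  shows "continuous_map mtopology euclideanreal g"
  unfolding continuous_map_def
proof (intro conjI allI impI)
  show "g \<in> topspace mtopology \<rightarrow> topspace euclideanreal" by simp
  fix U :: "real set" assume "openin euclideanreal U"
  then have U: "open U" by simp
  show "openin mtopology {x \<in> topspace mtopology. g x \<in> U}"
    unfolding openin_mtopology
  proof (intro conjI allI impI)
    fix x assume x: "x \<in> {x \<in> topspace mtopology. g x \<in> U}"
    then obtain e where e: "e > 0" "\<And>y. \<bar>y - g x\<bar> < e \<Longrightarrow> y \<in> U"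
      using U by (auto simp: open_dist dist_real_def)
    \<comment> \<open>The sign of \<open>L\<close> is not assumed and \<open>L\<close> may be
      \<open>0\<close>, whence \<open>\<bar>L\<bar> + 1\<close> in the radius.\<close>
    have "mball x (e / (\<bar>L\<bar> + 1)) \<subseteq> {x \<in> topspace mtopology. g x \<in> U}"
    proof
      fix y assume y: "y \<in> mball x (e / (\<bar>L\<bar> + 1))"
      have "\<bar>g y - g x\<bar> \<le> L * d y x" using x y by (intro assms) auto
      also have "\<dots> \<le> (\<bar>L\<bar> + 1) * d y x" by (intro mult_right_mono) auto
      also have "\<dots> < e" using y by (simp add: field_simps commute)
      finally show "y \<in> {x \<in> topspace mtopology. g x \<in> U}" using e(2) y by auto
    qed
    then show "\<exists>r>0. mball x r \<subseteq> {x \<in> topspace mtopology. g x \<in> U}"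
      using e(1) by (intro exI[of _ "e / (\<bar>L\<bar> + 1)"]) auto
  qed auto
qed

text \<open>The limit lies in an open set \<open>U\<close> exactly when, for some \<open>m\<close>,
  the approximations eventually keep a distance of at least \<open>1 / Suc m\<close> from the
  complement of \<open>U\<close>. The points violating this form the open set \<open>V m\<close>, so
  the condition is a countable combination of measurable events.\<close>

lemma measurable_borel_of_limit:
  assumes f: "\<And>k. f k \<in> measurable N (borel_of mtopology)"
    and g: "\<And>\<omega>. \<omega> \<in> space N \<Longrightarrow> g \<omega> \<in> M"
    and lim: "\<And>\<omega>. \<omega> \<in> space N \<Longrightarrow> (\<lambda>k. d (f k \<omega>) (g \<omega>)) \<longlonglongrightarrow> 0"
  shows "g \<in> measurable N (borel_of mtopology)"
proof (rule measurable_borel_ofI)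
  show "g \<omega> \<in> topspace mtopology" if "\<omega> \<in> space N" for \<omega> using g that by simp
  fix U assume U: "openin mtopology U"
  have fM: "f k \<omega> \<in> M" if "\<omega> \<in> space N" for k \<omega> using measurable_space[OF f that] by simp
  define V where "V m = {x \<in> M. \<exists>y\<in>M - U. d x y < 1 / Suc m}" for m :: nat
  have "openin mtopology (V m)" for m
  proof -
    have "V m = (\<Union>y\<in>M - U. mball y (1 / Suc m))" by (auto simp: V_def commute)
    then show ?thesis by (auto intro!: openin_mball)
  qed
  then have V: "V m \<in> sets (borel_of mtopology)" for m by blast
  have *: "f k -` (M - V m) \<inter> space N \<in> sets N" for k m
  proof -
    have "f k -` (M - V m) \<inter> space N = space N - (f k -` V m \<inter> space N)" using fM by auto
    then show ?thesis using measurable_sets[OF f V] by auto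
  qed
  have "g -` U \<inter> space N = (\<Union>m. \<Union>n. \<Inter>k\<in>{n..}. f k -` (M - V m) \<inter> space N)"
  proof (intro set_eqI iffI)
    fix \<omega> assume w: "\<omega> \<in> g -` U \<inter> space N"
    then obtain r where r: "r > 0" "mball (g \<omega>) r \<subseteq> U"
      using U unfolding openin_mtopology by blast
    \<comment> \<open>Two distances below \<open>1 / Suc m\<close> are added in the triangle
      inequality, hence the \<open>2\<close>.\<close>
    obtain m :: nat where m: "2 / Suc m < r"
      using nat_approx_posE[of "r / 2"] r(1) by (auto simp: field_simps)
    have "\<forall>\<^sub>F k in sequentially. d (f k \<omega>) (g \<omega>) < 1 / Suc m"
      using lim[of \<omega>] w by (intro order_tendstoD(2)[of _ 0]) auto
    then obtain n where n: "\<And>k. k \<ge> n \<Longrightarrow> d (f k \<omega>) (g \<omega>) < 1 / Suc m"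
      by (auto simp: eventually_sequentially)
    have "f k \<omega> \<in> M - V m" if "k \<ge> n" for k
    proof -
      have False if y: "y \<in> M - U" "d (f k \<omega>) y < 1 / Suc m" for y
      proof -
        have "d (g \<omega>) y \<le> d (g \<omega>) (f k \<omega>) + d (f k \<omega>) y"
          using w g fM y by (intro triangle) auto
        also have "\<dots> < 1 / Suc m + 1 / Suc m"
          using n[OF \<open>k \<ge> n\<close>] y by (intro add_strict_mono) (auto simp: commute)
        also have "\<dots> < r" using m by simp
        finally show False using r(2) y g w by auto
      qed
      then show ?thesis using fM w by (auto simp: V_def)
    qed
    then show "\<omega> \<in> (\<Union>m. \<Union>n. \<Inter>k\<in>{n..}. f k -` (M - V m) \<inter> space N)" using w by blast
  next
    fix \<omega> assume "\<omega> \<in> (\<Union>m. \<Union>n. \<Inter>k\<in>{n..}. f k -` (M - V m) \<inter> space N)"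
    then obtain m n where mn: "\<And>k. k \<ge> n \<Longrightarrow> f k \<omega> \<in> M - V m" "\<omega> \<in> space N" by force
    have "\<forall>\<^sub>F k in sequentially. d (f k \<omega>) (g \<omega>) < 1 / Suc m"
      using lim[of \<omega>] mn by (intro order_tendstoD(2)[of _ 0]) auto
    then obtain n' where n': "\<And>k. k \<ge> n' \<Longrightarrow> d (f k \<omega>) (g \<omega>) < 1 / Suc m"
      by (auto simp: eventually_sequentially)
    have "f (max n n') \<omega> \<in> M - V m" "d (f (max n n') \<omega>) (g \<omega>) < 1 / Suc m"
      using mn n' by auto
    then show "\<omega> \<in> g -` U \<inter> space N" using g mn(2) by (auto simp: V_def)
  qed
  also have "\<dots> \<in> sets N"
    by (intro sets.countable_UN image_subsetI sets.countable_INT * UNIV_I) auto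
  finally show "g -` U \<inter> space N \<in> sets N" .
qed

text \<open>The witness is the infimal convolution of \<open>h\<close> with \<open>m * d\<close>: an
  infimum of \<open>m\<close>-Lipschitz functions is \<open>m\<close>-Lipschitz, the choice
  \<open>y = x\<close> puts it below \<open>h\<close>, and a growing penalty forces near-minimizers
  towards \<open>x\<close>, where \<open>h\<close> is continuous.\<close>

lemma Lipschitz_approximation_below:
  fixes h :: "'a \<Rightarrow> real"
  assumes h: "continuous_map mtopology euclideanreal h"
    and B: "\<And>x. x \<in> M \<Longrightarrow> \<bar>h x\<bar> \<le> B"
  obtains g :: "nat \<Rightarrow> 'a \<Rightarrow> real"
  where "\<And>m x y. x \<in> M \<Longrightarrow> y \<in> M \<Longrightarrow> \<bar>g m x - g m y\<bar> \<le> real m * d x y"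
    and "\<And>m x. x \<in> M \<Longrightarrow> \<bar>g m x\<bar> \<le> B"
    and "\<And>m x. x \<in> M \<Longrightarrow> g m x \<le> h x"
    and "\<And>x. x \<in> M \<Longrightarrow> (\<lambda>m. g m x) \<longlonglongrightarrow> h x"
proof
  define g where "g m x = (INF y\<in>M. h y + real m * d x y)" for m x
  have bdd: "bdd_below ((\<lambda>y. h y + real m * d x y) ` M)" for m x
  proof (rule bdd_belowI2)
    fix y assume "y \<in> M"
    then show "- B \<le> h y + real m * d x y"
      using B[of y] mult_nonneg_nonneg[OF of_nat_0_le_iff[of m] nonneg[of x y]] by linarith
  qed
  have le: "g m x \<le> h y + real m * d x y" if "y \<in> M" for m x y
    unfolding g_def using that by (intro cINF_lower bdd) 
  have ge: "c \<le> g m x" if "x \<in> M" "\<And>y. y \<in> M \<Longrightarrow> c \<le> h y + real m * d x y" for c m x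
    unfolding g_def using that by (intro cINF_greatest) auto
  show gh: "g m x \<le> h x" if "x \<in> M" for m x using le[OF that, of m x] that by simp
  show gB: "\<bar>g m x\<bar> \<le> B" if x: "x \<in> M" for m x
  proof -
    have "- B \<le> h y + real m * d x y" if "y \<in> M" for y
      using B[OF that] mult_nonneg_nonneg[OF of_nat_0_le_iff[of m] nonneg[of x y]] by linarith
    then have "- B \<le> g m x" by (intro ge x)
    then show ?thesis using gh[OF x, of m] B[OF x] by linarith
  qed
  have *: "g m x - real m * d x y \<le> g m y" if "x \<in> M" "y \<in> M" for m x y
  proof (rule ge[OF that(2)])
    fix u assume u: "u \<in> M"
    have "real m * d x u \<le> real m * (d x y + d y u)"
      using that u by (intro mult_left_mono triangle) auto
    then show "g m x - real m * d x y \<le> h u + real m * d y u"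
      using le[OF u, of m x] by (simp add: algebra_simps)
  qed
  show "\<bar>g m x - g m y\<bar> \<le> real m * d x y" if "x \<in> M" "y \<in> M" for m x y
    using *[OF that, of m] *[OF that(2,1), of m] by (simp add: commute abs_le_iff)
  show "(\<lambda>m. g m x) \<longlonglongrightarrow> h x" if x: "x \<in> M" for x
  proof (rule LIMSEQ_I)
    fix e :: real assume e: "e > 0"
    have "openin euclideanreal {h x - e / 2<..}" by simp
    then have "openin mtopology {y \<in> topspace mtopology. h y \<in> {h x - e / 2<..}}"
      using h unfolding continuous_map_def by blast
    then obtain r where r: "r > 0" "\<And>y. y \<in> M \<Longrightarrow> d x y < r \<Longrightarrow> h x - e / 2 < h y"
      using x e unfolding openin_mtopology by fastforce
    \<comment> \<open>At distance at least \<open>r\<close> from \<open>x\<close> the penalty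
      exceeds \<open>2 * B\<close>, hence also \<open>h x - h y\<close>, so such points cannot push
      the infimum below \<open>h x\<close>.\<close>
    obtain m0 :: nat where m0: "real m0 * r > 2 * B" using ex_less_of_nat_mult[OF r(1)] by blast
    have "norm (g m x - h x) < e" if m: "m \<ge> m0" for m
    proof -
      have "h x - e / 2 \<le> g m x"
      proof (rule ge[OF x])
        fix y assume y: "y \<in> M"
        show "h x - e / 2 \<le> h y + real m * d x y"
        proof (cases "d x y < r")
          case True
          then show ?thesis using r(2)[OF y] by (smt (verit) mult_nonneg_nonneg nonneg of_nat_0_le_iff)
        next
          case False
          have "real m0 * r \<le> real m * d x y" using False m r(1) by (intro mult_mono) auto
          then show ?thesis using m0 B[OF x] B[OF y] e by linarith
        qed
      qed
      then show ?thesis using gh[OF x, of m] e by simp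
    qed
    then show "\<exists>m0. \<forall>m\<ge>m0. norm (g m x - h x) < e" by blast
  qed
qed

text \<open>Lipschitz minorants converging to \<open>h\<close> bound the lower limit of the
  integrals of \<open>h (Y n \<omega>)\<close> below by the integral of
  \<open>h (Z \<omega>)\<close>; the same bound for \<open>- h\<close> controls the upper
  limit.\<close>

lemma converges_weakly_in_LipschitzI:
  assumes P: "prob_space P" "prob_space Q"
    and Y: "\<And>n. Y n \<in> measurable P (borel_of mtopology)"
    and Z: "Z \<in> measurable Q (borel_of mtopology)"
    and lim: "\<And>g L B. (\<And>x y. x \<in> M \<Longrightarrow> y \<in> M \<Longrightarrow> \<bar>g x - g y\<bar> \<le> L * d x y) \<Longrightarrow>
      (\<And>x. x \<in> M \<Longrightarrow> \<bar>g x\<bar> \<le> B) \<Longrightarrow>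
      (\<lambda>n. \<integral>\<omega>. g (Y n \<omega>) \<partial>P) \<longlonglongrightarrow> (\<integral>\<omega>. g (Z \<omega>) \<partial>Q)"
  shows "converges_weakly_in mtopology P Y Q Z"
proof -
  interpret P: prob_space P by fact
  interpret Q: prob_space Q by fact
  have YM: "Y n \<omega> \<in> M" if "\<omega> \<in> space P" for n \<omega> using measurable_space[OF Y that] by simp
  have ZM: "Z \<omega> \<in> M" if "\<omega> \<in> space Q" for \<omega> using measurable_space[OF Z that] by simp
  have intY: "integrable P (\<lambda>\<omega>. h (Y n \<omega>))"
    if "continuous_map mtopology euclideanreal h" "\<And>x. x \<in> M \<Longrightarrow> \<bar>h x\<bar> \<le> B" for h B n
    using that YM by (intro P.integrable_const_bound[of _ B] borel_of_continuous_map_compose[OF Y]) auto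
  have intZ: "integrable Q (\<lambda>\<omega>. h (Z \<omega>))"
    if "continuous_map mtopology euclideanreal h" "\<And>x. x \<in> M \<Longrightarrow> \<bar>h x\<bar> \<le> B" for h B
    using that ZM by (intro Q.integrable_const_bound[of _ B] borel_of_continuous_map_compose[OF Z]) auto
  have lower: "\<forall>\<^sub>F n in sequentially. (\<integral>\<omega>. h (Z \<omega>) \<partial>Q) - e < (\<integral>\<omega>. h (Y n \<omega>) \<partial>P)"
    if h: "continuous_map mtopology euclideanreal h" and B: "\<And>x. x \<in> M \<Longrightarrow> \<bar>h x\<bar> \<le> B"
      and e: "e > 0" for h B e
  proof -
    from Lipschitz_approximation_below[OF h B] obtain g
      where g: "\<And>m x y. x \<in> M \<Longrightarrow> y \<in> M \<Longrightarrow> \<bar>g m x - g m y\<bar> \<le> real m * d x y"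
        "\<And>m x. x \<in> M \<Longrightarrow> \<bar>g m x\<bar> \<le> B" "\<And>m x. x \<in> M \<Longrightarrow> g m x \<le> h x"
        "\<And>x. x \<in> M \<Longrightarrow> (\<lambda>m. g m x) \<longlonglongrightarrow> h x" by blast
    note cg = Lipschitz_imp_continuous_map[OF g(1)]
    have "(\<lambda>m. \<integral>\<omega>. g m (Z \<omega>) \<partial>Q) \<longlonglongrightarrow> (\<integral>\<omega>. h (Z \<omega>) \<partial>Q)"
      using g ZM
      by (intro integral_dominated_convergence[where w="\<lambda>_. B"] borel_of_continuous_map_compose[OF Z] h cg) auto
    then have "\<forall>\<^sub>F m in sequentially. (\<integral>\<omega>. h (Z \<omega>) \<partial>Q) - e < (\<integral>\<omega>. g m (Z \<omega>) \<partial>Q)"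
      using e by (intro order_tendstoD(1)) auto
    then obtain m where m: "(\<integral>\<omega>. h (Z \<omega>) \<partial>Q) - e < (\<integral>\<omega>. g m (Z \<omega>) \<partial>Q)"
      by (auto simp: eventually_sequentially)
    have "\<forall>\<^sub>F n in sequentially. (\<integral>\<omega>. h (Z \<omega>) \<partial>Q) - e < (\<integral>\<omega>. g m (Y n \<omega>) \<partial>P)"
      using g by (intro order_tendstoD(1)[OF lim] m) auto
    then show ?thesis
    proof eventually_elim
      case (elim n)
      also have "(\<integral>\<omega>. g m (Y n \<omega>) \<partial>P) \<le> (\<integral>\<omega>. h (Y n \<omega>) \<partial>P)"
        using g YM by (intro integral_mono intY[of _ B] h B cg) auto
      finally show ?case .
    qed
  qed
  show ?thesis
    unfolding converges_weakly_in_def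
  proof (intro conjI allI impI Y Z; elim conjE)
    fix h assume h: "continuous_map mtopology euclideanreal h" and "bounded (h ` topspace mtopology)"
    then obtain B where B: "\<And>x. x \<in> M \<Longrightarrow> \<bar>h x\<bar> \<le> B" by (auto simp: bounded_iff)
    show "(\<lambda>n. \<integral>\<omega>. h (Y n \<omega>) \<partial>P) \<longlonglongrightarrow> (\<integral>\<omega>. h (Z \<omega>) \<partial>Q)"
    proof (rule order_tendstoI)
      fix a assume "a < (\<integral>\<omega>. h (Z \<omega>) \<partial>Q)"
      then show "\<forall>\<^sub>F n in sequentially. a < (\<integral>\<omega>. h (Y n \<omega>) \<partial>P)"
        using lower[OF h B, of "(\<integral>\<omega>. h (Z \<omega>) \<partial>Q) - a"] by simp
    next
      fix a assume "a > (\<integral>\<omega>. h (Z \<omega>) \<partial>Q)"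
      moreover have "continuous_map mtopology euclideanreal (\<lambda>x. - h x)"
        using h by (intro continuous_map_minus)
      ultimately show "\<forall>\<^sub>F n in sequentially. (\<integral>\<omega>. h (Y n \<omega>) \<partial>P) < a"
        using lower[of "\<lambda>x. - h x" B "a - (\<integral>\<omega>. h (Z \<omega>) \<partial>Q)"] B by (simp add: algebra_simps)
    qed
  qed
qed

end

section \<open>Step approximations in $D[0,1]$\<close>

text \<open>For \<open>s < 0\<close> the maximum is taken over a possibly empty set; only \<open>s \<ge> 0\<close> is meaningful.\<close>

definition cell :: "real set \<Rightarrow> real \<Rightarrow> real" where
  "cell T s = Max {t \<in> T. t \<le> s}"

definition step_of :: "real set \<Rightarrow> (real \<Rightarrow> real) \<Rightarrow> real \<Rightarrow> real" where
  "step_of T f = (\<lambda>s\<in>{0..1}. f (cell T s))"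

text \<open>The point \<open>0\<close> gives every time of the unit interval a cell. The point
  \<open>1\<close> forms a cell of its own: every time change fixes \<open>1\<close>, so a jump
  there has to be matched exactly.\<close>

definition partition01 :: "real set \<Rightarrow> bool" where
  "partition01 T \<longleftrightarrow> finite T \<and> 0 \<in> T \<and> 1 \<in> T \<and> T \<subseteq> {0..1}"

lemma cell:
  assumes "partition01 T" "0 \<le> s"
  shows cell_in: "cell T s \<in> T" and cell_le: "cell T s \<le> s"
    and cell_ge: "\<And>t. t \<in> T \<Longrightarrow> t \<le> s \<Longrightarrow> t \<le> cell T s"
proof -
  have *: "finite {t \<in> T. t \<le> s}" "{t \<in> T. t \<le> s} \<noteq> {}" using assms by (auto simp: partition01_def)
  from Max_in[OF *] show "cell T s \<in> T" "cell T s \<le> s" by (auto simp: cell_def)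
  show "t \<le> cell T s" if "t \<in> T" "t \<le> s" for t
    unfolding cell_def using * that by (intro Max_ge) auto
qed

lemma cell_01: "partition01 T \<Longrightarrow> 0 \<le> s \<Longrightarrow> cell T s \<in> {0..1}"
  using cell_in[of T s] by (auto simp: partition01_def)

lemma cell_gap: "partition01 T \<Longrightarrow> 0 \<le> s \<Longrightarrow> T \<inter> {cell T s<..s} = {}"
  using cell_ge[of T s] by force

lemma cell_eqI:
  assumes "partition01 T" "t \<in> T" "t \<le> s" "T \<inter> {t<..s} = {}"
  shows "cell T s = t"
proof -
  have s: "0 \<le> s" using assms by (auto simp: partition01_def)
  have "t \<le> cell T s" using cell_ge[OF assms(1) s] assms by auto
  moreover have "\<not> t < cell T s" using cell_in[OF assms(1) s] cell_le[OF assms(1) s] assms(4) by auto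
  ultimately show ?thesis by simp
qed

lemma cell_cell:
  assumes "partition01 T" "partition01 G" "T \<subseteq> G" "0 \<le> s"
  shows "cell T (cell G s) = cell T s"
proof (rule cell_eqI)
  show "cell T s \<le> cell G s"
    using assms by (intro cell_ge) (auto intro: cell_in cell_le)
  show "T \<inter> {cell T s<..cell G s} = {}"
    using cell_gap[OF assms(1,4)] cell_le[OF assms(2,4)] by force
qed (use assms in \<open>auto intro: cell_in\<close>)

lemma cell_self: "partition01 T \<Longrightarrow> t \<in> T \<Longrightarrow> cell T t = t"
  by (intro cell_eqI) auto

lemma step_of_cadlag:
  assumes T: "partition01 T" shows "step_of T f \<in> cadlag"
proof -
  have av: "\<exists>d>0. \<forall>t\<in>T. t \<noteq> s \<longrightarrow> d \<le> dist s t" for s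
    using finite_set_avoid[of T s] T by (auto simp: partition01_def)
  have "(step_of T f \<longlongrightarrow> step_of T f s) (at_right s)" if s: "s \<in> {0..<1}" for s
  proof -
    obtain d where d: "d > 0" "\<And>t. t \<in> T \<Longrightarrow> t \<noteq> s \<Longrightarrow> d \<le> dist s t" using av by metis
    have "\<forall>\<^sub>F u in at_right s. step_of T f u = step_of T f s"
      unfolding eventually_at_right_field
    proof (intro exI conjI allI impI)
      show "s < min 1 (s + d)" using s d by auto
      fix u assume u: "s < u" "u < min 1 (s + d)"
      have "T \<inter> {s<..u} = {}" using d(2) u by (fastforce simp: dist_real_def)
      then have "cell T u = cell T s"
        using u s T cell_gap[OF T, of s] by (intro cell_eqI cell_in) (force intro: order_trans[OF cell_le])+
      then show "step_of T f u = step_of T f s" using u s by (simp add: step_of_def)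
    qed
    then show ?thesis by (rule tendsto_eventually)
  qed
  moreover have "\<exists>l. (step_of T f \<longlongrightarrow> l) (at_left s)" if s: "s \<in> {0<..1}" for s
  proof -
    obtain d where d: "d > 0" "\<And>t. t \<in> T \<Longrightarrow> t \<noteq> s \<Longrightarrow> d \<le> dist s t" using av by metis
    \<comment> \<open>No point of \<open>T\<close> lies strictly between \<open>s - d\<close> and
      \<open>s\<close>, so the step function is constant from \<open>r\<close> up to
      \<open>s\<close> and its value at \<open>r\<close> is the left limit.\<close>
    define r where "r = max 0 (s - d / 2)"
    have r: "0 \<le> r" "r < s" "s - d < r" using s d by (auto simp: r_def)
    have "\<forall>\<^sub>F u in at_left s. step_of T f u = step_of T f r"
      unfolding eventually_at_left_field
    proof (intro exI conjI allI impI)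
      show "r < s" by fact
      fix u assume u: "r < u" "u < s"
      have "T \<inter> {r<..u} = {}" using d(2) u r by (fastforce simp: dist_real_def)
      then have "cell T u = cell T r"
        using u r T cell_gap[OF T, of r] by (intro cell_eqI cell_in) (force intro: order_trans[OF cell_le])+
      then show "step_of T f u = step_of T f r" using u s r by (simp add: step_of_def)
    qed
    then show ?thesis by (intro exI tendsto_eventually)
  qed
  ultimately show ?thesis by (auto simp: cadlag_def step_of_def)
qed

lemma skorokhod_dist_le_uniform:
  assumes "\<And>s. s \<in> {0..1} \<Longrightarrow> \<bar>f s - g s\<bar> \<le> e"
  shows "skorokhod_dist f g \<le> e"
proof (rule skorokhod_dist_le)
  have "0 \<le> e" using assms[of 0] by simp
  then show "skorokhod_close f g e"
    unfolding skorokhod_close_def using assms by (intro exI[of _ "\<lambda>s. s"]) (auto simp: time_change_id)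
qed

text \<open>Near each point the oscillation is at most \<open>e\<close> on either side separately,
  and finitely many such neighbourhoods cover the interval. The gap condition says that
  \<open>s\<close> and \<open>t\<close> share a cell that is closed on the left and open on the
  right, so that jumps at points of \<open>T\<close> do not count.\<close>

lemma cadlag_partition:
  assumes f: "f \<in> cadlag" and e: "e > 0"
  obtains T where "partition01 T"
    and "\<And>s t. 0 \<le> s \<Longrightarrow> s \<le> t \<Longrightarrow> t \<le> 1 \<Longrightarrow> T \<inter> {s<..t} = {} \<Longrightarrow> \<bar>f s - f t\<bar> \<le> e"
proof -
  have loc: "\<exists>d>0. \<forall>u v. u \<in> {0..1} \<longrightarrow> v \<in> {0..1} \<longrightarrow>
      (s \<le> u \<and> u < s + d \<and> s \<le> v \<and> v < s + d \<or> s - d < u \<and> u < s \<and> s - d < v \<and> v < s) \<longrightarrow> \<bar>f u - f v\<bar> \<le> e"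
    if s: "s \<in> {0..1}" for s
  proof -
    have "\<exists>b>s. \<forall>u v. u \<in> {0..1} \<longrightarrow> v \<in> {0..1} \<longrightarrow> s \<le> u \<and> u < b \<and> s \<le> v \<and> v < b \<longrightarrow> \<bar>f u - f v\<bar> \<le> e"
    proof (cases "s < 1")
      case True
      then have "(f \<longlongrightarrow> f s) (at_right s)" using f s by (auto simp: cadlag_def)
      then have "\<forall>\<^sub>F t in at_right s. dist (f t) (f s) < e / 2" by (rule tendstoD) (use e in simp)
      then obtain b where b: "b > s" "\<And>t. s < t \<Longrightarrow> t < b \<Longrightarrow> dist (f t) (f s) < e / 2"
        unfolding eventually_at_right_field by blast
      have b': "\<bar>f t - f s\<bar> < e / 2" if "s \<le> t" "t < b" for t
        using b(2)[of t] that e by (cases "s = t") (auto simp: dist_real_def)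
      show ?thesis
      proof (intro exI[of _ b] conjI allI impI b(1))
        fix u v assume "s \<le> u \<and> u < b \<and> s \<le> v \<and> v < b"
        then show "\<bar>f u - f v\<bar> \<le> e" using b'[of u] b'[of v] by linarith
      qed
    next
      case False
      show ?thesis
      proof (intro exI[of _ "s + 1"] conjI allI impI)
        fix u v :: real assume "u \<in> {0..1}" "v \<in> {0..1}" "s \<le> u \<and> u < s + 1 \<and> s \<le> v \<and> v < s + 1"
        then have "u = v" using False by auto
        then show "\<bar>f u - f v\<bar> \<le> e" using e by simp
      qed simp
    qed
    moreover have "\<exists>a<s. \<forall>u v. u \<in> {0..1} \<longrightarrow> v \<in> {0..1} \<longrightarrow> a < u \<and> u < s \<and> a < v \<and> v < s \<longrightarrow> \<bar>f u - f v\<bar> \<le> e"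
    proof (cases "0 < s")
      case True
      then have "s \<in> {0<..1}" using s by auto
      then obtain l where "(f \<longlongrightarrow> l) (at_left s)" using f unfolding cadlag_def by blast
      then have "\<forall>\<^sub>F t in at_left s. dist (f t) l < e / 2" by (rule tendstoD) (use e in simp)
      then obtain a where a: "a < s" "\<And>t. a < t \<Longrightarrow> t < s \<Longrightarrow> \<bar>f t - l\<bar> < e / 2"
        unfolding eventually_at_left_field dist_real_def by blast
      show ?thesis
      proof (intro exI[of _ a] conjI allI impI a(1))
        fix u v assume "a < u \<and> u < s \<and> a < v \<and> v < s"
        then show "\<bar>f u - f v\<bar> \<le> e" using a(2)[of u] a(2)[of v] by linarith
      qed
    qed (use s in \<open>auto intro!: exI[of _ "s - 1"]\<close>)
    ultimately obtain a b where ab: "s < b" "a < s"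
      and b: "\<And>u v. u \<in> {0..1} \<Longrightarrow> v \<in> {0..1} \<Longrightarrow> s \<le> u \<and> u < b \<and> s \<le> v \<and> v < b \<Longrightarrow> \<bar>f u - f v\<bar> \<le> e"
      and a: "\<And>u v. u \<in> {0..1} \<Longrightarrow> v \<in> {0..1} \<Longrightarrow> a < u \<and> u < s \<and> a < v \<and> v < s \<Longrightarrow> \<bar>f u - f v\<bar> \<le> e"
      by metis
    show ?thesis
    proof (intro exI[of _ "min (b - s) (s - a)"] conjI allI impI)
      show "0 < min (b - s) (s - a)" using ab by simp
      fix u v :: real
      assume "u \<in> {0..1}" "v \<in> {0..1}"
        "s \<le> u \<and> u < s + min (b - s) (s - a) \<and> s \<le> v \<and> v < s + min (b - s) (s - a) \<or>
         s - min (b - s) (s - a) < u \<and> u < s \<and> s - min (b - s) (s - a) < v \<and> v < s"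
      then show "\<bar>f u - f v\<bar> \<le> e" using a[of u v] b[of u v] by (auto simp: min_def split: if_splits)
    qed
  qed
  then obtain d where d: "\<And>s. s \<in> {0..1} \<Longrightarrow> d s > 0"
    and osc: "\<And>s u v. s \<in> {0..1} \<Longrightarrow> u \<in> {0..1} \<Longrightarrow> v \<in> {0..1} \<Longrightarrow>
      s \<le> u \<and> u < s + d s \<and> s \<le> v \<and> v < s + d s \<or> s - d s < u \<and> u < s \<and> s - d s < v \<and> v < s \<Longrightarrow> \<bar>f u - f v\<bar> \<le> e"
    by metis
  have "{0..1} \<subseteq> (\<Union>s\<in>{0..1}. ball s (d s))" using d by force
  then obtain C where C: "C \<subseteq> {0..1}" "finite C" "{0..1} \<subseteq> (\<Union>s\<in>C. ball s (d s))"
    using compactE_image[of "{0..1::real}" "{0..1}" "\<lambda>s. ball s (d s)"] by auto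
  \<comment> \<open>For the centre \<open>c\<close> whose ball contains \<open>s\<close>, the point
    \<open>c\<close> keeps \<open>t\<close> on the same side of \<open>c\<close> as
    \<open>s\<close>, and \<open>c + d c\<close> keeps \<open>t\<close> from leaving the ball on the
    right. If \<open>c + d c\<close> exceeds \<open>1\<close> it cannot be passed by
    \<open>t \<le> 1\<close>.\<close>
  define T where "T = {0, 1} \<union> (C \<union> (\<lambda>c. c + d c) ` C) \<inter> {0..1}"
  show thesis
  proof
    show "partition01 T" using C by (auto simp: T_def partition01_def)
    fix s t :: real assume st: "0 \<le> s" "s \<le> t" "t \<le> 1" and gap: "T \<inter> {s<..t} = {}"
    obtain c where c: "c \<in> C" "\<bar>s - c\<bar> < d c"
      using C(3) st by (force simp: dist_real_def abs_minus_commute)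
    have nc: "\<not> (s < c \<and> c \<le> t)" "\<not> (s < c + d c \<and> c + d c \<le> t)"
      using gap c st by (auto simp: T_def)
    have "c \<in> {0..1}" using c C by auto
    then show "\<bar>f s - f t\<bar> \<le> e"
      by (rule osc) (use st nc c in \<open>auto simp: abs_less_iff\<close>)
  qed
qed

text \<open>
  Let \<open>T\<close> be a partition on whose cells \<open>f\<close> oscillates little, and \<open>u t\<close> the first grid point after \<open>t \<in> T\<close>.
  A time change that adds small tents to the identity moves \<open>u t\<close> back to \<open>t\<close>; then \<open>cell G s\<close> and \<open>\<tau> s\<close>
  lie in the same cell of \<open>T\<close>.
\<close>

lemma skorokhod_step_close:
  assumes f: "f \<in> cadlag" and e: "e > 0"
  obtains \<eta> where "\<eta> > 0"
    and "\<And>G. partition01 G \<Longrightarrow> (\<And>t. t \<in> {0..1} \<Longrightarrow> \<exists>g\<in>G. t \<le> g \<and> g \<le> t + \<eta>) \<Longrightarrow>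
      skorokhod_close (step_of G f) f e"
proof -
  from cadlag_partition[OF f e] obtain T where T: "partition01 T"
    and osc: "\<And>s t. 0 \<le> s \<Longrightarrow> s \<le> t \<Longrightarrow> t \<le> 1 \<Longrightarrow> T \<inter> {s<..t} = {} \<Longrightarrow> \<bar>f s - f t\<bar> \<le> e" by blast
  have finT: "finite T" and T01: "T \<subseteq> {0..1}" using T by (auto simp: partition01_def)
  have "\<exists>d>0. \<forall>t\<in>T. \<forall>t'\<in>T. t \<noteq> t' \<longrightarrow> d \<le> dist t t'"
  proof -
    define D where "D = insert 1 ((\<lambda>(t, t'). dist t t') ` {(t, t'). t \<in> T \<and> t' \<in> T \<and> t \<noteq> t'})"
    have "finite D"
      unfolding D_def
      by (intro finite.insertI finite_imageI finite_subset[OF _ finite_cartesian_product[OF finT finT]]) auto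
    moreover have "\<forall>d\<in>D. 0 < d" by (auto simp: D_def)
    moreover have "dist t t' \<in> D" if "t \<in> T" "t' \<in> T" "t \<noteq> t'" for t t'
      using that by (auto simp: D_def)
    ultimately show ?thesis
      by (intro exI[of _ "Min D"] conjI ballI impI Min_le) (auto simp: D_def)
  qed
  then obtain \<delta> where \<delta>: "\<delta> > 0" "\<And>t t'. t \<in> T \<Longrightarrow> t' \<in> T \<Longrightarrow> t \<noteq> t' \<Longrightarrow> \<delta> \<le> \<bar>t - t'\<bar>"
    unfolding dist_real_def by metis
  define N where "N = real (card T)"
  have N: "N \<ge> 1" using T finT by (auto simp: N_def partition01_def Suc_le_eq card_gt_0_iff)
  \<comment> \<open>Below, \<open>u t\<close> exceeds \<open>t\<close> by at most
    \<open>\<eta> \<le> w\<close>, so distinct points \<open>u t\<close> and \<open>u t'\<close>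
    stay at least \<open>w\<close> apart and a tent of half-width \<open>w\<close> about one of them
    vanishes at the other.\<close>
  define w where "w = \<delta> / 2"
  have w: "w > 0" using \<delta> by (simp add: w_def)
  \<comment> \<open>The first bound limits the displacement \<open>N * \<eta>\<close> to
    \<open>e\<close>. The second limits the Lipschitz constant of the sum of tents to
    \<open>1 / 2\<close>, so that identity plus tents remains strictly increasing.\<close>
  define \<eta> where "\<eta> = min (e / N) (w / (2 * N))"
  have \<eta>: "\<eta> > 0" "N * \<eta> \<le> e" "N * (\<eta> / w) \<le> 1 / 2" "\<eta> \<le> w"
  proof -
    show "\<eta> > 0" using e w N by (simp add: \<eta>_def)
    have "\<eta> \<le> e / N" by (simp add: \<eta>_def)
    then show "N * \<eta> \<le> e" using N by (simp add: field_simps)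
    have *: "\<eta> \<le> w / (2 * N)" by (simp add: \<eta>_def)
    then show "N * (\<eta> / w) \<le> 1 / 2" using N w by (simp add: field_simps)
    have "w / (2 * N) \<le> w / 1" using N w by (intro divide_left_mono) auto
    then show "\<eta> \<le> w" using * by simp
  qed
  show thesis
  proof (rule that[OF \<eta>(1)])
    fix G assume G: "partition01 G" and mesh: "\<And>t. t \<in> {0..1} \<Longrightarrow> \<exists>g\<in>G. t \<le> g \<and> g \<le> t + \<eta>"
    define u where "u t = Min {g \<in> G. t \<le> g}" for t
    have finG: "finite {g \<in> G. t \<le> g}" for t using G by (auto simp: partition01_def)
    have u: "u t \<in> G" "t \<le> u t" "u t \<le> t + \<eta>" "\<And>g. g \<in> G \<Longrightarrow> t \<le> g \<Longrightarrow> u t \<le> g" if t: "t \<in> {0..1}" for t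
    proof -
      obtain g where g: "g \<in> G" "t \<le> g" "g \<le> t + \<eta>" using mesh[OF t] by blast
      then have ne: "{g \<in> G. t \<le> g} \<noteq> {}" by blast
      show "u t \<in> G" "t \<le> u t" using Min_in[OF finG ne] by (auto simp: u_def)
      show *: "u t \<le> g" if "g \<in> G" "t \<le> g" for g
        unfolding u_def using finG that by (intro Min_le) auto
      show "u t \<le> t + \<eta>" using *[OF g(1,2)] g(3) by simp
    qed
    have u01: "u 0 = 0" "u 1 = 1"
      using u[of 0] u[of 1] G unfolding partition01_def by fastforce+
    have ud: "\<bar>t - u t\<bar> \<le> \<eta>" if "t \<in> T" for t using u(2,3)[of t] T01 that by auto
    define p where "p s = (\<Sum>t\<in>T. (t - u t) * max 0 (1 - \<bar>s - u t\<bar> / w))" for s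
    define \<tau> where "\<tau> s = s + p s" for s
    have pu: "p (u t) = t - u t" if t: "t \<in> T" for t
    proof -
      have "(t' - u t') * max 0 (1 - \<bar>u t - u t'\<bar> / w) = (if t' = t then t - u t else 0)" if t': "t' \<in> T" for t'
      proof (cases "t' = t")
        case False
        have "t \<in> {0..1}" "t' \<in> {0..1}" using t t' T01 by auto
        then have "\<bar>u t - u t'\<bar> \<ge> w"
          using \<delta>(2)[OF t t'] False u(2,3)[of t] u(2,3)[of t'] \<eta>(4) w_def by linarith
        then have "1 - \<bar>u t - u t'\<bar> / w \<le> 0" using w by (simp add: field_simps)
        then show ?thesis using False by (simp add: max_def)
      qed simp
      then show ?thesis unfolding p_def using finT t by simp
    qed
    have plip: "\<bar>p x - p y\<bar> \<le> \<bar>x - y\<bar> / 2" for x y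
    proof -
      have "\<bar>p x - p y\<bar> \<le> (\<Sum>t\<in>T. \<eta> * (\<bar>x - y\<bar> / w))"
        unfolding p_def sum_subtractf[symmetric] right_diff_distrib[symmetric]
      proof (rule order_trans[OF sum_abs], rule sum_mono)
        fix t assume t: "t \<in> T"
        have "\<bar>max 0 (1 - \<bar>x - u t\<bar> / w) - max 0 (1 - \<bar>y - u t\<bar> / w)\<bar> \<le> \<bar>\<bar>y - u t\<bar> / w - \<bar>x - u t\<bar> / w\<bar>"
          by (auto simp: max_def)
        also have "\<dots> = \<bar>\<bar>y - u t\<bar> - \<bar>x - u t\<bar>\<bar> / w"
          using w by (simp add: diff_divide_distrib[symmetric] abs_divide)
        also have "\<dots> \<le> \<bar>x - y\<bar> / w" using w by (intro divide_right_mono) auto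
        finally show "\<bar>(t - u t) * (max 0 (1 - \<bar>x - u t\<bar> / w) - max 0 (1 - \<bar>y - u t\<bar> / w))\<bar> \<le> \<eta> * (\<bar>x - y\<bar> / w)"
          unfolding abs_mult using ud[OF t] by (intro mult_mono) auto
      qed
      also have "\<dots> = N * (\<eta> / w) * \<bar>x - y\<bar>" by (simp add: N_def)
      also have "\<dots> \<le> 1 / 2 * \<bar>x - y\<bar>" using \<eta> by (intro mult_right_mono) auto
      finally show ?thesis by simp
    qed
    have pbd: "\<bar>p x\<bar> \<le> e" for x
    proof -
      have "\<bar>p x\<bar> \<le> (\<Sum>t\<in>T. \<eta> * 1)"
        unfolding p_def
      proof (rule order_trans[OF sum_abs], rule sum_mono)
        fix t assume t: "t \<in> T"
        show "\<bar>(t - u t) * max 0 (1 - \<bar>x - u t\<bar> / w)\<bar> \<le> \<eta> * 1"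
          unfolding abs_mult using ud[OF t] w by (intro mult_mono) auto
      qed
      then show ?thesis using \<eta>(2) by (simp add: N_def)
    qed
    have mono: "\<tau> x < \<tau> y" if "x < y" for x y
    proof -
      have "p x - p y \<le> \<bar>p x - p y\<bar>" by simp
      also note plip
      also have "\<bar>x - y\<bar> / 2 < y - x" using that by simp
      finally show ?thesis by (simp add: \<tau>_def)
    qed
    have cont: "continuous_on A \<tau>" for A
      unfolding \<tau>_def p_def by (intro continuous_intros) (use w in auto)
    have \<tau>u: "\<tau> (u t) = t" if "t \<in> T" for t using pu[OF that] by (simp add: \<tau>_def)
    have \<tau>01: "\<tau> 0 = 0" "\<tau> 1 = 1" using \<tau>u[of 0] \<tau>u[of 1] u01 T by (auto simp: partition01_def)
    have le: "\<tau> x \<le> \<tau> y" if "x \<le> y" for x y using mono[of x y] that by (cases "x = y") auto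
    have tc: "time_change \<tau>"
      unfolding time_change_def
    proof (intro conjI cont)
      show "strict_mono_on {0..1} \<tau>" using mono by (auto simp: strict_mono_on_def)
      show "\<tau> ` {0..1} = {0..1}"
      proof
        show "\<tau> ` {0..1} \<subseteq> {0..1}" using le[of 0] le[of _ 1] \<tau>01 by auto
        show "{0..1} \<subseteq> \<tau> ` {0..1}"
        proof
          fix y :: real assume "y \<in> {0..1}"
          then obtain x where "0 \<le> x" "x \<le> 1" "\<tau> x = y"
            using IVT'[of \<tau> 0 y 1] cont \<tau>01 by auto
          then show "y \<in> \<tau> ` {0..1}" by auto
        qed
      qed
    qed
    show "skorokhod_close (step_of G f) f e"
      unfolding skorokhod_close_def
    proof (intro exI[of _ \<tau>] conjI tc ballI)
      fix s :: real assume s: "s \<in> {0..1}"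
      show "\<bar>\<tau> s - s\<bar> \<le> e" using pbd[of s] by (simp add: \<tau>_def)
      \<comment> \<open>Both \<open>cell G s\<close> and \<open>\<tau> s\<close> lie to the left of
        \<open>t\<close> exactly when \<open>s\<close> lies to the left of \<open>u t\<close>; hence
        no point of \<open>T\<close> separates them.\<close>
      have iff: "cell G s < t \<longleftrightarrow> \<tau> s < t" if t: "t \<in> T" for t
      proof -
        have t01: "t \<in> {0..1}" using t T01 by auto
        have "cell G s < t \<longleftrightarrow> s < u t"
        proof
          assume "cell G s < t"
          then show "s < u t"
            using cell_ge[OF G, of s "u t"] u(1,2)[OF t01] s by force
        next
          assume "s < u t"
          then show "cell G s < t"
            using cell_le[OF G, of s] u(4)[OF t01 cell_in[OF G, of s]] s by force
        qed
        also have "\<dots> \<longleftrightarrow> \<tau> s < \<tau> (u t)" using mono[of s "u t"] le[of "u t" s] by linarith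
        finally show ?thesis using \<tau>u[OF t] by simp
      qed
      have "\<tau> s \<in> {0..1}" "cell G s \<in> {0..1}"
        using time_change_in[OF tc s] cell_01[OF G] s by auto
      then have "\<bar>f (cell G s) - f (\<tau> s)\<bar> \<le> e"
        using osc[of "cell G s" "\<tau> s"] osc[of "\<tau> s" "cell G s"] iff
        by (cases "cell G s \<le> \<tau> s") (force simp: abs_minus_commute)+
      then show "\<bar>step_of G f s - f (\<tau> s)\<bar> \<le> e" using s by (simp add: step_of_def)
    qed
  qed
qed

section \<open>Limits along refined grids and measurability in D[0,1]\<close>

definition refine :: "real set \<Rightarrow> nat \<Rightarrow> real set" where
  "refine T k = T \<union> (\<lambda>j. real j / real (Suc k)) ` {..Suc k}"

lemma partition01_refine: "partition01 T \<Longrightarrow> partition01 (refine T k)"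
  by (auto simp: partition01_def refine_def divide_le_eq_1)

text \<open>The convergence need not be uniform, because \<open>f\<close> may jump between grid
  points; \<open>skorokhod_step_close\<close> absorbs this by shifting time, as soon as the mesh
  \<open>1 / Suc k\<close> is below its \<open>\<eta>\<close>.\<close>

lemma skorokhod_refine_limit:
  assumes f: "f \<in> cadlag" and T: "partition01 T"
  shows "(\<lambda>k. skorokhod_dist (step_of (refine T k) f) f) \<longlonglongrightarrow> 0"
proof (rule LIMSEQ_I)
  fix e :: real assume e: "e > 0"
  then have "e / 2 > 0" by simp
  from skorokhod_step_close[OF f this] obtain \<eta> where \<eta>: "\<eta> > 0"
    and close: "\<And>G. partition01 G \<Longrightarrow> (\<And>t. t \<in> {0..1} \<Longrightarrow> \<exists>g\<in>G. t \<le> g \<and> g \<le> t + \<eta>) \<Longrightarrow>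
      skorokhod_close (step_of G f) f (e / 2)" by blast
  obtain n :: nat where n: "1 / Suc n < \<eta>" using nat_approx_posE[OF \<eta>] by auto
  have "norm (skorokhod_dist (step_of (refine T k) f) f - 0) < e" if k: "k \<ge> n" for k
  proof -
    have "skorokhod_close (step_of (refine T k) f) f (e / 2)"
    proof (rule close[OF partition01_refine[OF T]])
      fix t :: real assume t: "t \<in> {0..1}"
      define j where "j = nat \<lceil>t * Suc k\<rceil>"
      have j: "real j = of_int \<lceil>t * Suc k\<rceil>" using t by (simp add: j_def)
      then have j1: "t * Suc k \<le> real j" "real j \<le> t * Suc k + 1" by linarith+
      have "t * Suc k \<le> real (Suc k)" using t by (simp add: mult_left_le_one_le)
      then have "\<lceil>t * Suc k\<rceil> \<le> int (Suc k)" by (simp add: ceiling_le_iff)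
      then have "j \<le> Suc k" by (simp add: j_def nat_le_iff)
      moreover have "t \<le> real j / Suc k" using j1 by (simp add: field_simps)
      moreover have "real j / Suc k \<le> t + 1 / Suc k"
        using divide_right_mono[OF j1(2), of "Suc k"] by (simp add: add_divide_distrib)
      moreover have "1 / real (Suc k) \<le> 1 / Suc n" using k by (intro divide_left_mono) auto
      ultimately show "\<exists>g\<in>refine T k. t \<le> g \<and> g \<le> t + \<eta>"
        using n by (intro bexI[of _ "real j / Suc k"]) (auto simp: refine_def)
    qed
    then have "skorokhod_dist (step_of (refine T k) f) f \<le> e / 2" by (rule skorokhod_dist_le)
    then show ?thesis using e skorokhod_dist_nonneg[of "step_of (refine T k) f" f] by simp
  qed
  then show "\<exists>n. \<forall>k\<ge>n. norm (skorokhod_dist (step_of (refine T k) f) f - 0) < e" by blast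
qed

text \<open>A step function depends on finitely many values, and a small change of these values
  moves it little in the uniform and hence in the Skorokhod distance, so open sets have open
  preimages. The values are coded as \<open>nat \<Rightarrow> real\<close> because measurability
  into a product over a countable index type can be checked coordinatewise.\<close>

lemma measurable_step_of:
  assumes T: "partition01 T" and Y: "\<And>t. t \<in> T \<Longrightarrow> (\<lambda>\<omega>. Y \<omega> t) \<in> borel_measurable M"
  shows "(\<lambda>\<omega>. step_of T (Y \<omega>)) \<in> measurable M (borel_of skorokhod_topology)"
proof (rule measurable_borel_ofI)
  show "step_of T (Y \<omega>) \<in> topspace skorokhod_topology" for \<omega>
    by (simp add: topspace_skorokhod step_of_cadlag[OF T])
  fix U assume U: "openin skorokhod_topology U"
  interpret Metric_space cadlag skorokhod_dist by (rule Metric_space_skorokhod)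
  have cT: "countable T" "T \<noteq> {}" using T by (auto simp: partition01_def intro: countable_finite)
  define \<Phi> :: "(nat \<Rightarrow> real) \<Rightarrow> real \<Rightarrow> real" where "\<Phi> y = step_of T (\<lambda>t. y (to_nat_on T t))" for y
  define v where "v \<omega> i = Y \<omega> (from_nat_into T i)" for \<omega> i
  have v: "v \<in> borel_measurable M"
    unfolding v_def
    by (intro measurable_coordinatewise_then_product Y from_nat_into cT)
  have "open (\<Phi> -` U)"
    unfolding open_subopen[of "\<Phi> -` U"]
  proof
    fix y0 assume "y0 \<in> \<Phi> -` U"
    then obtain r where r: "r > 0" "mball (\<Phi> y0) r \<subseteq> U"
      using U unfolding skorokhod_topology_def openin_mtopology by auto
    let ?V = "\<Inter>t\<in>T. {y :: nat \<Rightarrow> real. \<bar>y (to_nat_on T t) - y0 (to_nat_on T t)\<bar> < r / 2}"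
    have "open ?V"
      by (intro open_INT ballI open_Collect_less continuous_intros continuous_on_product_coordinates)
        (use T in \<open>simp add: partition01_def\<close>)
    moreover have "y0 \<in> ?V" using r by simp
    moreover have "?V \<subseteq> \<Phi> -` U"
    proof
      fix y assume y: "y \<in> ?V"
      have "skorokhod_dist (\<Phi> y0) (\<Phi> y) \<le> r / 2"
      proof (rule skorokhod_dist_le_uniform)
        fix s :: real assume s: "s \<in> {0..1}"
        then have "cell T s \<in> T" using cell_in[OF T] by simp
        then show "\<bar>\<Phi> y0 s - \<Phi> y s\<bar> \<le> r / 2"
          using y s by (auto simp: \<Phi>_def step_of_def abs_minus_commute less_imp_le)
      qed
      then have "\<Phi> y \<in> mball (\<Phi> y0) r" using r by (auto simp: \<Phi>_def step_of_cadlag[OF T])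
      then show "y \<in> \<Phi> -` U" using r by auto
    qed
    ultimately show "\<exists>V. open V \<and> y0 \<in> V \<and> V \<subseteq> \<Phi> -` U" by blast
  qed
  then have "v -` (\<Phi> -` U) \<inter> space M \<in> sets M" by (intro measurable_sets[OF v]) simp
  moreover have "\<Phi> (v \<omega>) = step_of T (Y \<omega>)" for \<omega>
    unfolding \<Phi>_def step_of_def v_def using cT cell_in[OF T] by (auto simp: restrict_def)
  ultimately show "(\<lambda>\<omega>. step_of T (Y \<omega>)) -` U \<inter> space M \<in> sets M"
    by (simp add: vimage_def)
qed

text \<open>Each path is the Skorokhod limit of its step functions on the grids
  \<open>refine {0, 1} k\<close>, which are measurable because they involve finitely many
  evaluations. This replaces a description of the Borel sets of D[0,1] by evaluations.\<close>

lemma measurable_cadlag_process: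
  assumes cad: "\<And>\<omega>. \<omega> \<in> space M \<Longrightarrow> Y \<omega> \<in> cadlag"
    and meas: "\<And>s. s \<in> {0..1} \<Longrightarrow> (\<lambda>\<omega>. Y \<omega> s) \<in> borel_measurable M"
  shows "Y \<in> measurable M (borel_of skorokhod_topology)"
proof -
  interpret Metric_space cadlag skorokhod_dist by (rule Metric_space_skorokhod)
  have p: "partition01 {0, 1}" by (simp add: partition01_def)
  have m: "(\<lambda>\<omega>. step_of (refine {0, 1} k) (Y \<omega>)) \<in> measurable M (borel_of skorokhod_topology)" for k
    using partition01_refine[OF p, of k] meas
    by (intro measurable_step_of) (auto simp: partition01_def)
  show ?thesis
    unfolding skorokhod_topology_def
    by (rule measurable_borel_of_limit[where f="\<lambda>k \<omega>. step_of (refine {0, 1} k) (Y \<omega>)", OF m[unfolded skorokhod_topology_def]])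
      (use cad skorokhod_refine_limit[OF _ p] in auto)
qed

section \<open>A maximal inequality\<close>

text \<open>
  Splitting at an index \<open>h\<close> that halves the mass loses the factor
  \<open>1 / (2 * (9/10) ^ 4) < 1\<close>, which leaves room for the two union-bound terms
  \<open>2 * 10 ^ 4\<close>; this is where the constant comes from.
\<close>

lemma (in prob_space) maximal_inequality:
  fixes S :: "nat \<Rightarrow> 'a \<Rightarrow> real" and \<mu> :: "nat \<Rightarrow> real"
  assumes S [measurable]: "\<And>i. S i \<in> borel_measurable M" and \<mu>: "mono \<mu>"
    and two: "\<And>i j k r. i \<le> j \<Longrightarrow> j \<le> k \<Longrightarrow> k \<le> N \<Longrightarrow> r > 0 \<Longrightarrow>
      prob {\<omega>\<in>space M. r \<le> \<bar>S j \<omega> - S i \<omega>\<bar> \<and> r \<le> \<bar>S k \<omega> - S j \<omega>\<bar>} \<le> (\<mu> k - \<mu> i)\<^sup>2 / r ^ 4"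
    and ik: "i \<le> k" "k \<le> N" and l: "r > 0"
  shows "prob {\<omega>\<in>space M. \<exists>j\<in>{i..k}. r \<le> \<bar>S j \<omega> - S i \<omega>\<bar> \<and> r \<le> \<bar>S k \<omega> - S j \<omega>\<bar>}
    \<le> 100000 * (\<mu> k - \<mu> i)\<^sup>2 / r ^ 4"
  using ik l
proof (induction "k - i" arbitrary: i k r rule: less_induct)
  case less
  define E where "E i k r = {\<omega>\<in>space M. \<exists>j\<in>{i..k}. r \<le> \<bar>S j \<omega> - S i \<omega>\<bar> \<and> r \<le> \<bar>S k \<omega> - S j \<omega>\<bar>}" for i k r
  define D where "D i j k r = {\<omega>\<in>space M. r \<le> \<bar>S j \<omega> - S i \<omega>\<bar> \<and> r \<le> \<bar>S k \<omega> - S j \<omega>\<bar>}" for i j k r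
  have Em [measurable]: "E i k r \<in> sets M" and Dm [measurable]: "D i j k r \<in> sets M" for i j k r
    by (simp_all add: E_def D_def)
  note l = \<open>r > 0\<close>
  show ?case
  proof (cases "i + 1 < k")
    case False
    have "E i k r = {}"
    proof -
      have "j = i \<or> j = k" if "j \<in> {i..k}" for j using that False less.prems by auto
      then show ?thesis using l by (fastforce simp: E_def)
    qed
    then have "prob (E i k r) = 0" by simp
    then show ?thesis using l unfolding E_def by simp
  next
    case True
    define u where "u = \<mu> k - \<mu> i"
    have u0: "u \<ge> 0" using monoD[OF \<mu>, of i k] less.prems by (simp add: u_def)
    define h where "h = (LEAST h. i < h \<and> u / 2 \<le> \<mu> h - \<mu> i)"
    have hk: "i < k \<and> u / 2 \<le> \<mu> k - \<mu> i" using True u0 by (simp add: u_def)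
    have h: "i < h" "u / 2 \<le> \<mu> h - \<mu> i" "h \<le> k"
      using LeastI[of "\<lambda>h. i < h \<and> u / 2 \<le> \<mu> h - \<mu> i", OF hk]
        Least_le[of "\<lambda>h. i < h \<and> u / 2 \<le> \<mu> h - \<mu> i", OF hk] by (auto simp: h_def)
    \<comment> \<open>Since \<open>h\<close> is the first index after \<open>i\<close> reaching half
      of the mass, the ranges from \<open>i\<close> to \<open>g\<close> and from \<open>h\<close> to
      \<open>k\<close> carry at most half each. The step from \<open>g\<close> to \<open>h\<close>
      may carry any share and belongs to neither range.\<close>
    define g where "g = h - 1"
    have g: "i \<le> g" "g < h" "h = Suc g" using h by (auto simp: g_def)
    have gu: "\<mu> g - \<mu> i \<le> u / 2"
    proof (cases "g = i")
      case False
      then have "i < g" using g by simp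
      then show ?thesis
        using not_less_Least[of g "\<lambda>h. i < h \<and> u / 2 \<le> \<mu> h - \<mu> i"] g by (auto simp: h_def)
    qed (use u0 in simp)
    have hu: "\<mu> k - \<mu> h \<le> u / 2" using h by (simp add: u_def field_simps)
    define a where "a = 9 / 10 * r"
    define b where "b = 1 / 10 * r"
    have ab: "a > 0" "b > 0" "r = a + b" using l by (auto simp: a_def b_def)
    \<comment> \<open>Take \<open>j \<le> g\<close>. If \<open>S j\<close> and \<open>S g\<close>
      differ by at least \<open>a\<close>, then \<open>j\<close> witnesses the event on the left
      range. Otherwise \<open>S g\<close> inherits from \<open>S j\<close> a distance of at least
      \<open>r - a = b\<close> from both \<open>S i\<close> and \<open>S k\<close>. For
      \<open>j \<ge> h\<close> the same works with \<open>S h\<close>.\<close>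
    have inc: "E i k r \<subseteq> (E i g a \<union> E h k a) \<union> (D i g k b \<union> D i h k b)"
    proof
      fix \<omega> assume "\<omega> \<in> E i k r"
      then obtain j where w: "\<omega> \<in> space M" and j: "i \<le> j" "j \<le> k"
        and big: "r \<le> \<bar>S j \<omega> - S i \<omega>\<bar>" "r \<le> \<bar>S k \<omega> - S j \<omega>\<bar>"
        by (auto simp: E_def)
      show "\<omega> \<in> (E i g a \<union> E h k a) \<union> (D i g k b \<union> D i h k b)"
      proof (cases "j \<le> g")
        case True
        show ?thesis
        proof (cases "a \<le> \<bar>S g \<omega> - S j \<omega>\<bar>")
          case t: True
          then have "\<omega> \<in> E i g a"
            using w j True big ab unfolding E_def by (intro CollectI conjI bexI[of _ j]) auto
          then show ?thesis by simp
        next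
          case False
          then have "b \<le> \<bar>S g \<omega> - S i \<omega>\<bar>" "b \<le> \<bar>S k \<omega> - S g \<omega>\<bar>" using big ab(3) by linarith+
          then show ?thesis using w by (auto simp: D_def)
        qed
      next
        case False
        then have hj: "h \<le> j" using g by simp
        show ?thesis
        proof (cases "a \<le> \<bar>S j \<omega> - S h \<omega>\<bar>")
          case t: True
          then have "\<omega> \<in> E h k a"
            using w j hj big ab unfolding E_def by (intro CollectI conjI bexI[of _ j]) auto
          then show ?thesis by simp
        next
          case False
          then have "b \<le> \<bar>S h \<omega> - S i \<omega>\<bar>" "b \<le> \<bar>S k \<omega> - S h \<omega>\<bar>" using big ab(3) by linarith+
          then show ?thesis using w by (auto simp: D_def)
        qed
      qed
    qed
    have E1: "prob (E i g a) \<le> 100000 * (u / 2)\<^sup>2 / a ^ 4"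
    proof -
      have "prob (E i g a) \<le> 100000 * (\<mu> g - \<mu> i)\<^sup>2 / a ^ 4"
        unfolding E_def by (rule less.hyps) (use g h less.prems ab in auto)
      also have "\<dots> \<le> 100000 * (u / 2)\<^sup>2 / a ^ 4"
        using gu monoD[OF \<mu> g(1)] ab by (intro divide_right_mono mult_left_mono power_mono) auto
      finally show ?thesis .
    qed
    have E2: "prob (E h k a) \<le> 100000 * (u / 2)\<^sup>2 / a ^ 4"
    proof -
      have "prob (E h k a) \<le> 100000 * (\<mu> k - \<mu> h)\<^sup>2 / a ^ 4"
        unfolding E_def by (rule less.hyps) (use g h less.prems ab in auto)
      also have "\<dots> \<le> 100000 * (u / 2)\<^sup>2 / a ^ 4"
        using hu monoD[OF \<mu> h(3)] ab by (intro divide_right_mono mult_left_mono power_mono) auto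
      finally show ?thesis .
    qed
    have D12: "prob (D i g k b) \<le> u\<^sup>2 / b ^ 4" "prob (D i h k b) \<le> u\<^sup>2 / b ^ 4"
      unfolding D_def u_def by (rule two; use g h less.prems ab in auto)+
    have "prob (E i k r) \<le> prob ((E i g a \<union> E h k a) \<union> (D i g k b \<union> D i h k b))"
      by (intro finite_measure_mono inc) auto
    also have "\<dots> \<le> prob (E i g a \<union> E h k a) + prob (D i g k b \<union> D i h k b)"
      by (intro measure_Un_le) auto
    also have "\<dots> \<le> (prob (E i g a) + prob (E h k a)) + (prob (D i g k b) + prob (D i h k b))"
      by (intro add_mono measure_Un_le) auto
    also have "\<dots> \<le> 2 * (100000 * (u / 2)\<^sup>2 / a ^ 4) + 2 * (u\<^sup>2 / b ^ 4)"
      using E1 E2 D12 by linarith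
    \<comment> \<open>The numerical factor is about \<open>96208\<close>.\<close>
    also have "\<dots> = (50000 * (10 / 9) ^ 4 + 20000) * (u\<^sup>2 / r ^ 4)"
      using l by (simp add: a_def b_def power_mult_distrib power_divide field_simps)
    also have "\<dots> \<le> 100000 * (u\<^sup>2 / r ^ 4)"
      using l by (intro mult_right_mono) (simp_all add: power_divide)
    finally show ?thesis by (simp add: E_def u_def)
  qed
qed

section \<open>Weighted sums over an i.i.d. field\<close>

text \<open>The upper estimate passes through \<open>1 / (1 + u)\<close>, because
  \<open>(1 - u + u\<^sup>2) * (1 + u) = 1 + u ^ 3\<close>.\<close>

lemma exp_minus_approx: "0 \<le> u \<Longrightarrow> \<bar>exp (- u) - (1 - u)\<bar> \<le> u\<^sup>2" for u :: real
proof -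
  assume u: "0 \<le> u"
  have "1 \<le> (1 - u + u\<^sup>2) * (1 + u)" using u by (simp add: algebra_simps power2_eq_square)
  then have "1 / (1 + u) \<le> 1 - u + u\<^sup>2" using u by (simp add: divide_le_eq)
  moreover have "exp (- u) \<le> 1 / (1 + u)"
    using exp_ge_add_one_self[of u] u by (simp add: exp_minus inverse_eq_divide frac_le)
  moreover have "1 - u \<le> exp (- u)" using exp_ge_add_one_self[of "- u"] by simp
  ultimately show ?thesis by simp
qed

locale iid_field = prob_space M for M :: "'a measure" +
  fixes X :: "'l \<Rightarrow> 'a \<Rightarrow> real" and D :: "real measure"
  assumes indep: "indep_vars (\<lambda>_. borel) X UNIV"
    and law: "\<And>l. distr M borel (X l) = D"
begin

lemma X_measurable [measurable]: "X l \<in> borel_measurable M"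
  using indep by (auto simp: indep_vars_def)

lemma sets_D [simp, measurable_cong]: "sets D = sets borel" and space_D [simp]: "space D = UNIV"
  by (auto simp: law[symmetric, of undefined])

sublocale D: prob_space D
  unfolding law[symmetric, of undefined] by (rule prob_space_distr) simp

sublocale D: real_distribution D
  by standard auto

lemma expectation_X: "f \<in> borel_measurable borel \<Longrightarrow> expectation (\<lambda>\<omega>. f (X l \<omega>)) = integral\<^sup>L D f"
  for f :: "real \<Rightarrow> real"
  unfolding law[symmetric, of l] by (rule integral_distr[symmetric]) auto

definition wsum :: "('l \<Rightarrow> real) \<Rightarrow> (real \<Rightarrow> real) \<Rightarrow> 'l set \<Rightarrow> 'a \<Rightarrow> real" where
  "wsum a f L \<omega> = (\<Sum>l\<in>L. a l * f (X l \<omega>))"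

lemma wsum_measurable [measurable]:
  assumes [measurable]: "f \<in> borel_measurable borel"
  shows "wsum a f L \<in> borel_measurable M"
  unfolding wsum_def by measurable

lemma wsum_bound: "(\<And>x. \<bar>f x\<bar> \<le> C) \<Longrightarrow> \<bar>wsum a f L \<omega>\<bar> \<le> (\<Sum>l\<in>L. \<bar>a l\<bar>) * C"
  unfolding wsum_def sum_distrib_right
  by (rule order_trans[OF sum_abs]) (auto simp: abs_mult intro!: sum_mono mult_left_mono)

lemma bounded_integrable:
  "f \<in> borel_measurable M \<Longrightarrow> (\<And>\<omega>. \<bar>f \<omega>\<bar> \<le> C) \<Longrightarrow> integrable M f" for f :: "'a \<Rightarrow> real"
  by (rule integrable_const_bound[of _ C]) auto

lemma bounded_integrable_D:
  "f \<in> borel_measurable borel \<Longrightarrow> (\<And>x. \<bar>f x\<bar> \<le> C) \<Longrightarrow> integrable D f" for f :: "real \<Rightarrow> real"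
  by (rule D.integrable_const_bound[of _ C]) auto

text \<open>This serves inductions that add one site at a time: \<open>X l\<close> is independent of
  the joint family over \<open>L\<close>, hence of any monomial in the two sums, and boundedness
  makes everything integrable.\<close>

lemma expectation_wsum_mult:
  assumes [measurable]: "f \<in> borel_measurable borel" "g \<in> borel_measurable borel" "h \<in> borel_measurable borel"
    and fb: "\<And>x. \<bar>f x\<bar> \<le> C" and gb: "\<And>x. \<bar>g x\<bar> \<le> C" and hb: "\<And>x. \<bar>h x\<bar> \<le> C'"
    and l: "l \<notin> L"
  shows "expectation (\<lambda>\<omega>. (wsum a f L \<omega> ^ i * wsum a g L \<omega> ^ j) * h (X l \<omega>)) =
      expectation (\<lambda>\<omega>. wsum a f L \<omega> ^ i * wsum a g L \<omega> ^ j) * integral\<^sup>L D h" (is ?eq)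
    and "integrable M (\<lambda>\<omega>. (wsum a f L \<omega> ^ i * wsum a g L \<omega> ^ j) * h (X l \<omega>))" (is ?int)
    and "integrable M (\<lambda>\<omega>. wsum a f L \<omega> ^ i * wsum a g L \<omega> ^ j)" (is ?int')
proof -
  define K where "K = (\<Sum>l\<in>L. \<bar>a l\<bar>) * C"
  have K: "\<bar>wsum a f L \<omega>\<bar> \<le> K" "\<bar>wsum a g L \<omega>\<bar> \<le> K" for \<omega>
    unfolding K_def using fb gb by (auto intro!: wsum_bound)
  have K': "\<bar>wsum a f L \<omega> ^ i * wsum a g L \<omega> ^ j\<bar> \<le> K ^ i * K ^ j" for \<omega>
    unfolding abs_mult power_abs using K[of \<omega>] by (intro mult_mono power_mono) auto
  show int': ?int' by (rule bounded_integrable[OF _ K']) measurable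
  have int_h: "integrable M (\<lambda>\<omega>. h (X l \<omega>))" by (rule bounded_integrable[OF _ hb]) measurable
  have "\<bar>(wsum a f L \<omega> ^ i * wsum a g L \<omega> ^ j) * h (X l \<omega>)\<bar> \<le> (K ^ i * K ^ j) * C'" for \<omega>
    unfolding abs_mult[of _ "h _"] using K'[of \<omega>] hb by (intro mult_mono) (auto intro: order_trans[OF abs_ge_zero])
  then show ?int by (rule bounded_integrable[rotated]) measurable
  define \<phi> where "\<phi> x = (\<Sum>l\<in>L. a l * f (x l)) ^ i * (\<Sum>l\<in>L. a l * g (x l)) ^ j" for x :: "'l \<Rightarrow> real"
  have \<phi>: "\<phi> \<in> borel_measurable (PiM L (\<lambda>_. borel))" unfolding \<phi>_def by measurable
  have "indep_var (PiM L (\<lambda>_. borel)) (\<lambda>\<omega>. \<lambda>i\<in>L. X i \<omega>) (PiM {l} (\<lambda>_. borel)) (\<lambda>\<omega>. \<lambda>i\<in>{l}. X i \<omega>)"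
    by (rule indep_var_restrict[OF indep]) (use l in auto)
  then have "indep_var borel (\<phi> \<circ> (\<lambda>\<omega>. \<lambda>i\<in>L. X i \<omega>)) borel ((\<lambda>x. h (x l)) \<circ> (\<lambda>\<omega>. \<lambda>i\<in>{l}. X i \<omega>))"
    by (rule indep_var_compose) (use \<phi> in measurable)
  moreover have "\<phi> \<circ> (\<lambda>\<omega>. \<lambda>i\<in>L. X i \<omega>) = (\<lambda>\<omega>. wsum a f L \<omega> ^ i * wsum a g L \<omega> ^ j)"
    by (auto simp: \<phi>_def wsum_def fun_eq_iff)
  moreover have "(\<lambda>x. h (x l)) \<circ> (\<lambda>\<omega>. \<lambda>i\<in>{l}. X i \<omega>) = (\<lambda>\<omega>. h (X l \<omega>))" by auto
  ultimately have "indep_var borel (\<lambda>\<omega>. wsum a f L \<omega> ^ i * wsum a g L \<omega> ^ j) borel (\<lambda>\<omega>. h (X l \<omega>))" by simp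
  from indep_var_lebesgue_integral[OF this int' int_h] show ?eq by (simp add: expectation_X)
qed

text \<open>
  The hypothesis \<open>c2\<close> is the Cauchy--Schwarz inequality. It is assumed because it is immediate in both applications.
\<close>

lemma fourth_moment:
  assumes [measurable]: "f \<in> borel_measurable borel" "g \<in> borel_measurable borel"
    and fb: "\<And>x. \<bar>f x\<bar> \<le> C" and gb: "\<And>x. \<bar>g x\<bar> \<le> C"
    and f0: "integral\<^sup>L D f = 0" and g0: "integral\<^sup>L D g = 0"
    and c2: "(\<integral>x. f x * g x \<partial>D)\<^sup>2 \<le> (\<integral>x. (f x)\<^sup>2 \<partial>D) * (\<integral>x. (g x)\<^sup>2 \<partial>D)"
    and L: "finite L"
  shows "expectation (wsum a f L) = 0"
    and "expectation (\<lambda>\<omega>. (wsum a f L \<omega>)\<^sup>2) = (\<Sum>l\<in>L. (a l)\<^sup>2) * (\<integral>x. (f x)\<^sup>2 \<partial>D)"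
    and "expectation (\<lambda>\<omega>. (wsum a f L \<omega>)\<^sup>2 * (wsum a g L \<omega>)\<^sup>2) \<le>
      3 * ((\<Sum>l\<in>L. (a l)\<^sup>2) * (\<integral>x. (f x)\<^sup>2 \<partial>D)) * ((\<Sum>l\<in>L. (a l)\<^sup>2) * (\<integral>x. (g x)\<^sup>2 \<partial>D))
        + (\<Sum>l\<in>L. a l ^ 4) * (\<integral>x. (f x)\<^sup>2 * (g x)\<^sup>2 \<partial>D)"
proof -
  define vf where "vf = (\<integral>x. (f x)\<^sup>2 \<partial>D)"
  define vg where "vg = (\<integral>x. (g x)\<^sup>2 \<partial>D)"
  define c where "c = (\<integral>x. f x * g x \<partial>D)"
  define q where "q = (\<integral>x. (f x)\<^sup>2 * (g x)\<^sup>2 \<partial>D)"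
  have v0: "vf \<ge> 0" "vg \<ge> 0" by (simp_all add: vf_def vg_def)
  have C0: "C \<ge> 0" using fb[of 0] by linarith
  have fgb: "\<bar>f x ^ i * g x ^ j\<bar> \<le> C ^ i * C ^ j" for x i j
    unfolding abs_mult power_abs using fb[of x] gb[of x] C0 by (intro mult_mono power_mono) auto
  note E = expectation_wsum_mult(1)[where f=f and g=g and C=C and a=a, OF _ _ _ fb gb fgb]
  note I = expectation_wsum_mult(2)[where f=f and g=g and C=C and a=a, OF _ _ _ fb gb fgb]
  note I' = expectation_wsum_mult(3)[where f=f and g=g and C=C and a=a and h="\<lambda>_. 0" and C'=0, OF _ _ _ fb gb]
  \<comment> \<open>Adding a site to the fourth moment produces the first, second and mixed moments
    of both sums, so these are carried through the same induction.\<close>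
  have all: "expectation (wsum a f L) = 0 \<and> expectation (wsum a g L) = 0 \<and>
    expectation (\<lambda>\<omega>. (wsum a f L \<omega>)\<^sup>2) = (\<Sum>l\<in>L. (a l)\<^sup>2) * vf \<and>
    expectation (\<lambda>\<omega>. (wsum a g L \<omega>)\<^sup>2) = (\<Sum>l\<in>L. (a l)\<^sup>2) * vg \<and>
    expectation (\<lambda>\<omega>. wsum a f L \<omega> * wsum a g L \<omega>) = (\<Sum>l\<in>L. (a l)\<^sup>2) * c \<and>
    expectation (\<lambda>\<omega>. (wsum a f L \<omega>)\<^sup>2 * (wsum a g L \<omega>)\<^sup>2) \<le>
      3 * ((\<Sum>l\<in>L. (a l)\<^sup>2) * vf) * ((\<Sum>l\<in>L. (a l)\<^sup>2) * vg) + (\<Sum>l\<in>L. a l ^ 4) * q"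
    using L
  proof (induction L)
    case empty
    show ?case by (simp add: wsum_def)
  next
    case (insert l L)
    note l = \<open>l \<notin> L\<close>
    define A where "A = wsum a f L"
    define B where "B = wsum a g L"
    define s where "s = (\<Sum>l\<in>L. (a l)\<^sup>2)"
    define b where "b = a l"
    have s0: "s \<ge> 0" by (simp add: s_def sum_nonneg)
    have Af: "wsum a f (insert l L) \<omega> = A \<omega> + b * f (X l \<omega>)"
      and Bg: "wsum a g (insert l L) \<omega> = B \<omega> + b * g (X l \<omega>)" for \<omega>
      using insert by (simp_all add: wsum_def A_def B_def b_def)
    define T where "T i j i' j' \<omega> = (A \<omega> ^ i * B \<omega> ^ j) * (f (X l \<omega>) ^ i' * g (X l \<omega>) ^ j')" for i j i' j' \<omega>
    have ET: "expectation (T i j i' j') = expectation (\<lambda>\<omega>. A \<omega> ^ i * B \<omega> ^ j) * (\<integral>x. f x ^ i' * g x ^ j' \<partial>D)"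
      and IT [simp]: "integrable M (T i j i' j')" for i j i' j'
      unfolding T_def A_def B_def by (intro E I l; measurable)+
    note IH = insert.IH[folded A_def B_def s_def]
    have D1: "D.prob UNIV = 1" using D.prob_space by simp
    note ETs = ET IH f0 g0 D1 prob_space vf_def[symmetric] vg_def[symmetric] c_def[symmetric] q_def[symmetric]
    \<comment> \<open>Expansion into the monomials \<open>T\<close>, whose expectations factor.
      Every monomial with an isolated first power of a centered factor, such as
      \<open>T 2 1 0 1\<close> or \<open>T 1 0 1 2\<close>, has expectation
      \<open>0\<close>.\<close>
    have e1: "(\<lambda>\<omega>. A \<omega> + b * f (X l \<omega>)) = (\<lambda>\<omega>. T 1 0 0 0 \<omega> + b * T 0 0 1 0 \<omega>)"
      and e2: "(\<lambda>\<omega>. B \<omega> + b * g (X l \<omega>)) = (\<lambda>\<omega>. T 0 1 0 0 \<omega> + b * T 0 0 0 1 \<omega>)"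
      and e3: "(\<lambda>\<omega>. (A \<omega> + b * f (X l \<omega>))\<^sup>2) = (\<lambda>\<omega>. T 2 0 0 0 \<omega> + 2 * b * T 1 0 1 0 \<omega> + b\<^sup>2 * T 0 0 2 0 \<omega>)"
      and e4: "(\<lambda>\<omega>. (B \<omega> + b * g (X l \<omega>))\<^sup>2) = (\<lambda>\<omega>. T 0 2 0 0 \<omega> + 2 * b * T 0 1 0 1 \<omega> + b\<^sup>2 * T 0 0 0 2 \<omega>)"
      and e5: "(\<lambda>\<omega>. (A \<omega> + b * f (X l \<omega>)) * (B \<omega> + b * g (X l \<omega>))) =
        (\<lambda>\<omega>. T 1 1 0 0 \<omega> + b * T 1 0 0 1 \<omega> + b * T 0 1 1 0 \<omega> + b\<^sup>2 * T 0 0 1 1 \<omega>)"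
      and e6: "(\<lambda>\<omega>. (A \<omega> + b * f (X l \<omega>))\<^sup>2 * (B \<omega> + b * g (X l \<omega>))\<^sup>2) =
        (\<lambda>\<omega>. T 2 2 0 0 \<omega> + 2 * b * T 2 1 0 1 \<omega> + b\<^sup>2 * T 2 0 0 2 \<omega> + 2 * b * T 1 2 1 0 \<omega> + 4 * b\<^sup>2 * T 1 1 1 1 \<omega>
           + 2 * b ^ 3 * T 1 0 1 2 \<omega> + b\<^sup>2 * T 0 2 2 0 \<omega> + 2 * b ^ 3 * T 0 1 2 1 \<omega> + b ^ 4 * T 0 0 2 2 \<omega>)"
      by (simp_all add: fun_eq_iff T_def power2_eq_square power3_eq_cube power4_eq_xxxx algebra_simps)
    have S: "(\<Sum>l\<in>insert l L. (a l)\<^sup>2) = s + b\<^sup>2" "(\<Sum>l\<in>insert l L. a l ^ 4) = (\<Sum>l\<in>L. a l ^ 4) + b ^ 4"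
      using insert by (simp_all add: s_def b_def)
    \<comment> \<open>This is the origin of the factor \<open>3\<close>: \<open>T 2 0 0 2\<close>
      and \<open>T 0 2 2 0\<close> contribute \<open>b\<^sup>2 * s * vf * vg\<close> once each and
      \<open>T 1 1 1 1\<close> at most four times, and six is the cross term of
      \<open>3 * (s + b\<^sup>2)\<^sup>2\<close>.\<close>
    have x: "4 * b\<^sup>2 * (s * c * c) \<le> 4 * b\<^sup>2 * (s * (vf * vg))"
      using c2 s0 by (intro mult_left_mono) (simp_all add: c_def vf_def vg_def power2_eq_square mult.assoc mult_left_mono)
    have z: "0 \<le> 3 * b ^ 4 * (vf * vg)" using v0 by simp
    have "3 * ((s + b\<^sup>2) * vf) * ((s + b\<^sup>2) * vg) =
      3 * (s * vf) * (s * vg) + 2 * (b\<^sup>2 * s * vf * vg) + 4 * b\<^sup>2 * (s * (vf * vg)) + 3 * b ^ 4 * (vf * vg)"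
      by (simp add: power2_eq_square power4_eq_xxxx algebra_simps)
    with x z show ?case
      unfolding Af Bg e1 e2 e3 e4 e5 e6 S using IH
      by (simp add: ETs algebra_simps)
  qed
  then show "expectation (wsum a f L) = 0"
    "expectation (\<lambda>\<omega>. (wsum a f L \<omega>)\<^sup>2) = (\<Sum>l\<in>L. (a l)\<^sup>2) * (\<integral>x. (f x)\<^sup>2 \<partial>D)"
    "expectation (\<lambda>\<omega>. (wsum a f L \<omega>)\<^sup>2 * (wsum a g L \<omega>)\<^sup>2) \<le>
      3 * ((\<Sum>l\<in>L. (a l)\<^sup>2) * (\<integral>x. (f x)\<^sup>2 \<partial>D)) * ((\<Sum>l\<in>L. (a l)\<^sup>2) * (\<integral>x. (g x)\<^sup>2 \<partial>D))
        + (\<Sum>l\<in>L. a l ^ 4) * (\<integral>x. (f x)\<^sup>2 * (g x)\<^sup>2 \<partial>D)"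
    by (auto simp: vf_def vg_def q_def)
qed

text \<open>Both sides are products over the sites of factors of modulus at most \<open>1\<close>,
  so the errors of the factors add up. A second-order expansion makes each error a multiple of
  \<open>\<bar>a l\<bar> ^ 3\<close> plus a multiple of \<open>a l ^ 4\<close>, both at most
  \<open>m * (a l)\<^sup>2\<close>, and the squares sum to \<open>1\<close>. The argument
  \<open>1\<close> is enough because coefficients can be absorbed into \<open>f\<close>.\<close>

lemma char_wsum_approx:
  assumes [measurable]: "f \<in> borel_measurable borel" and fb: "\<And>x. \<bar>f x\<bar> \<le> C"
    and f0: "integral\<^sup>L D f = 0" and v: "v = (\<integral>x. (f x)\<^sup>2 \<partial>D)" and L: "finite L"
    and a2: "(\<Sum>l\<in>L. (a l)\<^sup>2) = 1" and am: "\<And>l. l \<in> L \<Longrightarrow> \<bar>a l\<bar> \<le> m" and m: "m \<le> 1"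
  shows "cmod (char (distr M borel (wsum a f L)) 1 - exp (- v / 2)) \<le> (C ^ 3 + v\<^sup>2) * m"
proof -
  have C0: "C \<ge> 0" using fb[of 0] by linarith
  have v0: "v \<ge> 0" by (simp add: v)
  define Z where "Z l \<omega> = a l * f (X l \<omega>)" for l \<omega>
  have Zb: "\<bar>Z l \<omega>\<bar> \<le> \<bar>a l\<bar> * C" for l \<omega> unfolding Z_def abs_mult using fb by (intro mult_left_mono) auto
  have Zm [measurable]: "Z l \<in> borel_measurable M" for l unfolding Z_def by measurable
  have "indep_vars (\<lambda>_. borel) Z L"
    unfolding Z_def by (rule indep_vars_compose2[OF indep_vars_subset[OF indep]]) auto
  then have prod: "char (distr M borel (wsum a f L)) 1 = (\<Prod>l\<in>L. char (distr M borel (Z l)) 1)"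
    using char_distr_sum[of Z L 1] unfolding wsum_def[abs_def] Z_def by simp
  have ex: "complex_of_real (exp (- v / 2)) = (\<Prod>l\<in>L. of_real (exp (- ((a l)\<^sup>2 * v / 2))))"
  proof -
    have "- v / 2 = (\<Sum>l\<in>L. - ((a l)\<^sup>2 * v / 2))"
      using a2 by (simp add: sum_negf sum_divide_distrib[symmetric] sum_distrib_right[symmetric])
    then show ?thesis using L by (simp add: exp_sum)
  qed
  have each: "cmod (char (distr M borel (Z l)) 1 - of_real (exp (- ((a l)\<^sup>2 * v / 2)))) \<le> (C ^ 3 + v\<^sup>2) * m * (a l)\<^sup>2"
    if l: "l \<in> L" for l
  proof -
    have EZ: "expectation (Z l) = 0"
      unfolding Z_def using expectation_X[of f l] f0 by simp
    have EZ2: "expectation (\<lambda>\<omega>. (Z l \<omega>)\<^sup>2) = (a l)\<^sup>2 * v"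
      unfolding Z_def power_mult_distrib using expectation_X[of "\<lambda>x. (f x)\<^sup>2" l] v by simp
    have Z2b: "\<bar>(Z l \<omega>)\<^sup>2\<bar> \<le> (\<bar>a l\<bar> * C)\<^sup>2" for \<omega>
      using power_mono[OF Zb[of l \<omega>], of 2] by simp
    have *: "cmod (char (distr M borel (Z l)) 1 - (1 - 1\<^sup>2 * ((a l)\<^sup>2 * v) / 2)) \<le>
        (1\<^sup>2 / 6) * expectation (\<lambda>\<omega>. min (6 * (Z l \<omega>)\<^sup>2) (\<bar>1\<bar> * \<bar>Z l \<omega>\<bar> ^ 3))"
      by (rule char_approx3')
        (use EZ EZ2 in \<open>auto intro: bounded_integrable[OF _ Zb] bounded_integrable[OF _ Z2b]\<close>)
    have "expectation (\<lambda>\<omega>. min (6 * (Z l \<omega>)\<^sup>2) (\<bar>1\<bar> * \<bar>Z l \<omega>\<bar> ^ 3)) \<le> expectation (\<lambda>\<omega>. (\<bar>a l\<bar> * C) ^ 3)"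
    proof (rule integral_mono)
      have b3: "min (6 * (Z l \<omega>)\<^sup>2) (\<bar>1\<bar> * \<bar>Z l \<omega>\<bar> ^ 3) \<le> (\<bar>a l\<bar> * C) ^ 3" for \<omega>
        using power_mono[OF Zb[of l \<omega>], of 3] by (simp add: min.coboundedI2)
      then show "min (6 * (Z l \<omega>)\<^sup>2) (\<bar>1\<bar> * \<bar>Z l \<omega>\<bar> ^ 3) \<le> (\<bar>a l\<bar> * C) ^ 3" for \<omega> .
      show "integrable M (\<lambda>\<omega>. min (6 * (Z l \<omega>)\<^sup>2) (\<bar>1\<bar> * \<bar>Z l \<omega>\<bar> ^ 3))"
        by (rule bounded_integrable[where C="(\<bar>a l\<bar> * C) ^ 3"]) (use b3 in auto)
    qed simp
    also have "\<dots> = (\<bar>a l\<bar> * C) ^ 3" using prob_space by simp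
    finally have E3: "expectation (\<lambda>\<omega>. min (6 * (Z l \<omega>)\<^sup>2) (\<bar>1\<bar> * \<bar>Z l \<omega>\<bar> ^ 3)) \<le> (\<bar>a l\<bar> * C) ^ 3" .
    have "0 \<le> (\<bar>a l\<bar> * C) ^ 3" using C0 by simp
    then have "(1\<^sup>2 / 6) * expectation (\<lambda>\<omega>. min (6 * (Z l \<omega>)\<^sup>2) (\<bar>1\<bar> * \<bar>Z l \<omega>\<bar> ^ 3)) \<le> (\<bar>a l\<bar> * C) ^ 3"
      using E3 unfolding power_one by linarith
    from order_trans[OF * this]
    have 1: "cmod (char (distr M borel (Z l)) 1 - (1 - (a l)\<^sup>2 * v / 2)) \<le> (\<bar>a l\<bar> * C) ^ 3"
      by simp
    have al: "\<bar>a l\<bar> \<le> m" "\<bar>a l\<bar> \<le> 1" using am[OF l] m by auto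
    have a3: "\<bar>a l\<bar> ^ 3 \<le> m * (a l)\<^sup>2"
    proof -
      have "\<bar>a l\<bar> ^ 3 = \<bar>a l\<bar> * (a l)\<^sup>2" by (simp add: power3_eq_cube power2_eq_square)
      also have "\<dots> \<le> m * (a l)\<^sup>2" using al by (intro mult_right_mono) auto
      finally show ?thesis .
    qed
    have a4: "(a l)\<^sup>2 * (a l)\<^sup>2 \<le> m * (a l)\<^sup>2"
    proof (rule mult_right_mono)
      have "(a l)\<^sup>2 = \<bar>a l\<bar> * \<bar>a l\<bar>" by (simp add: power2_eq_square)
      also have "\<dots> \<le> m * 1" using al by (intro mult_mono) auto
      finally show "(a l)\<^sup>2 \<le> m" by simp
    qed simp
    have 2: "cmod (of_real (exp (- ((a l)\<^sup>2 * v / 2))) - of_real (1 - (a l)\<^sup>2 * v / 2)) \<le> ((a l)\<^sup>2 * v / 2)\<^sup>2"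
      unfolding of_real_diff[symmetric] norm_of_real by (rule exp_minus_approx) (use v0 in simp)
    have "cmod (char (distr M borel (Z l)) 1 - of_real (exp (- ((a l)\<^sup>2 * v / 2)))) \<le>
      cmod (char (distr M borel (Z l)) 1 - of_real (1 - (a l)\<^sup>2 * v / 2)) +
      cmod (of_real (exp (- ((a l)\<^sup>2 * v / 2))) - of_real (1 - (a l)\<^sup>2 * v / 2))"
      by (rule norm_triangle_ineq4[THEN order_trans[rotated]]) simp
    also have "\<dots> \<le> (\<bar>a l\<bar> * C) ^ 3 + ((a l)\<^sup>2 * v / 2)\<^sup>2" using 1 2 by (intro add_mono) simp_all
    also have "\<dots> \<le> C ^ 3 * \<bar>a l\<bar> ^ 3 + v\<^sup>2 * ((a l)\<^sup>2 * (a l)\<^sup>2)"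
      by (simp add: power_mult_distrib power_divide power2_eq_square[of "(a l)\<^sup>2"] algebra_simps)
    also have "\<dots> \<le> C ^ 3 * (m * (a l)\<^sup>2) + v\<^sup>2 * (m * (a l)\<^sup>2)"
      using a3 a4 C0 by (intro add_mono mult_left_mono) auto
    finally show ?thesis by (simp add: algebra_simps)
  qed
  have "cmod (char (distr M borel (wsum a f L)) 1 - exp (- v / 2)) \<le>
    (\<Sum>l\<in>L. cmod (char (distr M borel (Z l)) 1 - of_real (exp (- ((a l)\<^sup>2 * v / 2)))))"
    unfolding prod ex
  proof (rule norm_prod_diff)
    fix l
    have "real_distribution (distr M borel (Z l))" by (rule real_distribution_distr) simp
    then show "cmod (char (distr M borel (Z l)) 1) \<le> 1" by (rule real_distribution.cmod_char_le_1)
    show "cmod (of_real (exp (- ((a l)\<^sup>2 * v / 2)))) \<le> 1" using v0 by simp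
  qed
  also have "\<dots> \<le> (\<Sum>l\<in>L. (C ^ 3 + v\<^sup>2) * m * (a l)\<^sup>2)" by (intro sum_mono each)
  also have "\<dots> = (C ^ 3 + v\<^sup>2) * m" using a2 by (simp add: sum_distrib_left[symmetric])
  finally show ?thesis .
qed

end

section \<open>Convergence of finite-dimensional distributions\<close>

text \<open>The two rules are those along which convergence of characteristic functions extends by
  linearity. Closure under products, needed for Stone--Weierstrass, is derived.\<close>

inductive_set trig_polys :: "nat set \<Rightarrow> ((nat \<Rightarrow> real) \<Rightarrow> complex) set" for I where
  exp: "(\<lambda>y. b * iexp (\<Sum>i\<in>I. c i * y i)) \<in> trig_polys I"
| add: "h \<in> trig_polys I \<Longrightarrow> k \<in> trig_polys I \<Longrightarrow> (\<lambda>y. h y + k y) \<in> trig_polys I"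

lemma trig_polys_const: "(\<lambda>_. b) \<in> trig_polys I"
  using trig_polys.exp[of b "\<lambda>_. 0" I] by simp

lemma trig_polys_mult:
  assumes "h \<in> trig_polys I" "k \<in> trig_polys I"
  shows "(\<lambda>y. h y * k y) \<in> trig_polys I"
  using assms(1)
proof induction
  case (exp b c)
  show ?case
    using assms(2)
  proof induction
    case (exp b' c')
    have "(\<lambda>y. b * iexp (\<Sum>i\<in>I. c i * y i) * (b' * iexp (\<Sum>i\<in>I. c' i * y i))) =
      (\<lambda>y. (b * b') * iexp (\<Sum>i\<in>I. (c i + c' i) * y i))"
      by (simp add: fun_eq_iff exp_add[symmetric] distrib_left distrib_right sum.distrib mult_ac add_ac)
    then show ?case using trig_polys.exp[of "b * b'" "\<lambda>i. c i + c' i" I] by simp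
  next
    case (add h k)
    then show ?case using trig_polys.add[OF add.IH] by (simp add: distrib_left)
  qed
next
  case (add h' k')
  then show ?case using trig_polys.add[OF add.IH] by (simp add: distrib_right)
qed

lemma trig_polys_sin:
  assumes "finite I" "i \<in> I"
  shows "(\<lambda>y. complex_of_real (sin (\<kappa> * y i))) \<in> trig_polys I"
proof -
  define c where "c r j = (if j = i then r else 0)" for r :: real and j
  have s: "(\<Sum>j\<in>I. c r j * y j) = r * y i" for r y
  proof -
    have "(\<Sum>j\<in>I. c r j * y j) = (\<Sum>j\<in>I. if j = i then r * y i else 0)"
      by (intro sum.cong) (auto simp: c_def)
    then show ?thesis using assms by simp
  qed
  have "(\<lambda>y. 1 / (2 * \<i>) * iexp (\<Sum>j\<in>I. c \<kappa> j * y j) + (- 1 / (2 * \<i>)) * iexp (\<Sum>j\<in>I. c (- \<kappa>) j * y j)) \<in> trig_polys I"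
    by (rule trig_polys.add[OF trig_polys.exp trig_polys.exp])
  moreover have "(\<lambda>y. 1 / (2 * \<i>) * iexp (\<Sum>j\<in>I. c \<kappa> j * y j) + (- 1 / (2 * \<i>)) * iexp (\<Sum>j\<in>I. c (- \<kappa>) j * y j)) =
      (\<lambda>y. complex_of_real (sin (\<kappa> * y i)))"
  proof
    fix y
    have "complex_of_real (sin (\<kappa> * y i)) = (iexp (\<kappa> * y i) - iexp (- \<kappa> * y i)) / (2 * \<i>)"
      unfolding sin_of_real[symmetric] sin_exp_eq by simp
    also have "\<dots> = 1 / (2 * \<i>) * iexp (\<kappa> * y i) + (- 1 / (2 * \<i>)) * iexp (- \<kappa> * y i)"
      by (simp add: diff_divide_distrib right_diff_distrib)
    finally show "1 / (2 * \<i>) * iexp (\<Sum>j\<in>I. c \<kappa> j * y j) + (- 1 / (2 * \<i>)) * iexp (\<Sum>j\<in>I. c (- \<kappa>) j * y j) =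
        complex_of_real (sin (\<kappa> * y i))"
      unfolding s by (rule sym)
  qed
  ultimately show ?thesis by simp
qed

text \<open>
  The function \<open>G\<close> is replaced by \<open>G \<circ> arcsin \<circ> sin\<close> (suitably scaled), which agrees with \<open>G\<close> on a
  large cube and factors through a compact cube, where Stone--Weierstrass applies. Being bounded
  everywhere, the approximation is controlled outside the cube as well.
\<close>

lemma trig_approximation:
  fixes G :: "(nat \<Rightarrow> real) \<Rightarrow> real"
  assumes I: "finite I" and R: "R > 0" and e: "e > 0"
    and G: "continuous_on UNIV G" and B: "\<And>y. \<bar>G y\<bar> \<le> B"
    and dep: "\<And>y y'. (\<And>i. i \<in> I \<Longrightarrow> y i = y' i) \<Longrightarrow> G y = G y'"
  obtains p where "(\<lambda>y. complex_of_real (p y)) \<in> trig_polys I"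
    and "\<And>y. \<bar>G y - p y\<bar> \<le> e + 2 * B * (\<Sum>i\<in>I. (y i)\<^sup>2) / R\<^sup>2"
proof -
  \<comment> \<open>This scale maps the range from \<open>- R\<close> to \<open>R\<close> onto the
    range on which \<open>arcsin\<close> inverts \<open>sin\<close>.\<close>
  define \<kappa> where "\<kappa> = pi / (2 * R)"
  have \<kappa>: "\<kappa> > 0" using R by (simp add: \<kappa>_def)
  have B0: "B \<ge> 0" using B[of undefined] by linarith
  \<comment> \<open>Coordinates outside \<open>I\<close> are frozen at \<open>0\<close>: the product
    is compact, and two distinct points of it differ at an index of \<open>I\<close>, where a sine
    separates them.\<close>
  define S where "S = (\<Pi>\<^sub>E i\<in>UNIV. if i \<in> I then {-1..1::real} else {0})"
  define \<phi> where "\<phi> y = (\<lambda>i. if i \<in> I then sin (\<kappa> * y i) else 0)" for y :: "nat \<Rightarrow> real"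
  define \<psi> where "\<psi> s = (\<lambda>i. if i \<in> I then arcsin (s i) / \<kappa> else 0)" for s :: "nat \<Rightarrow> real"
  define A where "A = {p. continuous_on S p \<and> (\<lambda>y. complex_of_real (p (\<phi> y))) \<in> trig_polys I}"
  have \<phi>S: "\<phi> y \<in> S" for y by (auto simp: S_def \<phi>_def)
  interpret function_ring_on A S
  proof
    have "compactin (product_topology (\<lambda>i. euclidean) UNIV) S"
      unfolding S_def by (subst compactin_PiE) auto
    then show "compact S" by (simp add: euclidean_product_topology)
    show "continuous_on S f" if "f \<in> A" for f using that by (simp add: A_def)
    show "(\<lambda>x. f x + g x) \<in> A" if "f \<in> A" "g \<in> A" for f g
      using that by (auto simp: A_def intro!: continuous_intros trig_polys.add)
    show "(\<lambda>x. f x * g x) \<in> A" if "f \<in> A" "g \<in> A" for f g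
      using that by (auto simp: A_def intro!: continuous_intros trig_polys_mult)
    show "(\<lambda>_. c) \<in> A" for c by (auto simp: A_def trig_polys_const)
    show "\<exists>f\<in>A. f x \<noteq> f y" if xy: "x \<in> S" "y \<in> S" "x \<noteq> y" for x y
    proof -
      obtain i where i: "x i \<noteq> y i" using xy by (auto simp: fun_eq_iff)
      then have iI: "i \<in> I" using xy by (force simp: S_def PiE_iff split: if_splits)
      have "(\<lambda>s. s i) \<in> A"
        unfolding A_def
      proof (intro CollectI conjI)
        show "continuous_on S (\<lambda>s. s i)"
          by (rule continuous_on_product_then_coordinatewise) (rule continuous_on_id)
        show "(\<lambda>y. complex_of_real (\<phi> y i)) \<in> trig_polys I"
          using trig_polys_sin[OF I iI, of \<kappa>] iI by (simp add: \<phi>_def)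
      qed
      then show ?thesis using i by (intro bexI[of _ "\<lambda>s. s i"]) auto
    qed
  qed
  have "continuous_on S (\<lambda>s. G (\<psi> s))"
  proof (rule continuous_on_compose2[OF G])
    show "continuous_on S \<psi>"
      unfolding \<psi>_def
    proof (rule continuous_on_coordinatewise_then_product)
      fix i
      show "continuous_on S (\<lambda>s. if i \<in> I then arcsin (s i) / \<kappa> else 0)"
      proof (cases "i \<in> I")
        case True
        have "continuous_on S (\<lambda>s. s i)"
          by (rule continuous_on_product_then_coordinatewise) (rule continuous_on_id)
        moreover have "\<forall>s\<in>S. -1 \<le> s i \<and> s i \<le> 1" using True by (auto simp: S_def PiE_iff split: if_splits)
        ultimately show ?thesis using True \<kappa> by (auto intro!: continuous_intros)
      qed simp
    qed
  qed simp
  from Stone_Weierstrass_basic[OF this e]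
  obtain p where p: "p \<in> A" "\<And>s. s \<in> S \<Longrightarrow> \<bar>G (\<psi> s) - p s\<bar> < e" by auto
  show thesis
  proof (rule that[of "\<lambda>y. p (\<phi> y)"])
    show "(\<lambda>y. complex_of_real (p (\<phi> y))) \<in> trig_polys I" using p by (simp add: A_def)
    fix y :: "nat \<Rightarrow> real"
    \<comment> \<open>Outside the cube some coordinate exceeds \<open>R\<close> in absolute value,
      so the quadratic expression is at least \<open>1\<close> and the trivial bound
      \<open>2 * B\<close> suffices. In this form the error can be integrated using second moments
      alone.\<close>
    have "\<bar>G y - G (\<psi> (\<phi> y))\<bar> \<le> 2 * B * (\<Sum>i\<in>I. (y i)\<^sup>2) / R\<^sup>2"
    proof (cases "\<forall>i\<in>I. \<bar>y i\<bar> \<le> R")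
      case True
      have "G (\<psi> (\<phi> y)) = G y"
      proof (rule dep)
        fix i assume i: "i \<in> I"
        have "\<bar>\<kappa> * y i\<bar> \<le> \<kappa> * R" using True i \<kappa> by (simp add: abs_mult)
        also have "\<kappa> * R = pi / 2" using R by (simp add: \<kappa>_def)
        finally have "arcsin (sin (\<kappa> * y i)) = \<kappa> * y i" by (intro arcsin_sin) auto
        then show "\<psi> (\<phi> y) i = y i" using i \<kappa> by (simp add: \<psi>_def \<phi>_def)
      qed
      then show ?thesis using B0 by (simp add: sum_nonneg)
    next
      case False
      then obtain i where i: "i \<in> I" "R < \<bar>y i\<bar>" by auto
      then have "R\<^sup>2 \<le> (y i)\<^sup>2" using R by (metis abs_of_pos less_imp_le power2_abs power_mono)
      also have "\<dots> \<le> (\<Sum>i\<in>I. (y i)\<^sup>2)" using I i by (intro member_le_sum) auto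
      finally have "1 \<le> (\<Sum>i\<in>I. (y i)\<^sup>2) / R\<^sup>2" using R by simp
      then have "2 * B * 1 \<le> 2 * B * ((\<Sum>i\<in>I. (y i)\<^sup>2) / R\<^sup>2)" using B0 by (intro mult_left_mono) auto
      then show ?thesis using B[of y] B[of "\<psi> (\<phi> y)"] by (simp add: abs_le_iff)
    qed
    then show "\<bar>G y - p (\<phi> y)\<bar> \<le> e + 2 * B * (\<Sum>i\<in>I. (y i)\<^sup>2) / R\<^sup>2"
      using p(2)[OF \<phi>S[of y]] by linarith
  qed
qed

lemma (in prob_space) trig_polys_integrable:
  assumes "h \<in> trig_polys I" and [measurable]: "\<And>i. (\<lambda>\<omega>. V \<omega> i) \<in> borel_measurable M"
  shows "integrable M (\<lambda>\<omega>. h (V \<omega>))"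
  using assms(1)
proof induction
  case (exp b c)
  show ?case by (rule integrable_const_bound[of _ "cmod b"]) (auto simp: norm_mult)
qed auto

text \<open>Characteristic functions determine the limits of integrals of trigonometric polynomials,
  and \<open>G\<close> is uniformly approximable by these up to an error quadratic in the
  coordinates. The second-moment bounds take the place of tightness in a multivariate continuity
  theorem.\<close>

theorem fidi_convergence:
  fixes Y :: "nat \<Rightarrow> 'a \<Rightarrow> nat \<Rightarrow> real" and Z :: "'b \<Rightarrow> nat \<Rightarrow> real" and G :: "(nat \<Rightarrow> real) \<Rightarrow> real"
  assumes P: "prob_space P" and Q: "prob_space Q" and I: "finite I"
    and Ym [measurable]: "\<And>n i. (\<lambda>\<omega>. Y n \<omega> i) \<in> borel_measurable P"
    and Zm [measurable]: "\<And>i. (\<lambda>\<omega>. Z \<omega> i) \<in> borel_measurable Q"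
    and char: "\<And>c. (\<lambda>n. \<integral>\<omega>. iexp (\<Sum>i\<in>I. c i * Y n \<omega> i) \<partial>P) \<longlonglongrightarrow> (\<integral>\<omega>. iexp (\<Sum>i\<in>I. c i * Z \<omega> i) \<partial>Q)"
    and Y2: "\<And>n i. i \<in> I \<Longrightarrow> integrable P (\<lambda>\<omega>. (Y n \<omega> i)\<^sup>2) \<and> (\<integral>\<omega>. (Y n \<omega> i)\<^sup>2 \<partial>P) \<le> C"
    and Z2: "\<And>i. i \<in> I \<Longrightarrow> integrable Q (\<lambda>\<omega>. (Z \<omega> i)\<^sup>2) \<and> (\<integral>\<omega>. (Z \<omega> i)\<^sup>2 \<partial>Q) \<le> C"
    and G: "continuous_on UNIV G" and B: "\<And>y. \<bar>G y\<bar> \<le> B"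
    and dep: "\<And>y y'. (\<And>i. i \<in> I \<Longrightarrow> y i = y' i) \<Longrightarrow> G y = G y'"
  shows "(\<lambda>n. \<integral>\<omega>. G (Y n \<omega>) \<partial>P) \<longlonglongrightarrow> (\<integral>\<omega>. G (Z \<omega>) \<partial>Q)"
proof (rule LIMSEQ_I)
  fix e :: real assume e: "e > 0"
  interpret P: prob_space P by fact
  interpret Q: prob_space Q by fact
  have B0: "B \<ge> 0" using B[of undefined] by linarith
  have Gm [measurable]: "G \<in> borel_measurable borel" by (rule borel_measurable_continuous_onI[OF G])
  have [measurable]: "Y n \<in> borel_measurable P" "Z \<in> borel_measurable Q" for n
    by (rule measurable_coordinatewise_then_product; measurable)+
  \<comment> \<open>Nothing forces \<open>C\<close> to be nonnegative when \<open>I\<close> is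
    empty, hence \<open>\<bar>C\<bar>\<close>.\<close>
  define D where "D = 2 * B * (real (card I) * \<bar>C\<bar>)"
  have D0: "D \<ge> 0" using B0 by (simp add: D_def)
  \<comment> \<open>The choice makes the quadratic error at most \<open>e / 8\<close>; the summand
    \<open>1\<close> keeps \<open>R\<close> positive when \<open>D = 0\<close>.\<close>
  define R where "R = sqrt (8 * (D + 1) / e)"
  have R: "R > 0" "R\<^sup>2 = 8 * (D + 1) / e" using e D0 by (simp_all add: R_def)
  have DR: "D / R\<^sup>2 \<le> e / 8" using e D0 unfolding R(2) by (simp add: field_simps)
  have "e / 8 > 0" using e by simp
  from trig_approximation[OF I R(1) this G B dep] obtain p
    where p: "(\<lambda>y. complex_of_real (p y)) \<in> trig_polys I"
      and pG: "\<And>y. \<bar>G y - p y\<bar> \<le> e / 8 + 2 * B * (\<Sum>i\<in>I. (y i)\<^sup>2) / R\<^sup>2" by blast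
  have bound: "integrable N (\<lambda>\<omega>. p (V \<omega>)) \<and> \<bar>(\<integral>\<omega>. G (V \<omega>) \<partial>N) - (\<integral>\<omega>. p (V \<omega>) \<partial>N)\<bar> \<le> e / 4"
    if N: "prob_space N" and Vm: "\<And>i. (\<lambda>\<omega>. V \<omega> i) \<in> borel_measurable N"
      and V2: "\<And>i. i \<in> I \<Longrightarrow> integrable N (\<lambda>\<omega>. (V \<omega> i)\<^sup>2) \<and> (\<integral>\<omega>. (V \<omega> i)\<^sup>2 \<partial>N) \<le> C" for N :: "'c measure" and V
  proof -
    interpret N: prob_space N by fact
    note [measurable] = measurable_coordinatewise_then_product[OF Vm]
    have V2': "(\<integral>\<omega>. (V \<omega> i)\<^sup>2 \<partial>N) \<le> \<bar>C\<bar>" if "i \<in> I" for i using V2[OF that] by linarith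
    have intp: "integrable N (\<lambda>\<omega>. p (V \<omega>))"
      using integrable_Re[OF N.trig_polys_integrable[OF p Vm]] by simp
    have intG: "integrable N (\<lambda>\<omega>. G (V \<omega>))"
      using B by (intro N.integrable_const_bound[of _ B]) auto
    have intS: "integrable N (\<lambda>\<omega>. e / 8 + 2 * B * (\<Sum>i\<in>I. (V \<omega> i)\<^sup>2) / R\<^sup>2)" using V2 by auto
    have "\<bar>(\<integral>\<omega>. G (V \<omega>) \<partial>N) - (\<integral>\<omega>. p (V \<omega>) \<partial>N)\<bar> = \<bar>\<integral>\<omega>. G (V \<omega>) - p (V \<omega>) \<partial>N\<bar>"
      using intp intG by simp
    also have "\<dots> \<le> (\<integral>\<omega>. \<bar>G (V \<omega>) - p (V \<omega>)\<bar> \<partial>N)" by (rule integral_abs_bound)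
    also have "\<dots> \<le> (\<integral>\<omega>. e / 8 + 2 * B * (\<Sum>i\<in>I. (V \<omega> i)\<^sup>2) / R\<^sup>2 \<partial>N)"
      using intp intG intS pG by (intro integral_mono) auto
    also have "\<dots> = e / 8 + 2 * B * (\<Sum>i\<in>I. \<integral>\<omega>. (V \<omega> i)\<^sup>2 \<partial>N) / R\<^sup>2"
      using V2 N.prob_space by (simp add: Bochner_Integration.integral_sum)
    also have "\<dots> \<le> e / 8 + 2 * B * (\<Sum>i\<in>I. \<bar>C\<bar>) / R\<^sup>2"
      using B0 by (intro add_left_mono divide_right_mono mult_left_mono sum_mono V2') auto
    also have "\<dots> = e / 8 + D / R\<^sup>2" by (simp add: D_def)
    also have "\<dots> \<le> e / 4" by (rule order_trans[OF add_left_mono[OF DR]]) simp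
    finally show ?thesis using intp by blast
  qed
  have bY: "integrable P (\<lambda>\<omega>. p (Y n \<omega>)) \<and> \<bar>(\<integral>\<omega>. G (Y n \<omega>) \<partial>P) - (\<integral>\<omega>. p (Y n \<omega>) \<partial>P)\<bar> \<le> e / 4" for n
    by (rule bound[OF P Ym]) (rule Y2)
  have bZ: "integrable Q (\<lambda>\<omega>. p (Z \<omega>)) \<and> \<bar>(\<integral>\<omega>. G (Z \<omega>) \<partial>Q) - (\<integral>\<omega>. p (Z \<omega>) \<partial>Q)\<bar> \<le> e / 4"
    by (rule bound[OF Q Zm]) (rule Z2)
  have iY: "integrable P (\<lambda>\<omega>. h (Y n \<omega>))" and iZ: "integrable Q (\<lambda>\<omega>. h (Z \<omega>))" if "h \<in> trig_polys I" for h n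
    using that by (auto intro: P.trig_polys_integrable Q.trig_polys_integrable)
  have conv: "(\<lambda>n. \<integral>\<omega>. h (Y n \<omega>) \<partial>P) \<longlonglongrightarrow> (\<integral>\<omega>. h (Z \<omega>) \<partial>Q)" if "h \<in> trig_polys I" for h
    using that
  proof induction
    case (exp b c)
    show ?case using tendsto_mult_left[OF char[of c], of b] by simp
  next
    case (add h k)
    then show ?case
      using tendsto_add[OF add.IH] iY iZ by simp
  qed
  have "(\<lambda>n. \<integral>\<omega>. p (Y n \<omega>) \<partial>P) \<longlonglongrightarrow> (\<integral>\<omega>. p (Z \<omega>) \<partial>Q)"
    using conv[OF p] by (simp add: integral_complex_of_real tendsto_of_real_iff)
  then have "\<forall>\<^sub>F n in sequentially. dist (\<integral>\<omega>. p (Y n \<omega>) \<partial>P) (\<integral>\<omega>. p (Z \<omega>) \<partial>Q) < e / 4"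
    by (rule tendstoD) (use e in simp)
  then obtain n0 where n0: "\<And>n. n \<ge> n0 \<Longrightarrow> \<bar>(\<integral>\<omega>. p (Y n \<omega>) \<partial>P) - (\<integral>\<omega>. p (Z \<omega>) \<partial>Q)\<bar> < e / 4"
    unfolding eventually_sequentially dist_real_def by blast
  show "\<exists>n0. \<forall>n\<ge>n0. norm ((\<integral>\<omega>. G (Y n \<omega>) \<partial>P) - (\<integral>\<omega>. G (Z \<omega>) \<partial>Q)) < e"
  proof (intro exI allI impI)
    fix n assume "n \<ge> n0"
    from n0[OF this] bY[of n] bZ show "norm ((\<integral>\<omega>. G (Y n \<omega>) \<partial>P) - (\<integral>\<omega>. G (Z \<omega>) \<partial>Q)) < e"
      using e by (simp only: real_norm_def) linarith
  qed
qed

section \<open>Gaussian characteristic functions of the Brownian bridge\<close>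

text \<open>The law may be a point mass, which has no density: then the vanishing mean puts it at
  \<open>0\<close> and all claims are trivial. Otherwise the mean read off the density is
  \<open>\<mu> = 0\<close>, and scaling by \<open>\<sigma>\<close> reduces to the standard normal
  law.\<close>

lemma gaussian_rv_centered:
  assumes M: "prob_space M" and X: "gaussian_rv M X" and X0: "(\<integral>\<omega>. X \<omega> \<partial>M) = 0"
  shows "integrable M (\<lambda>\<omega>. (X \<omega>)\<^sup>2)"
    and "(\<integral>\<omega>. iexp (X \<omega>) \<partial>M) = of_real (exp (- (\<integral>\<omega>. (X \<omega>)\<^sup>2 \<partial>M) / 2))"
proof -
  interpret prob_space M by fact
  have [measurable]: "X \<in> borel_measurable M" using X by (simp add: gaussian_rv_def)
  obtain \<mu> \<sigma> where \<sigma>: "0 \<le> \<sigma>" and d: "distr M borel X = normal_measure \<mu> \<sigma>"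
    using X by (auto simp: gaussian_rv_def)
  have "integrable M (\<lambda>\<omega>. (X \<omega>)\<^sup>2) \<and>
    (\<integral>\<omega>. iexp (X \<omega>) \<partial>M) = of_real (exp (- (\<integral>\<omega>. (X \<omega>)\<^sup>2 \<partial>M) / 2))"
  proof (cases "\<sigma> = 0")
    case True
    then have r: "distr M borel X = return borel \<mu>" using d by (simp add: normal_measure_def)
    have "AE x in distr M borel X. x = \<mu>" unfolding r by (subst AE_return) auto
    then have ae: "AE \<omega> in M. X \<omega> = \<mu>" by (subst (asm) AE_distr_iff) auto
    have "(\<integral>\<omega>. X \<omega> \<partial>M) = (\<integral>\<omega>. \<mu> \<partial>M)" by (rule integral_cong_AE) (use ae in auto)
    then have "\<mu> = 0" using X0 prob_space by simp
    with ae have ae: "AE \<omega> in M. X \<omega> = 0" by simp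
    have "integrable M (\<lambda>\<omega>. (X \<omega>)\<^sup>2) \<longleftrightarrow> integrable M (\<lambda>\<omega>. 0::real)"
      by (rule integrable_cong_AE) (use ae in auto)
    moreover have "(\<integral>\<omega>. (X \<omega>)\<^sup>2 \<partial>M) = (\<integral>\<omega>. 0 \<partial>M)" by (rule integral_cong_AE) (use ae in auto)
    moreover have "(\<integral>\<omega>. iexp (X \<omega>) \<partial>M) = (\<integral>\<omega>. 1 \<partial>M)" by (rule integral_cong_AE) (use ae in auto)
    ultimately show ?thesis using prob_space by simp
  next
    case False
    then have s: "\<sigma> > 0" using \<sigma> by simp
    have "distr M lborel X = distr M borel X" by (rule distr_cong) auto
    then have dist: "distributed M lborel X (normal_density \<mu> \<sigma>)"
      using d s by (simp add: distributed_def normal_measure_def)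
    have "(\<integral>\<omega>. X \<omega> \<partial>M) = \<mu>"
      using distributed_integral[OF dist, of "\<lambda>x. x"] s by (simp add: integral_normal_moment_nz_1)
    then have dist: "distributed M lborel X (normal_density 0 \<sigma>)" using dist X0 by simp
    have ev: "has_bochner_integral lborel (\<lambda>x. normal_density 0 \<sigma> x * x\<^sup>2) (\<sigma>\<^sup>2)"
      using normal_moment_even[of \<sigma> 0 1] s by simp
    have i2: "integrable M (\<lambda>\<omega>. (X \<omega>)\<^sup>2)"
      using distributed_integrable[OF dist, of "\<lambda>x. x\<^sup>2"] ev by (auto simp: has_bochner_integral_iff)
    have e2: "(\<integral>\<omega>. (X \<omega>)\<^sup>2 \<partial>M) = \<sigma>\<^sup>2"
      using distributed_integral[OF dist, of "\<lambda>x. x\<^sup>2"] ev by (auto simp: has_bochner_integral_iff)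
    have "distributed M lborel (\<lambda>\<omega>. X \<omega> / \<sigma>) std_normal_density"
      using dist normal_standard_normal_convert[OF s, of X 0] by simp
    then have "distr M lborel (\<lambda>\<omega>. X \<omega> / \<sigma>) = std_normal_distribution" by (simp add: distributed_def)
    moreover have "distr M lborel (\<lambda>\<omega>. X \<omega> / \<sigma>) = distr M borel (\<lambda>\<omega>. X \<omega> / \<sigma>)" by (rule distr_cong) auto
    ultimately have "char (distr M borel (\<lambda>\<omega>. X \<omega> / \<sigma>)) \<sigma> = of_real (exp (- \<sigma>\<^sup>2 / 2))"
      by (simp add: char_std_normal_distribution)
    moreover have "char (distr M borel (\<lambda>\<omega>. X \<omega> / \<sigma>)) \<sigma> = (\<integral>\<omega>. iexp (X \<omega>) \<partial>M)"
      unfolding char_def using s by (subst integral_distr) auto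
    ultimately show ?thesis using i2 e2 by simp
  qed
  then show "integrable M (\<lambda>\<omega>. (X \<omega>)\<^sup>2)"
    and "(\<integral>\<omega>. iexp (X \<omega>) \<partial>M) = of_real (exp (- (\<integral>\<omega>. (X \<omega>)\<^sup>2 \<partial>M) / 2))" by auto
qed

lemma brownian_bridge_gaussian:
  assumes W: "brownian_bridge M W" and s: "s \<in> {0..1}"
  shows "gaussian_rv M (W s)"
proof -
  have "gaussian_rv M (\<lambda>\<omega>. \<Sum>i\<in>{s}. (1::real) * W i \<omega>)"
    using W s unfolding brownian_bridge_def gaussian_process_def
    by (elim conjE allE[of _ "{s}"] allE[of _ "\<lambda>_. 1"]) simp
  then show ?thesis by simp
qed

lemma brownian_bridge_char:
  assumes W: "brownian_bridge M W" and T: "finite T" and F: "\<And>t. t \<in> T \<Longrightarrow> F t \<in> {0..1}"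
  shows "(\<integral>\<omega>. iexp (\<Sum>t\<in>T. c t * W (F t) \<omega>) \<partial>M) =
    of_real (exp (- (\<Sum>s\<in>T. \<Sum>t\<in>T. c s * c t * (min (F s) (F t) - F s * F t)) / 2))"
proof -
  interpret prob_space M using W by (simp add: brownian_bridge_def gaussian_process_def)
  have W0: "expectation (W s) = 0" if "s \<in> {0..1}" for s using W that by (simp add: brownian_bridge_def)
  have Wg: "gaussian_rv M (W s)" if "s \<in> {0..1}" for s using brownian_bridge_gaussian[OF W that] .
  have Wm [measurable]: "W s \<in> borel_measurable M" if "s \<in> {0..1}" for s
    using Wg[OF that] by (simp add: gaussian_rv_def)
  have W2: "integrable M (\<lambda>\<omega>. (W s \<omega>)\<^sup>2)" if "s \<in> {0..1}" for s
    using gaussian_rv_centered(1)[OF prob_space_axioms Wg[OF that] W0[OF that]] .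
  have W1: "integrable M (W s)" if "s \<in> {0..1}" for s
    using square_integrable_imp_integrable[OF Wm[OF that] W2[OF that]] .
  have WW: "integrable M (\<lambda>\<omega>. W s \<omega> * W t \<omega>)" if "s \<in> {0..1}" "t \<in> {0..1}" for s t
  proof (rule Bochner_Integration.integrable_bound)
    show "integrable M (\<lambda>\<omega>. (W s \<omega>)\<^sup>2 + (W t \<omega>)\<^sup>2)" using W2 that by simp
    have "\<bar>x * y\<bar> \<le> x\<^sup>2 + y\<^sup>2" for x y :: real
    proof -
      have "2 * \<bar>x * y\<bar> \<le> x\<^sup>2 + y\<^sup>2"
        using sum_squares_bound[of "\<bar>x\<bar>" "\<bar>y\<bar>"] by (simp add: abs_mult mult.assoc)
      then show ?thesis by linarith
    qed
    then show "AE \<omega> in M. norm (W s \<omega> * W t \<omega>) \<le> norm ((W s \<omega>)\<^sup>2 + (W t \<omega>)\<^sup>2)" by simp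
  qed (use that in measurable)
  define S where "S \<omega> = (\<Sum>t\<in>T. c t * W (F t) \<omega>)" for \<omega>
  have "(\<Sum>t\<in>T. c t * W (F t) \<omega>) = (\<Sum>x\<in>F ` T. (\<Sum>t | t \<in> T \<and> F t = x. c t) * W x \<omega>)" for \<omega>
  proof -
    have "(\<Sum>t\<in>T. c t * W (F t) \<omega>) = (\<Sum>x\<in>F ` T. \<Sum>t | t \<in> T \<and> F t = x. c t * W (F t) \<omega>)"
      by (rule sum.image_gen[OF T])
    also have "\<dots> = (\<Sum>x\<in>F ` T. (\<Sum>t | t \<in> T \<and> F t = x. c t) * W x \<omega>)"
      by (auto simp: sum_distrib_right intro!: sum.cong)
    finally show ?thesis .
  qed
  moreover have "gaussian_rv M (\<lambda>\<omega>. \<Sum>x\<in>F ` T. (\<Sum>t | t \<in> T \<and> F t = x. c t) * W x \<omega>)"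
  proof -
    have "finite (F ` T) \<and> F ` T \<subseteq> {0..1} \<longrightarrow>
        gaussian_rv M (\<lambda>\<omega>. \<Sum>x\<in>F ` T. (\<Sum>t | t \<in> T \<and> F t = x. c t) * W x \<omega>)"
      using W unfolding brownian_bridge_def gaussian_process_def
      by (elim conjE allE[of _ "F ` T"] allE[of _ "\<lambda>x. \<Sum>t | t \<in> T \<and> F t = x. c t"]) assumption
    moreover have "F ` T \<subseteq> {0..1}" using F by (rule image_subsetI)
    ultimately show ?thesis using T by blast
  qed
  ultimately have Sg: "gaussian_rv M S" by (simp add: S_def[abs_def])
  have S0: "expectation S = 0"
    unfolding S_def using W1[OF F] W0[OF F] by (subst Bochner_Integration.integral_sum) auto
  have "expectation (\<lambda>\<omega>. (S \<omega>)\<^sup>2) = expectation (\<lambda>\<omega>. \<Sum>s\<in>T. \<Sum>t\<in>T. c s * c t * (W (F s) \<omega> * W (F t) \<omega>))"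
    by (simp add: S_def power2_eq_square sum_product mult_ac)
  also have "\<dots> = (\<Sum>s\<in>T. \<Sum>t\<in>T. c s * c t * expectation (\<lambda>\<omega>. W (F s) \<omega> * W (F t) \<omega>))"
    using WW[OF F F] by (simp add: Bochner_Integration.integral_sum)
  also have "\<dots> = (\<Sum>s\<in>T. \<Sum>t\<in>T. c s * c t * (min (F s) (F t) - F s * F t))"
    using W F by (intro sum.cong) (auto simp: brownian_bridge_def)
  finally show ?thesis
    using gaussian_rv_centered(2)[OF prob_space_axioms Sg S0] by (simp add: S_def)
qed

section \<open>The weighted empirical process\<close>

context iid_field
begin

definition emp :: "('l \<Rightarrow> real) \<Rightarrow> 'l set \<Rightarrow> 'a \<Rightarrow> real \<Rightarrow> real" where
  "emp a L \<omega> s = wsum a (\<lambda>x. indicator {..s} x - cdf D s) L \<omega>"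

lemma emp_measurable [measurable]: "(\<lambda>\<omega>. emp a L \<omega> s) \<in> borel_measurable M"
  unfolding emp_def by measurable

lemma integral_indicator_D: "A \<in> sets borel \<Longrightarrow> (\<integral>x. indicator A x \<partial>D) = D.prob A"
  and integrable_indicator_D: "A \<in> sets borel \<Longrightarrow> integrable D (indicator A :: real \<Rightarrow> real)"
  by (auto simp: D.emeasure_eq_measure)

lemma cdf_diff: "s \<le> t \<Longrightarrow> D.prob {s<..t} = cdf D t - cdf D s"
  using D.cdf_diff_eq[of s t] by (cases "s = t") auto

lemma emp_diff:
  assumes "s \<le> t"
  shows "emp a L \<omega> t - emp a L \<omega> s = wsum a (\<lambda>x. indicator {s<..t} x - D.prob {s<..t}) L \<omega>"
proof -
  have "indicator {..t} x - indicator {..s} x = (indicator {s<..t} x :: real)" for x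
    using assms by (auto simp: indicator_def)
  then show ?thesis
    unfolding emp_def wsum_def sum_subtractf[symmetric] right_diff_distrib[symmetric] cdf_diff[OF assms]
    by (intro sum.cong) (auto simp: algebra_simps)
qed

lemma centered_indicator:
  fixes A B
  assumes [measurable]: "A \<in> sets borel" "B \<in> sets borel"
  defines "f \<equiv> \<lambda>x. indicator A x - D.prob A" and "g \<equiv> \<lambda>x. indicator B x - D.prob B"
  shows "f \<in> borel_measurable borel" and "\<bar>f x\<bar> \<le> 1" and "integral\<^sup>L D f = 0"
    and "(\<integral>x. (f x)\<^sup>2 \<partial>D) = D.prob A * (1 - D.prob A)"
    and "(\<integral>x. f x * g x \<partial>D) = D.prob (A \<inter> B) - D.prob A * D.prob B"
proof -
  note [simp] = integral_indicator_D integrable_indicator_D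
  have 1: "D.prob A \<le> 1" "D.prob A \<ge> 0" by simp_all
  have DU: "D.prob UNIV = 1" using D.prob_space by simp
  show "f \<in> borel_measurable borel" unfolding f_def by measurable
  show "\<bar>f x\<bar> \<le> 1" using 1 by (auto simp: f_def indicator_def)
  show "integral\<^sup>L D f = 0" unfolding f_def using DU by simp
  show fg: "(\<integral>x. f x * g x \<partial>D) = D.prob (A \<inter> B) - D.prob A * D.prob B"
  proof -
    have "(\<lambda>x. f x * g x) = (\<lambda>x. indicator (A \<inter> B) x - D.prob B * indicator A x - D.prob A * indicator B x + D.prob A * D.prob B)"
      by (auto simp: f_def g_def indicator_def fun_eq_iff algebra_simps)
    then show ?thesis using DU by simp
  qed
  have "(\<lambda>x. (f x)\<^sup>2) = (\<lambda>x. (1 - 2 * D.prob A) * indicator A x + (D.prob A)\<^sup>2)"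
    by (auto simp: f_def indicator_def fun_eq_iff power2_eq_square algebra_simps)
  then show "(\<integral>x. (f x)\<^sup>2 \<partial>D) = D.prob A * (1 - D.prob A)"
    using DU by (simp add: power2_eq_square algebra_simps)
qed

lemma sum_power4_le:
  assumes "finite L" "(\<Sum>l\<in>L. (a l)\<^sup>2) \<le> 1"
  shows "(\<Sum>l\<in>L. a l ^ 4) \<le> (1::real)"
proof -
  have "(\<Sum>l\<in>L. a l ^ 4) \<le> (\<Sum>l\<in>L. (a l)\<^sup>2)"
  proof (rule sum_mono)
    fix l assume "l \<in> L"
    then have "(a l)\<^sup>2 \<le> (\<Sum>l\<in>L. (a l)\<^sup>2)" using assms by (intro member_le_sum) auto
    then have "(a l)\<^sup>2 \<le> 1" using assms by linarith
    then have "(a l)\<^sup>2 * (a l)\<^sup>2 \<le> (a l)\<^sup>2 * 1" by (intro mult_left_mono) auto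
    then show "a l ^ 4 \<le> (a l)\<^sup>2" by (simp add: power4_eq_xxxx power2_eq_square mult.assoc)
  qed
  then show ?thesis using assms by linarith
qed

text \<open>These bounds, uniform in the weights and in \<open>s\<close>, supply the moment
  hypotheses of \<open>fidi_convergence\<close>.\<close>

lemma emp_second_moment:
  assumes L: "finite L" "(\<Sum>l\<in>L. (a l)\<^sup>2) \<le> 1"
  shows "integrable M (\<lambda>\<omega>. (emp a L \<omega> s)\<^sup>2)" and "expectation (\<lambda>\<omega>. (emp a L \<omega> s)\<^sup>2) \<le> 1"
proof -
  define f where "f x = indicator {..s} x - D.prob {..s}" for x
  note c = centered_indicator[of "{..s}" "{..s}", folded f_def, simplified]
  have e: "emp a L \<omega> s = wsum a f L \<omega>" for \<omega> by (simp add: emp_def f_def[abs_def] cdf_def)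
  have "\<bar>(wsum a f L \<omega>)\<^sup>2\<bar> \<le> ((\<Sum>l\<in>L. \<bar>a l\<bar>) * 1)\<^sup>2" for \<omega>
    using power_mono[OF wsum_bound[of f 1 a L \<omega>, OF c(2)], of 2] by simp
  then show "integrable M (\<lambda>\<omega>. (emp a L \<omega> s)\<^sup>2)"
    unfolding e using c(1) by (intro bounded_integrable) measurable
  have "expectation (\<lambda>\<omega>. (emp a L \<omega> s)\<^sup>2) = (\<Sum>l\<in>L. (a l)\<^sup>2) * (D.prob {..s} * (1 - D.prob {..s}))"
    unfolding e using fourth_moment(2)[of f f 1 L a] c L by (simp add: power2_eq_square)
  also have "\<dots> \<le> 1 * (1 * 1)" using L by (intro mult_mono) (auto simp: sum_nonneg)
  finally show "expectation (\<lambda>\<omega>. (emp a L \<omega> s)\<^sup>2) \<le> 1" by simp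
qed

text \<open>Both bounds are Markov inequalities for a product of two squared sums. For disjoint
  intervals of masses \<open>p\<close> and \<open>q\<close> the fourth-moment bound is at most
  \<open>3 * p * q + p * q \<le> (p + q)\<^sup>2\<close>. For a single interval the integral of
  \<open>f ^ 4\<close> is only of order \<open>p\<close>, which leaves the linear term with the
  fourth powers of the weights.\<close>

lemma emp_increments:
  assumes L: "finite L" "(\<Sum>l\<in>L. (a l)\<^sup>2) \<le> 1" and st: "r \<le> s" "s \<le> t" and l: "l > 0"
  shows "prob {\<omega>\<in>space M. l \<le> \<bar>emp a L \<omega> s - emp a L \<omega> r\<bar> \<and> l \<le> \<bar>emp a L \<omega> t - emp a L \<omega> s\<bar>}
      \<le> (cdf D t - cdf D r)\<^sup>2 / l ^ 4"
    and "prob {\<omega>\<in>space M. l \<le> \<bar>emp a L \<omega> s - emp a L \<omega> r\<bar>}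
      \<le> (3 * (cdf D s - cdf D r)\<^sup>2 + (\<Sum>l\<in>L. a l ^ 4) * (cdf D s - cdf D r)) / l ^ 4"
proof -
  define S2 where "S2 = (\<Sum>l\<in>L. (a l)\<^sup>2)"
  define S4 where "S4 = (\<Sum>l\<in>L. a l ^ 4)"
  have S: "0 \<le> S2" "S2 \<le> 1" "0 \<le> S4" "S4 \<le> 1"
    using L sum_power4_le[OF L] by (auto simp: S2_def S4_def sum_nonneg)
  define A where "A = {r<..s}"
  define B where "B = {s<..t}"
  have AB [measurable]: "A \<in> sets borel" "B \<in> sets borel" and dis: "A \<inter> B = {}" by (auto simp: A_def B_def)
  define p where "p = D.prob A"
  define q where "q = D.prob B"
  have p: "p = cdf D s - cdf D r" and q: "q = cdf D t - cdf D s"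
    using st by (simp_all add: p_def q_def A_def B_def cdf_diff)
  have pq0: "0 \<le> p" "0 \<le> q" "p \<le> 1" by (simp_all add: p_def q_def)
  have pq1: "p + q \<le> 1"
    using dis AB by (simp add: p_def q_def D.finite_measure_Union[symmetric])
  define f where "f x = indicator A x - p" for x
  define g where "g x = indicator B x - q" for x
  note cf = centered_indicator[OF AB, folded p_def q_def, folded f_def g_def]
  note cg = centered_indicator[OF AB(2,1), folded p_def q_def, folded f_def g_def]
  have ff: "(\<integral>x. f x * f x \<partial>D) = (\<integral>x. (f x)\<^sup>2 \<partial>D)" by (simp add: power2_eq_square)
  have fA: "emp a L \<omega> s - emp a L \<omega> r = wsum a f L \<omega>" for \<omega>
    using emp_diff[OF st(1), of a L \<omega>] by (simp add: f_def[abs_def] A_def p_def)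
  have gB: "emp a L \<omega> t - emp a L \<omega> s = wsum a g L \<omega>" for \<omega>
    using emp_diff[OF st(2), of a L \<omega>] by (simp add: g_def[abs_def] B_def q_def)
  note [measurable] = cf(1) cg(1)
  have bnd: "\<bar>wsum a h L \<omega>\<bar> \<le> (\<Sum>l\<in>L. \<bar>a l\<bar>)" if "h = f \<or> h = g" for h \<omega>
    using wsum_bound[of h 1 a L \<omega>] that cf(2) cg(2) by auto
  have int: "integrable M (\<lambda>\<omega>. (wsum a f L \<omega>)\<^sup>2 * (wsum a h L \<omega>)\<^sup>2)" if h: "h = f \<or> h = g" for h
  proof -
    have "\<bar>(wsum a f L \<omega>)\<^sup>2 * (wsum a h L \<omega>)\<^sup>2\<bar> \<le> (\<Sum>l\<in>L. \<bar>a l\<bar>)\<^sup>2 * (\<Sum>l\<in>L. \<bar>a l\<bar>)\<^sup>2" for \<omega>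
      unfolding abs_mult power_abs using bnd[of f] bnd[OF h] by (intro mult_mono power_mono) auto
    moreover have [measurable]: "h \<in> borel_measurable borel" using h cf(1) cg(1) by blast
    ultimately show ?thesis by (intro bounded_integrable) measurable
  qed
  have markov: "prob {\<omega>\<in>space M. l ^ 4 \<le> (wsum a f L \<omega>)\<^sup>2 * (wsum a h L \<omega>)\<^sup>2} \<le>
      expectation (\<lambda>\<omega>. (wsum a f L \<omega>)\<^sup>2 * (wsum a h L \<omega>)\<^sup>2) / l ^ 4" if h: "h = f \<or> h = g" for h
    using l by (intro integral_Markov_inequality_measure[of _ _ "{}"] int h) auto
  have sub: "l ^ 4 \<le> x\<^sup>2 * y\<^sup>2" if "l \<le> \<bar>x\<bar>" "l \<le> \<bar>y\<bar>" for x y :: real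
  proof -
    have "l\<^sup>2 * l\<^sup>2 \<le> \<bar>x\<bar>\<^sup>2 * \<bar>y\<bar>\<^sup>2" using that l by (intro mult_mono power_mono) auto
    then show ?thesis by (simp add: power4_eq_xxxx power2_eq_square mult.assoc)
  qed
  show "prob {\<omega>\<in>space M. l \<le> \<bar>emp a L \<omega> s - emp a L \<omega> r\<bar> \<and> l \<le> \<bar>emp a L \<omega> t - emp a L \<omega> s\<bar>}
      \<le> (cdf D t - cdf D r)\<^sup>2 / l ^ 4"
  proof -
    \<comment> \<open>By disjointness the integrand is \<open>(1 - p)\<^sup>2 * q\<^sup>2\<close> on
      \<open>A\<close>, \<open>p\<^sup>2 * (1 - q)\<^sup>2\<close> on \<open>B\<close> and
      \<open>p\<^sup>2 * q\<^sup>2\<close> elsewhere.\<close>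
    have fg2: "(\<integral>x. (f x)\<^sup>2 * (g x)\<^sup>2 \<partial>D) = p * q * (p + q - 3 * (p * q))"
    proof -
      have "(\<lambda>x. (f x)\<^sup>2 * (g x)\<^sup>2) =
          (\<lambda>x. (1 - 2 * p) * q\<^sup>2 * indicator A x + p\<^sup>2 * (1 - 2 * q) * indicator B x + p\<^sup>2 * q\<^sup>2)"
        using dis by (auto simp: f_def g_def indicator_def fun_eq_iff power2_eq_square algebra_simps)
      then show ?thesis
        using D.prob_space
        by (simp add: integral_indicator_D integrable_indicator_D p_def[symmetric] q_def[symmetric] power2_eq_square algebra_simps)
    qed
    have pq: "p * q * (p + q - 3 * (p * q)) \<le> p * q * 1"
      using pq0 pq1 by (intro mult_left_mono) (auto intro: order_trans[of _ "p + q"])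
    \<comment> \<open>The covariance of the disjoint indicators is \<open>- p * q\<close>, and
      \<open>p * q \<le> (1 - p) * (1 - q)\<close> amounts to \<open>p + q \<le> 1\<close>.\<close>
    have "(p * q)\<^sup>2 \<le> p * (1 - p) * (q * (1 - q))"
    proof -
      have "p * q * (p * q) \<le> p * q * ((1 - p) * (1 - q))"
        using pq0 pq1 by (intro mult_left_mono) (auto simp: algebra_simps)
      then show ?thesis by (simp add: power2_eq_square algebra_simps)
    qed
    then have "expectation (\<lambda>\<omega>. (wsum a f L \<omega>)\<^sup>2 * (wsum a g L \<omega>)\<^sup>2) \<le>
        3 * (S2 * (p * (1 - p))) * (S2 * (q * (1 - q))) + S4 * (p * q * (p + q - 3 * (p * q)))"
      using fourth_moment(3)[of f g 1 L a] cf cg L(1) dis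
      by (simp add: S2_def S4_def fg2)
    also have "\<dots> \<le> 3 * (1 * (p * 1)) * (1 * (q * 1)) + 1 * (p * q * 1)"
    proof (intro add_mono)
      show "3 * (S2 * (p * (1 - p))) * (S2 * (q * (1 - q))) \<le> 3 * (1 * (p * 1)) * (1 * (q * 1))"
        using S pq0 pq1 by (intro mult_mono) auto
      have "S4 * (p * q * (p + q - 3 * (p * q))) \<le> S4 * (p * q * 1)" by (rule mult_left_mono[OF pq S(3)])
      also have "\<dots> \<le> 1 * (p * q * 1)" by (rule mult_right_mono[OF S(4)]) (use pq0 in simp)
      finally show "S4 * (p * q * (p + q - 3 * (p * q))) \<le> 1 * (p * q * 1)" .
    qed
    also have "\<dots> \<le> (p + q)\<^sup>2"
      using zero_le_power2[of "p - q"] by (simp add: power2_eq_square algebra_simps)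
    finally have E: "expectation (\<lambda>\<omega>. (wsum a f L \<omega>)\<^sup>2 * (wsum a g L \<omega>)\<^sup>2) \<le> (p + q)\<^sup>2" .
    have "prob {\<omega>\<in>space M. l \<le> \<bar>wsum a f L \<omega>\<bar> \<and> l \<le> \<bar>wsum a g L \<omega>\<bar>} \<le>
        prob {\<omega>\<in>space M. l ^ 4 \<le> (wsum a f L \<omega>)\<^sup>2 * (wsum a g L \<omega>)\<^sup>2}"
      by (intro finite_measure_mono; (blast intro: sub | measurable))
    also have "\<dots> \<le> (p + q)\<^sup>2 / l ^ 4"
      using order_trans[OF markov[of g] divide_right_mono[OF E, of "l ^ 4"]] l by simp
    finally show ?thesis unfolding fA gB by (simp add: p q)
  qed
  show "prob {\<omega>\<in>space M. l \<le> \<bar>emp a L \<omega> s - emp a L \<omega> r\<bar>}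
      \<le> (3 * (cdf D s - cdf D r)\<^sup>2 + (\<Sum>l\<in>L. a l ^ 4) * (cdf D s - cdf D r)) / l ^ 4"
  proof -
    have f2: "(\<integral>x. (f x)\<^sup>2 \<partial>D) \<le> p" unfolding cf(4) using pq0 by (intro mult_left_le) auto
    have f20: "0 \<le> (\<integral>x. (f x)\<^sup>2 \<partial>D)" by simp
    have f1: "(f x)\<^sup>2 \<le> 1" for x using power_mono[OF cf(2)[of x], of 2] by simp
    have "(\<integral>x. (f x)\<^sup>2 * (f x)\<^sup>2 \<partial>D) \<le> (\<integral>x. (f x)\<^sup>2 \<partial>D)"
    proof (rule integral_mono)
      have b: "(f x)\<^sup>2 * (f x)\<^sup>2 \<le> (f x)\<^sup>2" for x using mult_left_mono[OF f1[of x], of "(f x)\<^sup>2"] by simp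
      show "(f x)\<^sup>2 * (f x)\<^sup>2 \<le> (f x)\<^sup>2" for x by (rule b)
      show "integrable D (\<lambda>x. (f x)\<^sup>2)" by (rule bounded_integrable_D[of _ 1]) (use f1 in auto)
      show "integrable D (\<lambda>x. (f x)\<^sup>2 * (f x)\<^sup>2)"
        by (rule bounded_integrable_D[of _ 1]) (use order_trans[OF b f1] in \<open>auto simp: abs_mult\<close>)
    qed
    then have f4: "(\<integral>x. (f x)\<^sup>2 * (f x)\<^sup>2 \<partial>D) \<le> p" using f2 by linarith
    have "expectation (\<lambda>\<omega>. (wsum a f L \<omega>)\<^sup>2 * (wsum a f L \<omega>)\<^sup>2) \<le>
        3 * (S2 * (\<integral>x. (f x)\<^sup>2 \<partial>D)) * (S2 * (\<integral>x. (f x)\<^sup>2 \<partial>D)) + S4 * (\<integral>x. (f x)\<^sup>2 * (f x)\<^sup>2 \<partial>D)"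
      using fourth_moment(3)[of f f 1 L a] cf(1-3) L(1)
      unfolding ff S2_def S4_def by (simp add: power2_eq_square[of "integral\<^sup>L D _"])
    also have "\<dots> \<le> 3 * (1 * p) * (1 * p) + S4 * p"
      using S f2 f4 f20 pq0 by (intro add_mono mult_mono) auto
    finally have E: "expectation (\<lambda>\<omega>. (wsum a f L \<omega>)\<^sup>2 * (wsum a f L \<omega>)\<^sup>2) \<le> 3 * p\<^sup>2 + S4 * p"
      by (simp add: power2_eq_square)
    have "prob {\<omega>\<in>space M. l \<le> \<bar>wsum a f L \<omega>\<bar>} \<le>
        prob {\<omega>\<in>space M. l ^ 4 \<le> (wsum a f L \<omega>)\<^sup>2 * (wsum a f L \<omega>)\<^sup>2}"
      by (intro finite_measure_mono; (blast intro: sub | measurable))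
    also have "\<dots> \<le> (3 * p\<^sup>2 + S4 * p) / l ^ 4"
      using order_trans[OF markov[of f] divide_right_mono[OF E, of "l ^ 4"]] l by simp
    finally show ?thesis unfolding fA by (simp add: p S4_def)
  qed
qed

text \<open>If \<open>S j\<close> is \<open>2 * l\<close> away from \<open>S 0\<close>, then either
  \<open>S N\<close> is \<open>l\<close> away from \<open>S 0\<close>, or \<open>S j\<close> is
  \<open>l\<close> away from both ends. The first event is a single increment, the second falls
  under \<open>maximal_inequality\<close>; the constant is \<open>100000 + 3\<close>.\<close>

lemma emp_block:
  fixes g :: "nat \<Rightarrow> real"
  assumes L: "finite L" "(\<Sum>l\<in>L. (a l)\<^sup>2) \<le> 1" and g: "mono g" and l: "l > 0"
  shows "prob {\<omega>\<in>space M. \<exists>j\<le>N. 2 * l \<le> \<bar>emp a L \<omega> (g j) - emp a L \<omega> (g 0)\<bar>} \<le>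
    (100003 * (cdf D (g N) - cdf D (g 0))\<^sup>2 + (\<Sum>l\<in>L. a l ^ 4) * (cdf D (g N) - cdf D (g 0))) / l ^ 4"
proof -
  define S where "S j \<omega> = emp a L \<omega> (g j)" for j \<omega>
  have [measurable]: "S j \<in> borel_measurable M" for j unfolding S_def by measurable
  have m: "mono (\<lambda>j. cdf D (g j))" using g by (auto simp: mono_def intro: D.cdf_nondecreasing)
  have "prob {\<omega>\<in>space M. \<exists>j\<in>{0..N}. l \<le> \<bar>S j \<omega> - S 0 \<omega>\<bar> \<and> l \<le> \<bar>S N \<omega> - S j \<omega>\<bar>} \<le>
      100000 * (cdf D (g N) - cdf D (g 0))\<^sup>2 / l ^ 4"
  proof (rule maximal_inequality[where \<mu>="\<lambda>j. cdf D (g j)" and N=N])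
    fix i j k :: nat and r :: real assume "i \<le> j" "j \<le> k" "k \<le> N" "r > 0"
    then show "prob {\<omega>\<in>space M. r \<le> \<bar>S j \<omega> - S i \<omega>\<bar> \<and> r \<le> \<bar>S k \<omega> - S j \<omega>\<bar>} \<le> (cdf D (g k) - cdf D (g i))\<^sup>2 / r ^ 4"
      unfolding S_def by (intro emp_increments(1) L monoD[OF g])
  qed (use m l in auto)
  moreover have "prob {\<omega>\<in>space M. l \<le> \<bar>S N \<omega> - S 0 \<omega>\<bar>} \<le>
      (3 * (cdf D (g N) - cdf D (g 0))\<^sup>2 + (\<Sum>l\<in>L. a l ^ 4) * (cdf D (g N) - cdf D (g 0))) / l ^ 4"
    unfolding S_def by (intro emp_increments(2)[where t="g N"] L monoD[OF g] l) auto
  moreover have "prob {\<omega>\<in>space M. \<exists>j\<le>N. 2 * l \<le> \<bar>S j \<omega> - S 0 \<omega>\<bar>} \<le>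
      prob ({\<omega>\<in>space M. \<exists>j\<in>{0..N}. l \<le> \<bar>S j \<omega> - S 0 \<omega>\<bar> \<and> l \<le> \<bar>S N \<omega> - S j \<omega>\<bar>} \<union> {\<omega>\<in>space M. l \<le> \<bar>S N \<omega> - S 0 \<omega>\<bar>})"
  proof (rule finite_measure_mono)
    show "{\<omega>\<in>space M. \<exists>j\<le>N. 2 * l \<le> \<bar>S j \<omega> - S 0 \<omega>\<bar>} \<subseteq>
      {\<omega>\<in>space M. \<exists>j\<in>{0..N}. l \<le> \<bar>S j \<omega> - S 0 \<omega>\<bar> \<and> l \<le> \<bar>S N \<omega> - S j \<omega>\<bar>} \<union> {\<omega>\<in>space M. l \<le> \<bar>S N \<omega> - S 0 \<omega>\<bar>}"
    proof
      fix \<omega> assume "\<omega> \<in> {\<omega>\<in>space M. \<exists>j\<le>N. 2 * l \<le> \<bar>S j \<omega> - S 0 \<omega>\<bar>}"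
      then obtain j where w: "\<omega> \<in> space M" and j: "j \<le> N" "2 * l \<le> \<bar>S j \<omega> - S 0 \<omega>\<bar>" by auto
      have "l \<le> \<bar>S N \<omega> - S 0 \<omega>\<bar> \<or> l \<le> \<bar>S j \<omega> - S 0 \<omega>\<bar> \<and> l \<le> \<bar>S N \<omega> - S j \<omega>\<bar>" using j(2) l by linarith
      then show "\<omega> \<in> {\<omega>\<in>space M. \<exists>j\<in>{0..N}. l \<le> \<bar>S j \<omega> - S 0 \<omega>\<bar> \<and> l \<le> \<bar>S N \<omega> - S j \<omega>\<bar>} \<union> {\<omega>\<in>space M. l \<le> \<bar>S N \<omega> - S 0 \<omega>\<bar>}"
        using w j(1) by auto
    qed
  qed measurable
  moreover have "\<dots> \<le> prob {\<omega>\<in>space M. \<exists>j\<in>{0..N}. l \<le> \<bar>S j \<omega> - S 0 \<omega>\<bar> \<and> l \<le> \<bar>S N \<omega> - S j \<omega>\<bar>} + prob {\<omega>\<in>space M. l \<le> \<bar>S N \<omega> - S 0 \<omega>\<bar>}"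
    by (intro measure_Un_le) measurable
  ultimately show ?thesis
    unfolding S_def by (simp add: add_divide_distrib)
qed

end

section \<open>Path regularity and oscillation over the cells of a partition\<close>

lemma cadlagI:
  assumes "\<And>s. (f \<longlongrightarrow> f s) (at_right s)" "\<And>s. \<exists>l. (f \<longlongrightarrow> l) (at_left s)"
  shows "(\<lambda>s\<in>{0..1}. f s) \<in> cadlag"
  unfolding cadlag_def
proof (intro CollectI conjI ballI)
  fix s :: real assume s: "s \<in> {0..<1}"
  have "\<forall>\<^sub>F u in at_right s. f u = (\<lambda>s\<in>{0..1}. f s) u"
    unfolding eventually_at_right_field using s by (intro exI[of _ 1]) auto
  moreover have "(\<lambda>s\<in>{0..1}. f s) s = f s" using s by simp
  ultimately show "((\<lambda>s\<in>{0..1}. f s) \<longlongrightarrow> (\<lambda>s\<in>{0..1}. f s) s) (at_right s)"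
    using Lim_transform_eventually[OF assms(1)] by metis
next
  fix s :: real assume s: "s \<in> {0<..1}"
  have "\<forall>\<^sub>F u in at_left s. f u = (\<lambda>s\<in>{0..1}. f s) u"
    unfolding eventually_at_left_field using s by (intro exI[of _ 0]) auto
  then show "\<exists>l. ((\<lambda>s\<in>{0..1}. f s) \<longlongrightarrow> l) (at_left s)"
    using assms(2)[of s] Lim_transform_eventually by blast
qed simp

lemma indicator_atMost_tendsto:
  fixes x s :: real
  shows "((\<lambda>u. indicator {..u} x :: real) \<longlongrightarrow> indicator {..s} x) (at_right s)"
    and "((\<lambda>u. indicator {..u} x :: real) \<longlongrightarrow> indicator {..<s} x) (at_left s)"
proof -
  have "\<forall>\<^sub>F u in at_right s. indicator {..u} x = (indicator {..s} x :: real)"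
    unfolding eventually_at_right_field
    by (intro exI[of _ "if x \<le> s then s + 1 else x"]) (auto simp: indicator_def)
  then show "((\<lambda>u. indicator {..u} x :: real) \<longlongrightarrow> indicator {..s} x) (at_right s)"
    by (rule tendsto_eventually)
  have "\<forall>\<^sub>F u in at_left s. indicator {..u} x = (indicator {..<s} x :: real)"
    unfolding eventually_at_left_field
    by (intro exI[of _ "if x < s then x else s - 1"]) (auto simp: indicator_def)
  then show "((\<lambda>u. indicator {..u} x :: real) \<longlongrightarrow> indicator {..<s} x) (at_left s)"
    by (rule tendsto_eventually)
qed

context iid_field
begin

lemma cdf_at_right: "(cdf D \<longlongrightarrow> cdf D s) (at_right s)"
  using D.cdf_is_right_cont[of s] by (simp add: continuous_within)

lemma emp_cadlag: "(\<lambda>s\<in>{0..1}. emp a L \<omega> s) \<in> cadlag"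
proof (rule cadlagI)
  fix s
  show "(emp a L \<omega> \<longlongrightarrow> emp a L \<omega> s) (at_right s)"
    unfolding emp_def[abs_def] wsum_def
    by (intro tendsto_intros indicator_atMost_tendsto cdf_at_right)
  have "(emp a L \<omega> \<longlongrightarrow> (\<Sum>l\<in>L. a l * (indicator {..<s} (X l \<omega>) - D.prob {..<s}))) (at_left s)"
    unfolding emp_def[abs_def] wsum_def
    by (intro tendsto_intros indicator_atMost_tendsto D.cdf_at_left)
  then show "\<exists>l. (emp a L \<omega> \<longlongrightarrow> l) (at_left s)" by blast
qed

lemma cdf_cadlag: "(\<lambda>s\<in>{0..1}. cdf D s) \<in> cadlag"
  by (rule cadlagI) (use cdf_at_right D.cdf_at_left in blast)+

text \<open>The left limit at \<open>s\<close> is the value of \<open>w\<close> at the mass of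
  \<open>{..<s}\<close>, so the path can jump only at atoms of \<open>D\<close>.\<close>

lemma continuous_cdf_cadlag:
  assumes "continuous_on {0..1} w"
  shows "(\<lambda>s\<in>{0..1}. w (cdf D s)) \<in> cadlag"
proof (rule cadlagI)
  fix s
  have "\<forall>\<^sub>F u in F. cdf D u \<in> {0..1}" for F
    by (simp add: D.cdf_nonneg D.cdf_bounded_prob)
  note * = continuous_on_tendsto_compose[OF assms _ _ this]
  show "((\<lambda>s. w (cdf D s)) \<longlongrightarrow> w (cdf D s)) (at_right s)"
    by (rule *[OF cdf_at_right]) (simp add: D.cdf_nonneg D.cdf_bounded_prob)
  have "((\<lambda>s. w (cdf D s)) \<longlongrightarrow> w (D.prob {..<s})) (at_left s)"
    by (rule *[OF D.cdf_at_left]) simp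
  then show "\<exists>l. ((\<lambda>s. w (cdf D s)) \<longlongrightarrow> l) (at_left s)" by blast
qed

text \<open>
  A block of mass \<open>p\<close> contributes a multiple of \<open>p\<^sup>2 \<le> \<delta> * p\<close>, and the masses of the blocks sum to at most \<open>1\<close>.
\<close>

lemma emp_oscillation:
  assumes L: "finite L" "(\<Sum>l\<in>L. (a l)\<^sup>2) \<le> 1" and T: "partition01 T" and G: "partition01 G" "T \<subseteq> G"
    and \<delta>: "\<And>u. u \<in> {0..1} \<Longrightarrow> cdf D u - cdf D (cell T u) \<le> \<delta>" and l: "l > 0"
  shows "prob {\<omega>\<in>space M. \<exists>u\<in>G. 2 * l \<le> \<bar>emp a L \<omega> u - emp a L \<omega> (cell T u)\<bar>} \<le>
    (100003 * \<delta> + (\<Sum>l\<in>L. a l ^ 4)) / l ^ 4"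
proof -
  define S4 where "S4 = (\<Sum>l\<in>L. a l ^ 4)"
  have S4: "0 \<le> S4" by (simp add: S4_def sum_nonneg)
  have finT: "finite T" and finG: "finite G" and G01: "G \<subseteq> {0..1}" using T G by (auto simp: partition01_def)
  have \<delta>0: "0 \<le> \<delta>" using \<delta>[of 0] D.cdf_nondecreasing[OF cell_le[OF T, of 0]] by simp
  define B where "B t = {u \<in> G. cell T u = t}" for t
  define m where "m t = Max (B t)" for t
  define p where "p t = cdf D (m t) - cdf D t" for t
  define E where "E t = {\<omega>\<in>space M. \<exists>u\<in>B t. 2 * l \<le> \<bar>emp a L \<omega> u - emp a L \<omega> t\<bar>}" for t
  have finB: "finite (B t)" for t using finG by (simp add: B_def)
  have [measurable]: "E t \<in> sets M" for t unfolding E_def using finB[of t] by measurable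
  have tB: "t \<in> B t" if "t \<in> T" for t using that G(2) cell_self[OF T that] by (auto simp: B_def)
  have Bt: "t \<le> u" if "u \<in> B t" for t u using that cell_le[OF T, of u] G01 by (auto simp: B_def)
  have mB: "m t \<in> B t" if "t \<in> T" for t unfolding m_def using finB tB[OF that] by (intro Max_in) auto
  have tm: "t \<le> m t" if "t \<in> T" for t using Bt[OF mB[OF that]] .
  have p0: "0 \<le> p t" if "t \<in> T" for t using D.cdf_nondecreasing[OF tm[OF that]] by (simp add: p_def)
  have p\<delta>: "p t \<le> \<delta>" if "t \<in> T" for t
    using mB[OF that] \<delta>[of "m t"] G01 by (auto simp: p_def B_def)
  have Et: "prob (E t) \<le> (100003 * \<delta> + S4) * p t / l ^ 4" if t: "t \<in> T" for t
  proof -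
    define xs where "xs = sorted_list_of_set (B t)"
    define N where "N = length xs - 1"
    \<comment> \<open>The sorted list is extended constantly beyond its last index, so that
      \<open>g\<close> is monotone on all of \<open>nat\<close>, as \<open>emp_block\<close>
      requires.\<close>
    define g where "g j = xs ! min j N" for j
    have xs: "set xs = B t" "sorted xs" "xs \<noteq> []" using finB[of t] tB[OF t] by (auto simp: xs_def)
    have len: "min j N < length xs" for j using xs(3) by (cases xs) (auto simp: N_def)
    have gB: "g j \<in> B t" for j using len[of j] nth_mem xs(1) by (auto simp: g_def)
    have mono: "mono g"
    proof (rule monoI)
      fix i j :: nat assume "i \<le> j"
      then show "g i \<le> g j" unfolding g_def by (intro sorted_nth_mono[OF xs(2)] len) auto
    qed
    have ex: "\<exists>j\<le>N. g j = u" if "u \<in> B t" for u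
    proof -
      have "u \<in> set xs" using \<open>u \<in> B t\<close> xs(1) by simp
      then obtain j where "j < length xs" "xs ! j = u" by (auto simp: in_set_conv_nth)
      then show ?thesis by (intro exI[of _ j]) (auto simp: g_def N_def min_def)
    qed
    obtain j0 where "g j0 = t" using ex[OF tB[OF t]] by auto
    then have g0: "g 0 = t" using Bt[OF gB[of 0]] monoD[OF mono, of 0 j0] by simp
    have gN: "g N \<le> m t" unfolding m_def using finB gB by (intro Max_ge)
    have "E t \<subseteq> {\<omega>\<in>space M. \<exists>j\<le>N. 2 * l \<le> \<bar>emp a L \<omega> (g j) - emp a L \<omega> (g 0)\<bar>}"
      unfolding E_def g0 using ex by blast
    then have "prob (E t) \<le> prob {\<omega>\<in>space M. \<exists>j\<le>N. 2 * l \<le> \<bar>emp a L \<omega> (g j) - emp a L \<omega> (g 0)\<bar>}"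
      by (intro finite_measure_mono) measurable
    also have "\<dots> \<le> (100003 * (cdf D (g N) - cdf D (g 0))\<^sup>2 + S4 * (cdf D (g N) - cdf D (g 0))) / l ^ 4"
      unfolding S4_def by (rule emp_block[OF L mono l])
    also have "\<dots> \<le> (100003 * (p t)\<^sup>2 + S4 * p t) / l ^ 4"
    proof -
      have "cdf D (g N) - cdf D (g 0) \<le> p t" "0 \<le> cdf D (g N) - cdf D (g 0)"
        using D.cdf_nondecreasing[OF gN] D.cdf_nondecreasing[OF Bt[OF gB[of N]]] by (simp_all add: p_def g0)
      then show ?thesis
        using S4 l by (intro divide_right_mono add_mono mult_left_mono power_mono) auto
    qed
    also have "\<dots> \<le> (100003 * (\<delta> * p t) + S4 * p t) / l ^ 4"
      using p0[OF t] p\<delta>[OF t] l unfolding power2_eq_square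
      by (intro divide_right_mono add_mono mult_left_mono mult_right_mono) auto
    finally show ?thesis by (simp add: algebra_simps)
  qed
  have psum: "(\<Sum>t\<in>T. p t) \<le> 1"
  proof -
    \<comment> \<open>The last grid point \<open>m t\<close> of a cell precedes the next point of
      \<open>T\<close>. Being open on the left, these intervals also avoid any atom sitting at a
      point of \<open>T\<close>.\<close>
    have dis: "disjoint_family_on (\<lambda>t. {t<..m t}) T"
    proof -
      have False if tt: "t \<in> T" "t' \<in> T" "t < t'" "x \<in> {t<..m t}" "x \<in> {t'<..m t'}" for t t' x
      proof -
        have "m t \<in> {0..1}" "cell T (m t) = t" using mB[OF tt(1)] G01 by (auto simp: B_def)
        then show False using cell_ge[OF T, of "m t" t'] tt by auto
      qed
      then show ?thesis unfolding disjoint_family_on_def by (metis disjoint_iff linorder_neqE)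
    qed
    have "(\<Sum>t\<in>T. p t) = (\<Sum>t\<in>T. D.prob {t<..m t})"
      by (intro sum.cong refl) (simp add: p_def cdf_diff tm)
    also have "\<dots> = D.prob (\<Union>t\<in>T. {t<..m t})"
      by (intro D.finite_measure_finite_Union[symmetric] finT dis) auto
    also have "\<dots> \<le> 1" by simp
    finally show ?thesis .
  qed
  have "{\<omega>\<in>space M. \<exists>u\<in>G. 2 * l \<le> \<bar>emp a L \<omega> u - emp a L \<omega> (cell T u)\<bar>} \<subseteq> (\<Union>t\<in>T. E t)"
    using cell_in[OF T] G01 by (fastforce simp: E_def B_def)
  then have "prob {\<omega>\<in>space M. \<exists>u\<in>G. 2 * l \<le> \<bar>emp a L \<omega> u - emp a L \<omega> (cell T u)\<bar>} \<le> prob (\<Union>t\<in>T. E t)"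
    using finT by (intro finite_measure_mono) auto
  also have "\<dots> \<le> (\<Sum>t\<in>T. prob (E t))"
    using finT by (intro finite_measure_subadditive_finite) auto
  also have "\<dots> \<le> (\<Sum>t\<in>T. (100003 * \<delta> + S4) * p t / l ^ 4)" by (intro sum_mono Et)
  also have "\<dots> = ((100003 * \<delta> + S4) / l ^ 4) * (\<Sum>t\<in>T. p t)" by (simp add: sum_distrib_left)
  also have "\<dots> \<le> ((100003 * \<delta> + S4) / l ^ 4) * 1"
    using psum \<delta>0 S4 l by (intro mult_left_mono) auto
  finally show ?thesis by (simp add: S4_def)
qed

text \<open>
  The supremum over all times is never considered: \<open>Y\<close> is first replaced by its step function on a
  fine grid, and the grid is refined with the other parameters fixed.
\<close>

lemma emp_step_approximation:
  assumes L: "finite L" "(\<Sum>l\<in>L. (a l)\<^sup>2) \<le> 1" and T: "partition01 T"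
    and \<delta>: "\<And>u. u \<in> {0..1} \<Longrightarrow> cdf D u - cdf D (cell T u) \<le> \<delta>" and l: "l > 0"
    and lip: "\<And>x y. x \<in> cadlag \<Longrightarrow> y \<in> cadlag \<Longrightarrow> \<bar>h x - h y\<bar> \<le> K * skorokhod_dist x y" and K: "K \<ge> 0"
    and B: "\<And>x. x \<in> cadlag \<Longrightarrow> \<bar>h x\<bar> \<le> B"
  shows "\<bar>expectation (\<lambda>\<omega>. h (step_of T (emp a L \<omega>))) - expectation (\<lambda>\<omega>. h (\<lambda>s\<in>{0..1}. emp a L \<omega> s))\<bar> \<le>
    K * (2 * l) + 2 * B * ((100003 * \<delta> + (\<Sum>l\<in>L. a l ^ 4)) / l ^ 4)"
proof -
  interpret S: Metric_space cadlag skorokhod_dist by (rule Metric_space_skorokhod)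
  note hc = S.Lipschitz_imp_continuous_map[of h K, folded skorokhod_topology_def, OF lip]
  have B0: "0 \<le> B" using B[OF emp_cadlag] by (meson abs_ge_zero order_trans)
  define Y where "Y \<omega> = (\<lambda>s\<in>{0..1}. emp a L \<omega> s)" for \<omega>
  have Yc: "Y \<omega> \<in> cadlag" for \<omega> unfolding Y_def by (rule emp_cadlag)
  have sY: "step_of G (Y \<omega>) = step_of G (emp a L \<omega>)" if "partition01 G" for G \<omega>
    using cell_01[OF that] by (auto simp: step_of_def Y_def fun_eq_iff)
  have stm [measurable]: "(\<lambda>\<omega>. h (step_of G (emp a L \<omega>))) \<in> borel_measurable M" if "partition01 G" for G
    by (intro borel_of_continuous_map_compose[OF measurable_step_of[OF that] hc]) measurable
  have Ym [measurable]: "(\<lambda>\<omega>. h (Y \<omega>)) \<in> borel_measurable M"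
    by (intro borel_of_continuous_map_compose[OF measurable_cadlag_process hc] Yc) (simp add: Y_def)
  have int: "integrable M (\<lambda>\<omega>. h (step_of G (emp a L \<omega>)))" if "partition01 G" for G
    by (rule bounded_integrable[OF stm[OF that] B[OF step_of_cadlag[OF that]]])
  have "\<bar>expectation (\<lambda>\<omega>. h (step_of T (emp a L \<omega>))) - expectation (\<lambda>\<omega>. h (step_of (refine T k) (emp a L \<omega>)))\<bar> \<le>
      K * (2 * l) + 2 * B * ((100003 * \<delta> + (\<Sum>l\<in>L. a l ^ 4)) / l ^ 4)" for k
  proof -
    define G where "G = refine T k"
    have G: "partition01 G" "T \<subseteq> G" using partition01_refine[OF T] by (auto simp: G_def refine_def)
    have finG: "finite G" using G by (simp add: partition01_def)
    define E where "E = {\<omega>\<in>space M. \<exists>u\<in>G. 2 * l \<le> \<bar>emp a L \<omega> u - emp a L \<omega> (cell T u)\<bar>}"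
    have [measurable]: "E \<in> sets M" unfolding E_def using finG by measurable
    have pw: "\<bar>h (step_of T (emp a L \<omega>)) - h (step_of G (emp a L \<omega>))\<bar> \<le> K * (2 * l) + 2 * B * indicator E \<omega>"
      if w: "\<omega> \<in> space M" for \<omega>
    proof (cases "\<omega> \<in> E")
      case True
      have "\<bar>h (step_of T (emp a L \<omega>)) - h (step_of G (emp a L \<omega>))\<bar> \<le> 2 * B"
        using B[OF step_of_cadlag[OF T, of "emp a L \<omega>"]] B[OF step_of_cadlag[OF G(1), of "emp a L \<omega>"]] by linarith
      moreover have "0 \<le> K * (2 * l)" using K l by simp
      ultimately show ?thesis using True by simp
    next
      case False
      have "skorokhod_dist (step_of T (emp a L \<omega>)) (step_of G (emp a L \<omega>)) \<le> 2 * l"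
      proof (rule skorokhod_dist_le_uniform)
        fix s :: real assume s: "s \<in> {0..1}"
        \<comment> \<open>As \<open>T \<subseteq> G\<close>, the cell of \<open>s\<close> in
          \<open>T\<close> is that of the grid point \<open>cell G s\<close>; comparing the two step
          functions at any time thus reduces to finitely many grid points.\<close>
        then have "\<bar>emp a L \<omega> (cell G s) - emp a L \<omega> (cell T (cell G s))\<bar> < 2 * l"
          using False w cell_in[OF G(1), of s] by (auto simp: E_def not_le)
        then show "\<bar>step_of T (emp a L \<omega>) s - step_of G (emp a L \<omega>) s\<bar> \<le> 2 * l"
          using s cell_cell[OF T G, of s] by (simp add: step_of_def abs_minus_commute)
      qed
      then have "K * skorokhod_dist (step_of T (emp a L \<omega>)) (step_of G (emp a L \<omega>)) \<le> K * (2 * l)"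
        using K by (intro mult_left_mono)
      then show ?thesis
        using lip[OF step_of_cadlag[OF T] step_of_cadlag[OF G(1)], of "emp a L \<omega>" "emp a L \<omega>"] False by simp
    qed
    have "\<bar>expectation (\<lambda>\<omega>. h (step_of T (emp a L \<omega>))) - expectation (\<lambda>\<omega>. h (step_of G (emp a L \<omega>)))\<bar> =
        \<bar>expectation (\<lambda>\<omega>. h (step_of T (emp a L \<omega>)) - h (step_of G (emp a L \<omega>)))\<bar>"
      using int[OF T] int[OF G(1)] by simp
    also have "\<dots> \<le> expectation (\<lambda>\<omega>. \<bar>h (step_of T (emp a L \<omega>)) - h (step_of G (emp a L \<omega>))\<bar>)"
      by (rule integral_abs_bound)
    also have "\<dots> \<le> expectation (\<lambda>\<omega>. K * (2 * l) + 2 * B * indicator E \<omega>)"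
    proof (rule integral_mono)
      show "integrable M (\<lambda>\<omega>. \<bar>h (step_of T (emp a L \<omega>)) - h (step_of G (emp a L \<omega>))\<bar>)"
        using int[OF T] int[OF G(1)] by simp
      show "integrable M (\<lambda>\<omega>. K * (2 * l) + 2 * B * indicator E \<omega>)"
        by (simp add: emeasure_eq_measure)
    qed (rule pw)
    also have "\<dots> = K * (2 * l) + 2 * B * prob E"
      using prob_space by (simp add: emeasure_eq_measure)
    also have "\<dots> \<le> K * (2 * l) + 2 * B * ((100003 * \<delta> + (\<Sum>l\<in>L. a l ^ 4)) / l ^ 4)"
      unfolding E_def using B0 by (intro add_left_mono mult_left_mono emp_oscillation[OF L T G \<delta> l]) auto
    finally show ?thesis by (simp add: G_def)
  qed
  \<comment> \<open>The estimate just proved has a right-hand side independent of \<open>k\<close>,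
    so it survives this limit.\<close>
  moreover have "(\<lambda>k. expectation (\<lambda>\<omega>. h (step_of (refine T k) (emp a L \<omega>)))) \<longlonglongrightarrow> expectation (\<lambda>\<omega>. h (Y \<omega>))"
  proof (rule integral_dominated_convergence[where w="\<lambda>_. B"])
    show "AE \<omega> in M. (\<lambda>k. h (step_of (refine T k) (emp a L \<omega>))) \<longlonglongrightarrow> h (Y \<omega>)"
    proof (rule AE_I2)
      fix \<omega>
      have "(\<lambda>k. K * skorokhod_dist (step_of (refine T k) (Y \<omega>)) (Y \<omega>)) \<longlonglongrightarrow> K * 0"
        by (intro tendsto_mult_left skorokhod_refine_limit Yc T)
      then have "(\<lambda>k. K * skorokhod_dist (step_of (refine T k) (Y \<omega>)) (Y \<omega>)) \<longlonglongrightarrow> 0" by simp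
      then have "(\<lambda>k. h (step_of (refine T k) (Y \<omega>)) - h (Y \<omega>)) \<longlonglongrightarrow> 0"
        by (rule Lim_null_comparison[rotated])
          (auto intro!: always_eventually lip step_of_cadlag partition01_refine T Yc)
      then show "(\<lambda>k. h (step_of (refine T k) (emp a L \<omega>))) \<longlonglongrightarrow> h (Y \<omega>)"
        unfolding sY[OF partition01_refine[OF T]] by (simp add: LIM_zero_iff)
    qed
    show "AE \<omega> in M. norm (h (step_of (refine T k) (emp a L \<omega>))) \<le> B" for k
      using B step_of_cadlag[OF partition01_refine[OF T]] by (intro AE_I2) simp
  qed (use stm[OF partition01_refine[OF T]] in auto)
  then have "(\<lambda>k. \<bar>expectation (\<lambda>\<omega>. h (step_of T (emp a L \<omega>))) - expectation (\<lambda>\<omega>. h (step_of (refine T k) (emp a L \<omega>)))\<bar>)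
      \<longlonglongrightarrow> \<bar>expectation (\<lambda>\<omega>. h (step_of T (emp a L \<omega>))) - expectation (\<lambda>\<omega>. h (Y \<omega>))\<bar>"
    by (intro tendsto_intros)
  ultimately show ?thesis unfolding Y_def[symmetric] by (intro tendsto_upperbound[of _ _ sequentially]) auto
qed

end

section \<open>Convergence of the weighted empirical process\<close>

context iid_field
begin

lemma emp_linear_combination:
  assumes "finite L"
  shows "(\<Sum>t\<in>T. c t * emp a L \<omega> t) = wsum a (\<lambda>x. \<Sum>t\<in>T. c t * (indicator {..t} x - cdf D t)) L \<omega>"
  unfolding emp_def wsum_def sum_distrib_left by (subst sum.swap) (simp add: mult_ac)

text \<open>This is the Cramer--Wold device: a linear combination of evaluations is a single
  weighted sum of a bounded centered \<open>f\<close>. Its variance is the bridge form, since the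
  product of the indicators of \<open>{..s}\<close> and \<open>{..t}\<close> has mean
  \<open>min (cdf D s) (cdf D t)\<close>.\<close>

lemma emp_char_tendsto:
  fixes a :: "nat \<Rightarrow> 'l \<Rightarrow> real"
  assumes L: "\<And>n. finite (L n)" and a1: "\<forall>\<^sub>F n in sequentially. (\<Sum>l\<in>L n. (a n l)\<^sup>2) = 1"
    and am: "\<And>n l. l \<in> L n \<Longrightarrow> \<bar>a n l\<bar> \<le> m n" and m: "m \<longlonglongrightarrow> 0" and T: "finite T"
  shows "(\<lambda>n. \<integral>\<omega>. iexp (\<Sum>t\<in>T. c t * emp (a n) (L n) \<omega> t) \<partial>M) \<longlonglongrightarrow>
    of_real (exp (- (\<Sum>s\<in>T. \<Sum>t\<in>T. c s * c t * (min (cdf D s) (cdf D t) - cdf D s * cdf D t)) / 2))"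
proof -
  define e where "e t x = indicator {..t} x - D.prob {..t}" for t x :: real
  define f where "f x = (\<Sum>t\<in>T. c t * e t x)" for x
  define C where "C = (\<Sum>t\<in>T. \<bar>c t\<bar>)"
  define v where "v = (\<integral>x. (f x)\<^sup>2 \<partial>D)"
  note ce = centered_indicator[of "{..s}" "{..t}" for s t, folded e_def, simplified]
  have [measurable]: "e t \<in> borel_measurable borel" for t unfolding e_def[abs_def] by measurable
  have fm [measurable]: "f \<in> borel_measurable borel" unfolding f_def by measurable
  have fC: "\<bar>f x\<bar> \<le> C" for x
    unfolding f_def C_def
  proof (rule order_trans[OF sum_abs], rule sum_mono)
    fix t show "\<bar>c t * e t x\<bar> \<le> \<bar>c t\<bar>"
      using mult_left_mono[OF ce(2)[of t x], of "\<bar>c t\<bar>"] by (simp add: abs_mult)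
  qed
  have ei: "integrable D (e t)" for t by (rule bounded_integrable_D[OF _ ce(2)]) measurable
  have eei: "integrable D (\<lambda>x. e s x * e t x)" for s t
  proof (rule bounded_integrable_D[of _ 1])
    show "\<bar>e s x * e t x\<bar> \<le> 1" for x unfolding abs_mult using ce(2) by (intro mult_le_one) auto
  qed measurable
  have f0: "integral\<^sup>L D f = 0" unfolding f_def using ei ce(3) by (subst Bochner_Integration.integral_sum) auto
  have mi: "D.prob ({..s} \<inter> {..t}) = min (cdf D s) (cdf D t)" for s t
    using D.cdf_nondecreasing[of s t] D.cdf_nondecreasing[of t s]
    by (cases "s \<le> t") (auto simp: cdf_def min_def Int_absorb1 Int_absorb2)
  have ee: "(\<integral>x. e s x * e t x \<partial>D) = min (cdf D s) (cdf D t) - cdf D s * cdf D t" for s t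
  proof -
    have "(\<integral>x. e s x * e t x \<partial>D) = D.prob ({..s} \<inter> {..t}) - D.prob {..s} * D.prob {..t}"
      unfolding e_def by (rule centered_indicator(5)) auto
    then show ?thesis unfolding mi by (simp add: cdf_def)
  qed
  have v: "v = (\<Sum>s\<in>T. \<Sum>t\<in>T. c s * c t * (min (cdf D s) (cdf D t) - cdf D s * cdf D t))"
  proof -
    have "v = (\<integral>x. (\<Sum>s\<in>T. \<Sum>t\<in>T. c s * c t * (e s x * e t x)) \<partial>D)"
      by (simp add: v_def f_def power2_eq_square sum_product mult_ac)
    also have "\<dots> = (\<Sum>s\<in>T. \<Sum>t\<in>T. c s * c t * (\<integral>x. e s x * e t x \<partial>D))"
      using eei by (simp add: Bochner_Integration.integral_sum)
    also have "\<dots> = (\<Sum>s\<in>T. \<Sum>t\<in>T. c s * c t * (min (cdf D s) (cdf D t) - cdf D s * cdf D t))"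
      by (simp only: ee)
    finally show ?thesis .
  qed
  have W: "(\<Sum>t\<in>T. c t * emp (a n) (L n) \<omega> t) = wsum (a n) f (L n) \<omega>" for n \<omega>
    using emp_linear_combination[OF L] by (simp add: f_def[abs_def] e_def cdf_def)
  have ch: "(\<integral>\<omega>. iexp (\<Sum>t\<in>T. c t * emp (a n) (L n) \<omega> t) \<partial>M) = char (distr M borel (wsum (a n) f (L n))) 1" for n
    unfolding W char_def by (subst integral_distr) auto
  have "\<forall>\<^sub>F n in sequentially. m n < 1" using m by (rule order_tendstoD) simp
  with a1 have ev: "\<forall>\<^sub>F n in sequentially. norm (char (distr M borel (wsum (a n) f (L n))) 1 - of_real (exp (- v / 2))) \<le> (C ^ 3 + v\<^sup>2) * m n"
  proof eventually_elim
    case (elim n)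
    then show ?case using char_wsum_approx[OF fm fC f0 v_def L, of "a n" n "m n"] am by simp
  qed
  have "(\<lambda>n. (C ^ 3 + v\<^sup>2) * m n) \<longlonglongrightarrow> 0" using tendsto_mult_left[OF m] by simp
  from Lim_null_comparison[OF ev this] show ?thesis
    unfolding ch v[symmetric] by (simp add: LIM_zero_iff)
qed

text \<open>Composed with \<open>step_of T\<close>, the functional \<open>h\<close> becomes a
  bounded continuous function \<open>G\<close> of finitely many coordinates. The enumeration
  \<open>e\<close> of \<open>T\<close> and its inverse \<open>r\<close> translate to the coordinates
  in \<open>nat\<close> of \<open>fidi_convergence\<close>; \<open>r\<close> takes values in
  \<open>T\<close> at every index, so the moment bounds hold there too.\<close>

lemma emp_fidi_convergence:
  fixes a :: "nat \<Rightarrow> 'l \<Rightarrow> real" and h :: "(real \<Rightarrow> real) \<Rightarrow> real"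
  assumes L: "\<And>n. finite (L n)" and a1: "\<forall>\<^sub>F n in sequentially. (\<Sum>l\<in>L n. (a n l)\<^sup>2) = 1"
    and a2: "\<And>n. (\<Sum>l\<in>L n. (a n l)\<^sup>2) \<le> 1"
    and am: "\<And>n l. l \<in> L n \<Longrightarrow> \<bar>a n l\<bar> \<le> m n" and m: "m \<longlonglongrightarrow> 0"
    and W: "brownian_bridge M' W" and T: "partition01 T"
    and lip: "\<And>x y. x \<in> cadlag \<Longrightarrow> y \<in> cadlag \<Longrightarrow> \<bar>h x - h y\<bar> \<le> K * skorokhod_dist x y" and K: "K \<ge> 0"
    and B: "\<And>x. x \<in> cadlag \<Longrightarrow> \<bar>h x\<bar> \<le> B"
  shows "(\<lambda>n. \<integral>\<omega>. h (step_of T (emp (a n) (L n) \<omega>)) \<partial>M) \<longlonglongrightarrow>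
    (\<integral>\<omega>. h (step_of T (\<lambda>s. W (cdf D s) \<omega>)) \<partial>M')"
proof -
  have M': "prob_space M'" using W by (simp add: brownian_bridge_def gaussian_process_def)
  have finT: "finite T" and neT: "T \<noteq> {}" using T by (auto simp: partition01_def)
  have cT: "countable T" using finT by (rule countable_finite)
  define r where "r = from_nat_into T"
  define e where "e = to_nat_on T"
  have rT: "r i \<in> T" for i unfolding r_def using neT by (rule from_nat_into)
  have re: "r (e t) = t" if "t \<in> T" for t unfolding r_def e_def using cT that by (rule from_nat_into_to_nat_on)
  have inj: "inj_on e T" unfolding e_def using cT by (rule inj_on_to_nat_on)
  have c01: "cdf D s \<in> {0..1}" for s by (simp add: D.cdf_nonneg D.cdf_bounded_prob)
  define G where "G y = h (step_of T (\<lambda>t. y (e t)))" for y :: "nat \<Rightarrow> real"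
  have Ge: "G (\<lambda>i. f (r i)) = h (step_of T f)" for f
  proof -
    have "step_of T (\<lambda>t. f (r (e t))) = step_of T f"
      using re cell_in[OF T] by (auto simp: step_of_def fun_eq_iff)
    then show ?thesis by (simp add: G_def)
  qed
  have reindex: "(\<Sum>i\<in>e ` T. c i * f (r i)) = (\<Sum>t\<in>T. c (e t) * f t)" for c and f :: "real \<Rightarrow> real"
    using re by (subst sum.reindex[OF inj]) simp
  have Wm [measurable]: "W s \<in> borel_measurable M'" if "s \<in> {0..1}" for s
    using brownian_bridge_gaussian[OF W that] by (simp add: gaussian_rv_def)
  have "(\<lambda>n. \<integral>\<omega>. G (\<lambda>i. emp (a n) (L n) \<omega> (r i)) \<partial>M) \<longlonglongrightarrow> (\<integral>\<omega>. G (\<lambda>i. W (cdf D (r i)) \<omega>) \<partial>M')"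
  proof (rule fidi_convergence[where I="e ` T" and C=1 and B=B and G=G and
      Y="\<lambda>n \<omega> i. emp (a n) (L n) \<omega> (r i)" and Z="\<lambda>\<omega> i. W (cdf D (r i)) \<omega>"])
    show "prob_space M" by (rule prob_space_axioms)
    show "(\<lambda>n. \<integral>\<omega>. iexp (\<Sum>i\<in>e ` T. c i * emp (a n) (L n) \<omega> (r i)) \<partial>M) \<longlonglongrightarrow>
        (\<integral>\<omega>. iexp (\<Sum>i\<in>e ` T. c i * W (cdf D (r i)) \<omega>) \<partial>M')" for c
      unfolding reindex[of c "\<lambda>s. W (cdf D s) \<omega>" for \<omega>] reindex brownian_bridge_char[OF W finT c01]
      by (rule emp_char_tendsto[OF L a1 am m finT])
    show "integrable M (\<lambda>\<omega>. (emp (a n) (L n) \<omega> (r i))\<^sup>2) \<and> (\<integral>\<omega>. (emp (a n) (L n) \<omega> (r i))\<^sup>2 \<partial>M) \<le> 1" for n i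
      using emp_second_moment[OF L a2] by blast
    show "integrable M' (\<lambda>\<omega>. (W (cdf D (r i)) \<omega>)\<^sup>2) \<and> (\<integral>\<omega>. (W (cdf D (r i)) \<omega>)\<^sup>2 \<partial>M') \<le> 1" for i
    proof
      define x where "x = cdf D (r i)"
      have x: "x \<in> {0..1}" by (simp add: x_def D.cdf_nonneg D.cdf_bounded_prob)
      show "integrable M' (\<lambda>\<omega>. (W (cdf D (r i)) \<omega>)\<^sup>2)"
        by (rule gaussian_rv_centered(1)[OF M' brownian_bridge_gaussian[OF W c01]])
          (use W c01 in \<open>simp add: brownian_bridge_def\<close>)
      have "(\<integral>\<omega>. W x \<omega> * W x \<omega> \<partial>M') = min x x - x * x" using W x unfolding brownian_bridge_def by blast
      also have "\<dots> \<le> 1" using x zero_le_square[of x] unfolding min.idem atLeastAtMost_iff by linarith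
      finally show "(\<integral>\<omega>. (W (cdf D (r i)) \<omega>)\<^sup>2 \<partial>M') \<le> 1" by (simp add: power2_eq_square x_def)
    qed
    show "\<bar>G y\<bar> \<le> B" for y unfolding G_def by (intro B step_of_cadlag T)
    show "G y = G y'" if "\<And>i. i \<in> e ` T \<Longrightarrow> y i = y' i" for y y'
    proof -
      have "step_of T (\<lambda>t. y (e t)) = step_of T (\<lambda>t. y' (e t))"
        using that cell_in[OF T] by (auto simp: step_of_def fun_eq_iff)
      then show ?thesis by (simp add: G_def)
    qed
    show "continuous_on UNIV G"
    proof (rule continuous_at_imp_continuous_on, rule ballI)
      fix y0 :: "nat \<Rightarrow> real"
      define R where "R y = K * (\<Sum>t\<in>T. \<bar>y (e t) - y0 (e t)\<bar>)" for y :: "nat \<Rightarrow> real"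
      have GR: "\<bar>G y - G y0\<bar> \<le> R y" for y
      proof -
        have "skorokhod_dist (step_of T (\<lambda>t. y (e t))) (step_of T (\<lambda>t. y0 (e t))) \<le> (\<Sum>t\<in>T. \<bar>y (e t) - y0 (e t)\<bar>)"
        proof (rule skorokhod_dist_le_uniform)
          fix s :: real assume s: "s \<in> {0..1}"
          then have "cell T s \<in> T" using cell_in[OF T] by simp
          then have "\<bar>y (e (cell T s)) - y0 (e (cell T s))\<bar> \<le> (\<Sum>t\<in>T. \<bar>y (e t) - y0 (e t)\<bar>)"
            using finT by (intro member_le_sum) auto
          then show "\<bar>step_of T (\<lambda>t. y (e t)) s - step_of T (\<lambda>t. y0 (e t)) s\<bar> \<le> (\<Sum>t\<in>T. \<bar>y (e t) - y0 (e t)\<bar>)"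
            using s by (simp add: step_of_def)
        qed
        then have "K * skorokhod_dist (step_of T (\<lambda>t. y (e t))) (step_of T (\<lambda>t. y0 (e t))) \<le> R y"
          unfolding R_def using K by (rule mult_left_mono)
        then show ?thesis
          unfolding G_def using lip[OF step_of_cadlag[OF T] step_of_cadlag[OF T]] by (meson order_trans)
      qed
      have R0: "R \<midarrow>y0\<rightarrow> 0"
      proof -
        have "continuous_on UNIV R"
          unfolding R_def by (intro continuous_intros continuous_on_product_coordinates)
        then have "isCont R y0" by (simp add: continuous_on_eq_continuous_at)
        then have "R \<midarrow>y0\<rightarrow> R y0" by (simp add: isCont_def)
        then show ?thesis by (simp add: R_def)
      qed
      have "(\<lambda>y. G y - G y0) \<midarrow>y0\<rightarrow> 0"
      proof (rule Lim_null_comparison[OF _ R0])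
        show "\<forall>\<^sub>F y in at y0. norm (G y - G y0) \<le> R y"
          unfolding real_norm_def by (rule always_eventually) (rule allI, rule GR)
      qed
      then show "isCont G y0" by (simp add: isCont_def LIM_zero_iff)
    qed
  qed (use M' finT c01 in \<open>auto intro: Wm\<close>)
  then show ?thesis unfolding Ge[of "emp (a n) (L n) \<omega>" for n \<omega>] Ge[of "\<lambda>s. W (cdf D s) \<omega>" for \<omega>] .
qed

theorem weighted_empirical_process_converges:
  fixes a :: "nat \<Rightarrow> 'l \<Rightarrow> real"
  assumes L: "\<And>n. finite (L n)" and a1: "\<forall>\<^sub>F n in sequentially. (\<Sum>l\<in>L n. (a n l)\<^sup>2) = 1"
    and a2: "\<And>n. (\<Sum>l\<in>L n. (a n l)\<^sup>2) \<le> 1"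
    and am: "\<And>n l. l \<in> L n \<Longrightarrow> \<bar>a n l\<bar> \<le> m n" and m: "m \<longlonglongrightarrow> 0"
    and W: "brownian_bridge M' W"
  shows "converges_weakly_in skorokhod_topology M (\<lambda>n \<omega>. \<lambda>s\<in>{0..1}. emp (a n) (L n) \<omega> s)
    M' (\<lambda>\<omega>. \<lambda>s\<in>{0..1}. W (cdf D s) \<omega>)"
proof -
  interpret S: Metric_space cadlag skorokhod_dist by (rule Metric_space_skorokhod)
  interpret M': prob_space M' using W by (simp add: brownian_bridge_def gaussian_process_def)
  define Y where "Y n \<omega> = (\<lambda>s\<in>{0..1}. emp (a n) (L n) \<omega> s)" for n \<omega>
  define Z where "Z \<omega> = (\<lambda>s\<in>{0..1}. W (cdf D s) \<omega>)" for \<omega>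
  have c01: "cdf D s \<in> {0..1}" for s by (simp add: D.cdf_nonneg D.cdf_bounded_prob)
  have Wm: "W s \<in> borel_measurable M'" if "s \<in> {0..1}" for s
    using brownian_bridge_gaussian[OF W that] by (simp add: gaussian_rv_def)
  have Wc: "continuous_on {0..1} (\<lambda>s. W s \<omega>)" if "\<omega> \<in> space M'" for \<omega>
    using W that by (simp add: brownian_bridge_def)
  have Zc: "Z \<omega> \<in> cadlag" if "\<omega> \<in> space M'" for \<omega>
    unfolding Z_def by (rule continuous_cdf_cadlag[OF Wc[OF that]])
  have Ym: "Y n \<in> measurable M (borel_of skorokhod_topology)" for n
    by (rule measurable_cadlag_process) (simp_all add: Y_def emp_cadlag)
  have Zm: "Z \<in> measurable M' (borel_of skorokhod_topology)"
    by (rule measurable_cadlag_process[OF Zc]) (use Wm[OF c01] in \<open>simp_all add: Z_def\<close>)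
  have S4: "(\<Sum>l\<in>L n. a n l ^ 4) \<le> (m n)\<^sup>2" for n
  proof -
    have "(\<Sum>l\<in>L n. a n l ^ 4) \<le> (\<Sum>l\<in>L n. (m n)\<^sup>2 * (a n l)\<^sup>2)"
    proof (rule sum_mono)
      fix l assume "l \<in> L n"
      then have "(a n l)\<^sup>2 \<le> (m n)\<^sup>2" using power_mono[OF am, of l n 2] by simp
      then have "(a n l)\<^sup>2 * (a n l)\<^sup>2 \<le> (m n)\<^sup>2 * (a n l)\<^sup>2" by (rule mult_right_mono) simp
      then show "a n l ^ 4 \<le> (m n)\<^sup>2 * (a n l)\<^sup>2" by (simp add: power4_eq_xxxx power2_eq_square mult.assoc)
    qed
    also have "\<dots> \<le> (m n)\<^sup>2 * 1" unfolding sum_distrib_left[symmetric] using a2 by (rule mult_left_mono) simp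
    finally show ?thesis by simp
  qed
  \<comment> \<open>Applying \<open>cadlag_partition\<close> to the distribution function itself
    places every large jump of it at a partition point.\<close>
  have "\<exists>T. partition01 T \<and> (\<forall>u\<in>{0..1}. cdf D u - cdf D (cell T u) \<le> 1 / Suc k)" for k
  proof -
    have "0 < 1 / real (Suc k)" by simp
    from cadlag_partition[OF cdf_cadlag this] obtain T where T: "partition01 T"
      and osc: "\<And>s t. 0 \<le> s \<Longrightarrow> s \<le> t \<Longrightarrow> t \<le> 1 \<Longrightarrow> T \<inter> {s<..t} = {} \<Longrightarrow>
        \<bar>(\<lambda>s\<in>{0..1}. cdf D s) s - (\<lambda>s\<in>{0..1}. cdf D s) t\<bar> \<le> 1 / Suc k" by blast
    have "cdf D u - cdf D (cell T u) \<le> 1 / Suc k" if u: "u \<in> {0..1}" for u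
      using osc[of "cell T u" u] cell_01[OF T, of u] cell_le[OF T, of u] cell_gap[OF T, of u] u by auto
    then show ?thesis using T by blast
  qed
  then obtain T where T: "\<And>k. partition01 (T k)"
    and T\<delta>: "\<And>k u. u \<in> {0..1} \<Longrightarrow> cdf D u - cdf D (cell (T k) u) \<le> 1 / Suc k" by metis
  have lim: "(\<lambda>n. \<integral>\<omega>. h (Y n \<omega>) \<partial>M) \<longlonglongrightarrow> (\<integral>\<omega>. h (Z \<omega>) \<partial>M')"
    if lip': "\<And>x y. x \<in> cadlag \<Longrightarrow> y \<in> cadlag \<Longrightarrow> \<bar>h x - h y\<bar> \<le> K' * skorokhod_dist x y"
      and B: "\<And>x. x \<in> cadlag \<Longrightarrow> \<bar>h x\<bar> \<le> B" for h K' B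
  proof (rule LIMSEQ_I)
    fix \<epsilon> :: real assume \<epsilon>: "\<epsilon> > 0"
    then have \<epsilon>8: "\<epsilon> / 8 > 0" by simp
    define K where "K = \<bar>K'\<bar>"
    have K: "K \<ge> 0" by (simp add: K_def)
    have lip: "\<bar>h x - h y\<bar> \<le> K * skorokhod_dist x y" if "x \<in> cadlag" "y \<in> cadlag" for x y
      using lip'[OF that] mult_right_mono[OF abs_ge_self[of K'] skorokhod_dist_nonneg[of x y]]
      by (simp add: K_def)
    note hc = S.Lipschitz_imp_continuous_map[of h K, folded skorokhod_topology_def, OF lip]
    have B0: "0 \<le> B" using B[OF emp_cadlag] by (meson abs_ge_zero order_trans)
    \<comment> \<open>The mass between \<open>cell (T k) s\<close> and \<open>s\<close> is uniformly
      small and each path of \<open>W\<close> is uniformly continuous, so the step functions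
      converge to \<open>Z \<omega>\<close> uniformly.\<close>
    have sZ: "(\<lambda>k. \<integral>\<omega>. h (step_of (T k) (\<lambda>s. W (cdf D s) \<omega>)) \<partial>M') \<longlonglongrightarrow> (\<integral>\<omega>. h (Z \<omega>) \<partial>M')"
    proof (rule integral_dominated_convergence[where w="\<lambda>_. B"])
      show "(\<lambda>\<omega>. h (Z \<omega>)) \<in> borel_measurable M'"
        by (rule borel_of_continuous_map_compose[OF Zm hc])
      show "(\<lambda>\<omega>. h (step_of (T k) (\<lambda>s. W (cdf D s) \<omega>))) \<in> borel_measurable M'" for k
        by (intro borel_of_continuous_map_compose[OF measurable_step_of[OF T] hc] Wm c01)
      show "AE \<omega> in M'. norm (h (step_of (T k) (\<lambda>s. W (cdf D s) \<omega>))) \<le> B" for k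
        using B[OF step_of_cadlag[OF T]] by simp
      show "AE \<omega> in M'. (\<lambda>k. h (step_of (T k) (\<lambda>s. W (cdf D s) \<omega>))) \<longlonglongrightarrow> h (Z \<omega>)"
      proof (rule AE_I2, rule LIMSEQ_I)
        fix \<omega> and e :: real assume w: "\<omega> \<in> space M'" and e: "e > 0"
        define e' where "e' = e / (K + 1)"
        have e': "e' > 0" "K * e' < e" using e K by (simp_all add: e'_def field_simps)
        have "uniformly_continuous_on {0..1} (\<lambda>s. W s \<omega>)"
          by (rule compact_uniformly_continuous[OF Wc[OF w]]) simp
        then obtain d where d: "d > 0"
          "\<And>x y. x \<in> {0..1} \<Longrightarrow> y \<in> {0..1} \<Longrightarrow> \<bar>y - x\<bar> < d \<Longrightarrow> \<bar>W y \<omega> - W x \<omega>\<bar> < e'"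
          by (rule uniformly_continuous_onE[OF _ e'(1)]) (simp add: dist_real_def)
        obtain k0 where k0: "1 / Suc k0 < d" using nat_approx_posE[OF d(1)] by auto
        have "norm (h (step_of (T k) (\<lambda>s. W (cdf D s) \<omega>)) - h (Z \<omega>)) < e" if k: "k \<ge> k0" for k
        proof -
          have "skorokhod_dist (step_of (T k) (\<lambda>s. W (cdf D s) \<omega>)) (Z \<omega>) \<le> e'"
          proof (rule skorokhod_dist_le_uniform)
            fix s :: real assume s: "s \<in> {0..1}"
            have "1 / real (Suc k) \<le> 1 / Suc k0" using k by (intro divide_left_mono) auto
            then have "\<bar>cdf D (cell (T k) s) - cdf D s\<bar> < d"
              using T\<delta>[OF s, of k] k0 D.cdf_nondecreasing[OF cell_le[OF T, of s k]] s by auto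
            then have "\<bar>W (cdf D (cell (T k) s)) \<omega> - W (cdf D s) \<omega>\<bar> < e'" by (intro d(2) c01)
            then show "\<bar>step_of (T k) (\<lambda>s. W (cdf D s) \<omega>) s - Z \<omega> s\<bar> \<le> e'"
              using s by (simp add: step_of_def Z_def)
          qed
          then have "K * skorokhod_dist (step_of (T k) (\<lambda>s. W (cdf D s) \<omega>)) (Z \<omega>) \<le> K * e'"
            using K by (rule mult_left_mono)
          then show ?thesis using lip[OF step_of_cadlag[OF T] Zc[OF w], of k "\<lambda>s. W (cdf D s) \<omega>"] e'(2) by simp
        qed
        then show "\<exists>k0. \<forall>k\<ge>k0. norm (h (step_of (T k) (\<lambda>s. W (cdf D s) \<omega>)) - h (Z \<omega>)) < e" by blast
      qed
    qed simp
    \<comment> \<open>With \<open>l\<close> fixed, \<open>k\<close> makes the \<open>100003\<close>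
      term small and then \<open>n\<close> the fourth-power term. Together with
      \<open>K * (2 * l)\<close>, the two remaining comparisons give at most
      \<open>5 * (\<epsilon> / 8)\<close>.\<close>
    define l where "l = \<epsilon> / (16 * (K + 1))"
    have l: "l > 0" "K * (2 * l) \<le> \<epsilon> / 8"
    proof -
      show "l > 0" using \<epsilon> K by (simp add: l_def)
      have "K * (2 * l) \<le> (K + 1) * (2 * l)" using \<open>l > 0\<close> by simp
      also have "\<dots> = \<epsilon> / 8" using K by (simp add: l_def field_simps)
      finally show "K * (2 * l) \<le> \<epsilon> / 8" .
    qed
    have "(\<lambda>k. 2 * B * (100003 * (1 / real (Suc k)) / l ^ 4)) \<longlonglongrightarrow> 2 * B * (100003 * 0 / l ^ 4)"
      by (intro tendsto_intros LIMSEQ_Suc[OF lim_1_over_n]) (use l in simp)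
    then have "\<forall>\<^sub>F k in sequentially. 2 * B * (100003 * (1 / real (Suc k)) / l ^ 4) < \<epsilon> / 8"
      by (rule order_tendstoD(2)) (use \<epsilon> in simp)
    moreover have "\<forall>\<^sub>F k in sequentially. dist (\<integral>\<omega>. h (step_of (T k) (\<lambda>s. W (cdf D s) \<omega>)) \<partial>M') (\<integral>\<omega>. h (Z \<omega>) \<partial>M') < \<epsilon> / 8"
      by (rule tendstoD[OF sZ \<epsilon>8])
    ultimately have "\<forall>\<^sub>F k in sequentially. 2 * B * (100003 * (1 / real (Suc k)) / l ^ 4) < \<epsilon> / 8 \<and>
        dist (\<integral>\<omega>. h (step_of (T k) (\<lambda>s. W (cdf D s) \<omega>)) \<partial>M') (\<integral>\<omega>. h (Z \<omega>) \<partial>M') < \<epsilon> / 8"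
      by (rule eventually_conj)
    then obtain k where k: "2 * B * (100003 * (1 / real (Suc k)) / l ^ 4) < \<epsilon> / 8"
        "\<bar>(\<integral>\<omega>. h (step_of (T k) (\<lambda>s. W (cdf D s) \<omega>)) \<partial>M') - (\<integral>\<omega>. h (Z \<omega>) \<partial>M')\<bar> < \<epsilon> / 8"
      unfolding eventually_sequentially dist_real_def by blast
    have "(\<lambda>n. 2 * B * ((m n)\<^sup>2 / l ^ 4)) \<longlonglongrightarrow> 2 * B * (0\<^sup>2 / l ^ 4)"
      by (intro tendsto_intros m) (use l in simp)
    then have "\<forall>\<^sub>F n in sequentially. 2 * B * ((m n)\<^sup>2 / l ^ 4) < \<epsilon> / 8"
      by (rule order_tendstoD(2)) (use \<epsilon> in simp)
    moreover have "\<forall>\<^sub>F n in sequentially. dist (\<integral>\<omega>. h (step_of (T k) (emp (a n) (L n) \<omega>)) \<partial>M)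
        (\<integral>\<omega>. h (step_of (T k) (\<lambda>s. W (cdf D s) \<omega>)) \<partial>M') < \<epsilon> / 8"
      by (rule tendstoD[OF emp_fidi_convergence[OF L a1 a2 am m W T lip K B] \<epsilon>8])
    ultimately have "\<forall>\<^sub>F n in sequentially. norm ((\<integral>\<omega>. h (Y n \<omega>) \<partial>M) - (\<integral>\<omega>. h (Z \<omega>) \<partial>M')) < \<epsilon>"
    proof eventually_elim
      case (elim n)
      define S where "S = (\<Sum>l\<in>L n. a n l ^ 4)"
      have "\<bar>(\<integral>\<omega>. h (step_of (T k) (emp (a n) (L n) \<omega>)) \<partial>M) - (\<integral>\<omega>. h (Y n \<omega>) \<partial>M)\<bar> \<le>
          K * (2 * l) + 2 * B * ((100003 * (1 / real (Suc k)) + S) / l ^ 4)"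
        unfolding Y_def S_def by (rule emp_step_approximation[OF L a2 T T\<delta> l(1) lip K B])
      also have "\<dots> = K * (2 * l) + 2 * B * (100003 * (1 / real (Suc k)) / l ^ 4) + 2 * B * (S / l ^ 4)"
        by (simp only: add_divide_distrib distrib_left add.assoc)
      also have "2 * B * (S / l ^ 4) \<le> 2 * B * ((m n)\<^sup>2 / l ^ 4)"
        using S4[of n] B0 l by (intro mult_left_mono divide_right_mono) (auto simp: S_def)
      finally have "\<bar>(\<integral>\<omega>. h (step_of (T k) (emp (a n) (L n) \<omega>)) \<partial>M) - (\<integral>\<omega>. h (Y n \<omega>) \<partial>M)\<bar> < 3 * (\<epsilon> / 8)"
        using k(1) l(2) elim(1) by linarith
      then show ?case using elim(2) k(2) \<epsilon> unfolding dist_real_def real_norm_def by linarith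
    qed
    then show "\<exists>n0. \<forall>n\<ge>n0. norm ((\<integral>\<omega>. h (Y n \<omega>) \<partial>M) - (\<integral>\<omega>. h (Z \<omega>) \<partial>M')) < \<epsilon>"
      unfolding eventually_sequentially .
  qed
  show ?thesis
    unfolding skorokhod_topology_def Y_def[symmetric, abs_def] Z_def[symmetric, abs_def]
  proof (rule S.converges_weakly_in_LipschitzI)
    show "prob_space M" "prob_space M'" by (rule prob_space_axioms M'.prob_space_axioms)+
    show "Y n \<in> measurable M (borel_of S.mtopology)" for n
      using Ym unfolding skorokhod_topology_def .
    show "Z \<in> measurable M' (borel_of S.mtopology)"
      using Zm unfolding skorokhod_topology_def .
    fix h :: "(real \<Rightarrow> real) \<Rightarrow> real" and K B
    assume "\<And>x y. x \<in> cadlag \<Longrightarrow> y \<in> cadlag \<Longrightarrow> \<bar>h x - h y\<bar> \<le> K * skorokhod_dist x y"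
      and "\<And>x. x \<in> cadlag \<Longrightarrow> \<bar>h x\<bar> \<le> B"
    then show "(\<lambda>n. \<integral>\<omega>. h (Y n \<omega>) \<partial>M) \<longlonglongrightarrow> (\<integral>\<omega>. h (Z \<omega>) \<partial>M')"
      by (rule lim[of h K B])
  qed
qed

end

section \<open>Local times as weights over the visited sites\<close>

theorem theorem1p9:
  fixes M :: "'a measure" and M' :: "'b measure"
    and X :: "int ^ 'd \<Rightarrow> 'a \<Rightarrow> real" and F :: "real \<Rightarrow> real"
    and z :: "nat \<Rightarrow> int ^ 'd" and W :: "real \<Rightarrow> 'b \<Rightarrow> real"
  assumes "prob_space M"
    and "prob_space.indep_vars M (\<lambda>_. borel) X UNIV"
    and "\<And>l \<omega>. \<omega> \<in> space M \<Longrightarrow> X l \<omega> \<in> {0..1}"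
    and "\<And>l. cdf (distr M borel (X l)) = F"
    and "brownian_bridge M' W"
    and "(\<lambda>n. (real (max_local_time z n))\<^sup>2 / real (self_intersections z n)) \<longlonglongrightarrow> 0"
  shows "converges_weakly_in skorokhod_topology M (empirical_process X F z)
           M' (\<lambda>\<omega>. \<lambda>s\<in>{0..1}. W (F s) \<omega>)"
proof -
  interpret prob_space M by fact
  have Xm: "X l \<in> borel_measurable M" for l using assms(2) by (auto simp: indep_vars_def)
  define D where "D = distr M borel (X undefined)"
  \<comment> \<open>A common distribution function determines a common law.\<close>
  have law: "distr M borel (X l) = D" for l
    unfolding D_def
    by (rule cdf_unique) (simp_all add: assms(4) real_distribution_distr Xm)
  interpret iid_field M X D by unfold_locales (use assms(2) law in auto)
  have F: "cdf D = F" using assms(4) by (simp add: D_def)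
  define N where "N n l = real (local_time z n l)" for n l
  define L where "L n = z ` {..<n}" for n :: nat
  define V where "V n = real (self_intersections z n)" for n
  define m where "m n = real (max_local_time z n) / sqrt (V n)" for n
  define a where "a n l = N n l / sqrt (V n)" for n l
  have finL: "finite (L n)" for n by (simp add: L_def)
  have sum_N: "(\<Sum>k<n. f (z k)) = (\<Sum>l\<in>L n. N n l * f l)" for n and f :: "_ \<Rightarrow> real"
  proof -
    have "(\<Sum>k<n. f (z k)) = (\<Sum>l\<in>L n. \<Sum>k | k \<in> {..<n} \<and> z k = l. f (z k))"
      unfolding L_def by (rule sum.image_gen) simp
    also have "\<dots> = (\<Sum>l\<in>L n. \<Sum>k | k < n \<and> z k = l. f l)" by (intro sum.cong) auto
    also have "\<dots> = (\<Sum>l\<in>L n. N n l * f l)" by (simp add: N_def local_time_def)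
    finally show ?thesis .
  qed
  have V: "V n = (\<Sum>l\<in>L n. (N n l)\<^sup>2)" for n
  proof -
    \<comment> \<open>Counting the pairs by their first index gives the sum of
      \<open>N n (z j)\<close> over times \<open>j\<close>; regrouping by sites supplies the second
      factor \<open>N n l\<close>.\<close>
    have "{(j, k). j < n \<and> k < n \<and> z j = z k} = (SIGMA j:{..<n}. {k. k < n \<and> z k = z j})" by auto
    then have "self_intersections z n = (\<Sum>j<n. local_time z n (z j))"
      by (simp add: self_intersections_def local_time_def)
    then have "V n = (\<Sum>j<n. N n (z j))" by (simp add: V_def N_def)
    then show ?thesis by (simp add: sum_N power2_eq_square)
  qed
  have V0: "V n > 0" if "n \<ge> 1" for n
  proof -
    have "z 0 \<in> L n" using that by (auto simp: L_def)
    moreover have "0 \<in> {k. k < n \<and> z k = z 0}" using that by simp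
    then have "local_time z n (z 0) > 0" unfolding local_time_def by (subst card_gt_0_iff) auto
    then have "(N n (z 0))\<^sup>2 > 0" by (simp add: N_def)
    ultimately show ?thesis unfolding V using finL by (intro sum_pos2) auto
  qed
  \<comment> \<open>The quotient is \<open>1\<close> for \<open>n \<ge> 1\<close> and, by the
    convention for division by zero, \<open>0\<close> for \<open>n = 0\<close>.\<close>
  have asum: "(\<Sum>l\<in>L n. (a n l)\<^sup>2) = V n / V n" for n
    by (simp add: a_def power_divide sum_divide_distrib[symmetric] V[symmetric]) (simp add: V_def)
  have emp: "empirical_process X F z = (\<lambda>n \<omega>. \<lambda>s\<in>{0..1}. emp (a n) (L n) \<omega> s)"
  proof (intro ext)
    fix n \<omega> s
    show "empirical_process X F z n \<omega> s = (\<lambda>s\<in>{0..1}. emp (a n) (L n) \<omega> s) s"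
      using sum_N[of "\<lambda>l. indicator {..s} (X l \<omega>) - F s" n]
      by (auto simp: empirical_process_def emp_def wsum_def F a_def V_def indicator_def of_bool_def sum_divide_distrib[symmetric])
  qed
  have "converges_weakly_in skorokhod_topology M (\<lambda>n \<omega>. \<lambda>s\<in>{0..1}. emp (a n) (L n) \<omega> s)
    M' (\<lambda>\<omega>. \<lambda>s\<in>{0..1}. W (cdf D s) \<omega>)"
  proof (rule weighted_empirical_process_converges[OF finL, where m=m])
    show "\<forall>\<^sub>F n in sequentially. (\<Sum>l\<in>L n. (a n l)\<^sup>2) = 1"
      unfolding asum by (rule eventually_sequentiallyI[of 1]) (use V0 in force)
    show "(\<Sum>l\<in>L n. (a n l)\<^sup>2) \<le> 1" for n unfolding asum by simp
    show "\<bar>a n l\<bar> \<le> m n" for n l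
    proof -
      have "local_time z n l \<le> max_local_time z n"
        unfolding max_local_time_def by (intro Max_ge finite_range_local_time) auto
      then show ?thesis unfolding a_def m_def N_def by (simp add: divide_right_mono V_def)
    qed
    \<comment> \<open>The bound \<open>m n\<close> on the weights is the square root of the ratio in
      the hypothesis.\<close>
    have "(\<lambda>n. sqrt ((real (max_local_time z n))\<^sup>2 / V n)) \<longlonglongrightarrow> sqrt 0"
      using assms(6) unfolding V_def by (rule tendsto_real_sqrt)
    then show "m \<longlonglongrightarrow> 0" by (simp add: m_def[abs_def] real_sqrt_divide)
  qed fact
  then show ?thesis unfolding emp F .
qed

end
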